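(* Let $a_1,a_2,b_1,b_2\in\mathbb{C}^*$ and $t=q^\tau$ satisfy $|q\,t^{2i-2}|<1$ and $q<|a_1a_2b_1b_2t^{2i-2}|$ for $i=1,\ldots,n$. Suppose $\tau\notin\mathbb{Z}_+=\{1,2,\ldots\}$. For $i=0,1,\ldots,n$ let $$ H_i(x_1,x_2):= \prod_{j=1}^{i}\frac{\theta(x_2b_1t^{n-j})\theta(x_2b_2t^{n-j})}{\theta(t^{j})\theta(x_2x_1^{-1}t^{n-i-j+1})} \prod_{k=1}^{n-i}\frac{\theta(x_1b_1t^{n-k})\theta(x_1b_2t^{n-k})}{\theta(t^{k})\theta(x_1x_2^{-1}t^{i-k+1})} \prod_{l=1}^n\frac{\theta(t^l)}{\theta(x_1x_2b_1b_2t^{n+l-2})}. $$ Then there is a constant $C_1$, independent of $x_1$ and $x_2$, such that $$\sum_{i=0}^{n}\mathcal{J}(\zeta_i(x_1,x_2))\,H_i(x_1,x_2)=C_1$$ for all $x_1,x_2\in\mathbb{C}^*$ (for which no denominator vanishes).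
   Context: Fix $0<q<1$ and an integer $n\ge1$. Put $(a)_\infty=\prod_{i\ge0}(1-q^ia)$ and $\theta(a)=(a)_\infty(q/a)_\infty$. Let $t=q^\tau$, $$\Phi(z)=\prod_{i=1}^n z_i\frac{(qa_1^{-1}z_i)_\infty(qa_2^{-1}z_i)_\infty}{(b_1z_i)_\infty(b_2z_i)_\infty}\prod_{1\le j<k\le n}z_j^{2\tau-1}\frac{(qt^{-1}z_k/z_j)_\infty}{(tz_k/z_j)_\infty},\qquad \Delta(z)=\prod_{1\le i<j\le n}(z_i-z_j),$$ $J(x)=(1-q)^n\sum_{\nu\in\mathbb{Z}^n}\Phi(xq^\nu)\Delta(xq^\nu)$ with $xq^\nu=(x_1q^{\nu_1},\ldots,x_nq^{\nu_n})$, which converges absolutely under the stated conditions (away from poles), and $$\mathcal{J}(x)=\frac{J(x)}{h(x)},\qquad h(x)=\prod_{i=1}^n\frac{x_i}{\theta(b_1x_i)\theta(b_2x_i)}\prod_{1\le j<k\le n}x_j^{2\tau}\frac{\theta(x_k/x_j)}{\theta(tx_k/x_j)}.$$ $\mathcal{J}$ (the regularization of $J$) extends to a holomorphic function on $(\mathbb{C}^* )^n$, and $\mathcal{J}(\zeta)$ denotes the value of this extension. The same choice of logarithms of the $x_i$ is used in $J$ and $h$, with $(xq^\nu)^s=x^sq^{s\nu}$, so $\mathcal{J}$ is single-valued. For $x_1,x_2\in\mathbb{C}^*$ and $0\le i\le n$, $$\zeta_i(x_1,x_2)=(x_1,x_1t,\ldots,x_1t^{i-1},\,x_2,x_2t,\ldots,x_2t^{n-i-1})\in(\mathbb{C}^*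 )^n .$$ Since $\tau$ is determined by $t$ only modulo $2\pi\sqrt{-1}/\log q$, the condition $\tau\notin\mathbb{Z}_+$ is understood as $t\neq q^m$ for every $m\in\mathbb{Z}_+$. *)

theory Defs
  imports "HOL-Analysis.Analysis"
begin

definition qpoch :: "real \<Rightarrow> complex \<Rightarrow> complex" where
  "qpoch q a = prodinf (\<lambda>i. 1 - of_real q ^ i * a)"

definition theta :: "real \<Rightarrow> complex \<Rightarrow> complex" where
  "theta q a = qpoch q a * qpoch q (of_real q / a)"

text \<open>
  A point of \<open>(\<complex>\<^sup>*)\<^sup>n\<close> is a function in \<open>torus n\<close>, with coordinates indexed by
  \<open>1,\<dots>,n\<close>.  The complex powers in the integrand depend on logarithms of the coordinates,
  so the functions \<open>Phi\<close>, \<open>Jsum\<close>, \<open>hfun\<close> below take a vector \<open>u\<close> of logarithms; the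
  corresponding point is \<open>expt n u\<close> and \<open>z\<^sub>j\<^sup>s\<close> is \<open>exp (s * u j)\<close>.
\<close>

definition torus :: "nat \<Rightarrow> (nat \<Rightarrow> complex) set" where
  "torus n = {1..n} \<rightarrow>\<^sub>E (- {0})"

definition expt :: "nat \<Rightarrow> (nat \<Rightarrow> complex) \<Rightarrow> nat \<Rightarrow> complex" where
  "expt n u = (\<lambda>i\<in>{1..n}. exp (u i))"

definition qpower :: "real \<Rightarrow> complex \<Rightarrow> complex" where
  "qpower q \<tau> = of_real q powr \<tau>"

definition Phi ::
  "real \<Rightarrow> complex \<Rightarrow> complex \<Rightarrow> complex \<Rightarrow> complex \<Rightarrow> complex \<Rightarrow> nat \<Rightarrow> (nat \<Rightarrow> complex) \<Rightarrow> complex" where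
  "Phi q \<tau> a1 a2 b1 b2 n u =
    (let t = qpower q \<tau>; z = expt n u in
      (\<Prod>i=1..n. z i * (qpoch q (of_real q * inverse a1 * z i) * qpoch q (of_real q * inverse a2 * z i))
                 / (qpoch q (b1 * z i) * qpoch q (b2 * z i))) *
      (\<Prod>k=1..n. \<Prod>j\<in>{1..<k}. exp ((2 * \<tau> - 1) * u j) *
          (qpoch q (of_real q * inverse t * (z k / z j)) / qpoch q (t * (z k / z j)))))"

definition Delta :: "nat \<Rightarrow> (nat \<Rightarrow> complex) \<Rightarrow> complex" where
  "Delta n z = (\<Prod>j=1..n. \<Prod>i\<in>{1..<j}. z i - z j)"

text \<open>The shift \<open>x \<mapsto> x q\<^sup>\<nu>\<close>, on the level of logarithms.\<close>

definition qshift :: "real \<Rightarrow> (nat \<Rightarrow> int) \<Rightarrow> (nat \<Rightarrow> complex) \<Rightarrow> nat \<Rightarrow> complex" where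
  "qshift q \<nu> u = (\<lambda>i. u i + of_int (\<nu> i) * of_real (ln q))"

definition Jsum ::
  "real \<Rightarrow> complex \<Rightarrow> complex \<Rightarrow> complex \<Rightarrow> complex \<Rightarrow> complex \<Rightarrow> nat \<Rightarrow> (nat \<Rightarrow> complex) \<Rightarrow> complex" where
  "Jsum q \<tau> a1 a2 b1 b2 n u =
    (1 - of_real q) ^ n *
    (\<Sum>\<^sub>\<infinity>\<nu> \<in> {1..n} \<rightarrow>\<^sub>E (UNIV :: int set).
        Phi q \<tau> a1 a2 b1 b2 n (qshift q \<nu> u) * Delta n (expt n (qshift q \<nu> u)))"

definition hfun ::
  "real \<Rightarrow> complex \<Rightarrow> complex \<Rightarrow> complex \<Rightarrow> nat \<Rightarrow> (nat \<Rightarrow> complex) \<Rightarrow> complex" where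
  "hfun q \<tau> b1 b2 n u =
    (let t = qpower q \<tau>; x = expt n u in
      (\<Prod>i=1..n. x i / (theta q (b1 * x i) * theta q (b2 * x i))) *
      (\<Prod>k=1..n. \<Prod>j\<in>{1..<k}. exp (2 * \<tau> * u j) * (theta q (x k / x j) / theta q (t * (x k / x j)))))"

text \<open>
  The points at which \<open>J/h\<close> is defined: those at which no denominator occurring in \<open>h\<close>
  (equivalently, in some term of \<open>J\<close>) vanishes and, moreover, \<open>h\<close> is nonzero.
\<close>

definition regular_point :: "real \<Rightarrow> complex \<Rightarrow> complex \<Rightarrow> complex \<Rightarrow> nat \<Rightarrow> (nat \<Rightarrow> complex) \<Rightarrow> bool" where
  "regular_point q \<tau> b1 b2 n x \<longleftrightarrow>
    (\<forall>i\<in>{1..n}. theta q (b1 * x i) \<noteq> 0 \<and> theta q (b2 * x i) \<noteq> 0) \<and>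
    (\<forall>k\<in>{1..n}. \<forall>j\<in>{1..<k}. theta q (qpower q \<tau> * (x k / x j)) \<noteq> 0 \<and> theta q (x k / x j) \<noteq> 0)"

text \<open>
  Holomorphy in several variables: continuous and holomorphic in each variable separately.
  The topology on \<open>torus n\<close> is that of \<open>(\<complex>\<^sup>*)\<^sup>n\<close>, since the remaining coordinates are constant.
\<close>

definition holomorphic_on_torus :: "nat \<Rightarrow> ((nat \<Rightarrow> complex) \<Rightarrow> complex) \<Rightarrow> bool" where
  "holomorphic_on_torus n F \<longleftrightarrow>
    continuous_on (torus n) F \<and>
    (\<forall>x\<in>torus n. \<forall>i\<in>{1..n}. (\<lambda>w. F (x(i := w))) holomorphic_on (- {0}))"

text \<open>
  The regularization \<open>J/h\<close>, extended to the whole torus.  The same logarithms \<open>u\<close> enter \<open>J\<close>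
  and \<open>h\<close>, and every choice of them is required to give the same value.  As regular points
  are dense, all extensions agree on \<open>torus n\<close>, so that the choice operator is harmless.
\<close>

definition Jreg ::
  "real \<Rightarrow> complex \<Rightarrow> complex \<Rightarrow> complex \<Rightarrow> complex \<Rightarrow> complex \<Rightarrow> nat \<Rightarrow> (nat \<Rightarrow> complex) \<Rightarrow> complex" where
  "Jreg q \<tau> a1 a2 b1 b2 n =
    (SOME F. holomorphic_on_torus n F \<and>
      (\<forall>u. regular_point q \<tau> b1 b2 n (expt n u) \<longrightarrow>
           F (expt n u) = Jsum q \<tau> a1 a2 b1 b2 n u / hfun q \<tau> b1 b2 n u))"

definition zeta_pt :: "complex \<Rightarrow> nat \<Rightarrow> nat \<Rightarrow> complex \<Rightarrow> complex \<Rightarrow> nat \<Rightarrow> complex" where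
  "zeta_pt t n i x1 x2 =
    (\<lambda>j\<in>{1..n}. if j \<le> i then x1 * t ^ (j - 1) else x2 * t ^ (j - i - 1))"

definition Hcoef ::
  "real \<Rightarrow> complex \<Rightarrow> complex \<Rightarrow> complex \<Rightarrow> nat \<Rightarrow> nat \<Rightarrow> complex \<Rightarrow> complex \<Rightarrow> complex" where
  "Hcoef q t b1 b2 n i x1 x2 =
    (\<Prod>j=1..i. (theta q (x2 * b1 * t ^ (n - j)) * theta q (x2 * b2 * t ^ (n - j)))
        / (theta q (t ^ j) * theta q (x2 * inverse x1 * t powi (int n - int i - int j + 1)))) *
    (\<Prod>k=1..n-i. (theta q (x1 * b1 * t ^ (n - k)) * theta q (x1 * b2 * t ^ (n - k)))
        / (theta q (t ^ k) * theta q (x1 * inverse x2 * t powi (int i - int k + 1)))) *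
    (\<Prod>l=1..n. theta q (t ^ l) / theta q (x1 * x2 * b1 * b2 * t ^ (n + l - 2)))"

text \<open>No denominator of \<open>Hcoef q t b1 b2 n i x1 x2\<close> vanishes.\<close>

definition Hcoef_defined ::
  "real \<Rightarrow> complex \<Rightarrow> complex \<Rightarrow> complex \<Rightarrow> nat \<Rightarrow> nat \<Rightarrow> complex \<Rightarrow> complex \<Rightarrow> bool" where
  "Hcoef_defined q t b1 b2 n i x1 x2 \<longleftrightarrow>
    (\<forall>j\<in>{1..i}. theta q (t ^ j) \<noteq> 0 \<and>
        theta q (x2 * inverse x1 * t powi (int n - int i - int j + 1)) \<noteq> 0) \<and>
    (\<forall>k\<in>{1..n-i}. theta q (t ^ k) \<noteq> 0 \<and>
        theta q (x1 * inverse x2 * t powi (int i - int k + 1)) \<noteq> 0) \<and>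
    (\<forall>l\<in>{1..n}. theta q (x1 * x2 * b1 * b2 * t ^ (n + l - 2)) \<noteq> 0)"

end

theory Submission
  imports Defs "HOL-Complex_Analysis.Complex_Analysis"
begin

text \<open>
  The function \<open>\<J>\<close> is symmetric and satisfies \<open>\<J>(\<dots>, q x\<^sub>i, \<dots>) = \<J>(x) / (q \<kappa> x\<^sub>i\<^sup>2)\<close> with
  \<open>\<kappa> = b\<^sub>1 b\<^sub>2 t\<^sup>n\<^sup>-\<^sup>1\<close>.  A function of one variable with this quasi-periodicity is determined by
  its values at two generic nodes.  Apply this to \<open>\<J>(1/b\<^sub>1, 1/(b\<^sub>1 t), \<dots>, 1/(b\<^sub>1 t\<^sup>n\<^sup>-\<^sup>1))\<close>, one
  variable after the other, with the nodes \<open>x\<^sub>1 t\<^sup>i\<close> and \<open>x\<^sub>2 t\<^sup>m\<^sup>-\<^sup>i\<close> if \<open>m\<close> variables have already been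
  replaced and \<open>i\<close> of them by \<open>x\<^sub>1\<close>-nodes.  By symmetry the result is a combination of the
  \<open>\<J>(\<zeta>\<^sub>i(x\<^sub>1, x\<^sub>2))\<close>, and the three term relation for \<open>\<theta>\<close> shows that the coefficients are the
  \<open>H\<^sub>i(x\<^sub>1, x\<^sub>2)\<close>.  So \<open>C\<^sub>1 = \<J>(1/b\<^sub>1, \<dots>, 1/(b\<^sub>1 t\<^sup>n\<^sup>-\<^sup>1))\<close>.

  The same interpolation, with generic nodes, yields the holomorphic extension: after the poles of
  the summands have been removed, \<open>J\<close> becomes a holomorphic function \<open>G\<close> that is antisymmetric like
  \<open>D = \<Prod>\<^sub>j\<^sub><\<^sub>k x\<^sub>j \<theta>(x\<^sub>k/x\<^sub>j)\<close>, and \<open>J/h = (1 - q)\<^sup>n G/D\<close>.  In every variable the zeros of \<open>D\<close> are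
  cancelled by those of \<open>G\<close>, so \<open>G/D\<close> equals its interpolation, which is a finite sum of
  products of theta functions.
\<close>

subsection \<open>Theta functions\<close>

text \<open>\<open>Jreg\<close> is a choice, so nothing is known about it before some extension has
  been constructed. The zeros of \<open>D\<close> form hypersurfaces that meet one another, and
  removing singularities in one variable at a time says nothing about joint continuity where they
  meet; a finite interpolation sum is continuous and holomorphic in each variable at once. The
  multiplier has two sources. The summation lattice is invariant under shifts, so J is unchanged
  when x_i becomes q x_i. In h, the factor x_i / (\<theta>(b1 x_i) \<theta>(b2 x_i)) is multiplied
  by q b1 b2 x_i^2, and each of the n - 1 pairs containing i contributes one factor t, whichever of
  its two members is shifted. The points 1 / (b1 t^j) form a progression of ratio t, as the nodes
  do. Powers of t therefore cancel in the interpolation coefficients, and the sum over all orders in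
  which nodes can be chosen has a closed product form.\<close>

locale q_base =
  fixes q :: real
  assumes q_pos: "0 < q" and q_less_1: "q < 1"
begin

abbreviation "qc \<equiv> complex_of_real q"
abbreviation "qp \<equiv> qpoch q"
abbreviation "\<theta> \<equiv> theta q"

lemma q_nonzero [simp]: "q \<noteq> 0"
  using q_pos by simp

lemma summable_qpoch: "summable (\<lambda>i. norm (- (qc ^ i * a)))"
proof -
  have "summable (\<lambda>i. q ^ i * norm a)"
    using q_pos q_less_1 by (intro summable_mult2 summable_geometric) auto
  then show ?thesis
    using q_pos by (simp add: norm_mult norm_power)
qed

lemma convergent_qpoch: "convergent_prod (\<lambda>i. 1 - qc ^ i * a)"
proof -
  have "abs_convergent_prod (\<lambda>i. 1 + (- (qc ^ i * a)))"
    using summable_qpoch by (intro summable_imp_abs_convergent_prod) simp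
  then show ?thesis
    using abs_convergent_prod_imp_convergent_prod by force
qed

lemma qpoch_tendsto: "(\<lambda>n. \<Prod>i<n. 1 - qc ^ i * a) \<longlonglongrightarrow> qp a"
  unfolding qpoch_def using convergent_prod_has_prod[OF convergent_qpoch]
  by (rule has_prod_imp_tendsto')

lemma qpoch_rec: "qp a = (1 - a) * qp (qc * a)"
proof -
  have "(\<lambda>n. \<Prod>i<Suc n. 1 - qc ^ i * a) \<longlonglongrightarrow> qp a"
    using qpoch_tendsto by (rule LIMSEQ_Suc)
  moreover have "(\<Prod>i<Suc n. 1 - qc ^ i * a) = (1 - a) * (\<Prod>i<n. 1 - qc ^ i * (qc * a))" for n
    by (simp add: prod.lessThan_Suc_shift mult_ac del: prod.lessThan_Suc)
  moreover have "(\<lambda>n. (1 - a) * (\<Prod>i<n. 1 - qc ^ i * (qc * a))) \<longlonglongrightarrow> (1 - a) * qp (qc * a)"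
    by (intro tendsto_mult tendsto_const qpoch_tendsto)
  ultimately show ?thesis
    by (simp add: LIMSEQ_unique)
qed

lemma qpoch_eq_0_iff: "qp a = 0 \<longleftrightarrow> (\<exists>i. qc ^ i * a = 1)"
proof -
  have "(\<lambda>i. 1 - qc ^ i * a) has_prod qp a"
    unfolding qpoch_def by (rule convergent_prod_has_prod[OF convergent_qpoch])
  from has_prod_eq_0_iff[OF this] show ?thesis
    by auto
qed

text \<open>The bound is independent of the number of factors. Besides giving
  \<open>norm_qpoch_le\<close> in the limit, it serves for the finite products in
  \<open>regq_bound_nonneg\<close>.\<close>

lemma norm_prod_qpoch_le:
  assumes "norm a \<le> r"
  shows "norm (\<Prod>i<n. 1 - qc ^ i * a) \<le> exp (r / (1 - q))"
proof -
  have "norm (\<Prod>i<n. 1 - qc ^ i * a) \<le> (\<Prod>i<n. 1 + q ^ i * r)"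
    unfolding prod_norm[symmetric]
  proof (intro prod_mono conjI)
    fix i
    have "norm (1 - qc ^ i * a) \<le> 1 + norm (qc ^ i * a)"
      using norm_triangle_ineq4[of 1 "qc ^ i * a"] by simp
    also have "\<dots> \<le> 1 + q ^ i * r"
      using assms q_pos by (simp add: norm_mult norm_power mult_left_mono)
    finally show "norm (1 - qc ^ i * a) \<le> 1 + q ^ i * r" .
  qed auto
  also have "\<dots> \<le> exp (\<Sum>i<n. q ^ i * r)"
  proof (rule prod_le_exp_sum)
    have "0 \<le> r" using assms norm_ge_zero order_trans by blast
    then show "\<And>i. i \<in> {..<n} \<Longrightarrow> 0 \<le> q ^ i * r"
      using q_pos by simp
  qed
  also have "(\<Sum>i<n. q ^ i * r) \<le> (1 / (1 - q)) * r"
  proof -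
    have "(\<Sum>i<n. q ^ i) \<le> (\<Sum>i. q ^ i)"
      using q_pos q_less_1 by (intro sum_le_suminf summable_geometric) auto
    also have "\<dots> = 1 / (1 - q)"
      using q_pos q_less_1 by (intro suminf_geometric) auto
    finally show ?thesis
      unfolding sum_distrib_right[symmetric]
      using assms norm_ge_zero order_trans by (intro mult_right_mono) blast+
  qed
  finally show ?thesis
    by simp
qed

lemma norm_qpoch_le:
  assumes "norm a \<le> r"
  shows "norm (qp a) \<le> exp (r / (1 - q))"
  using LIMSEQ_le_const2[OF tendsto_norm[OF qpoch_tendsto]] norm_prod_qpoch_le[OF assms]
  by blast

lemma qpoch_holomorphic_UNIV: "qp holomorphic_on UNIV"
proof (rule holomorphic_uniform_sequence)
  show "(\<lambda>z. \<Prod>i<n. 1 - qc ^ i * z) holomorphic_on UNIV" for n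
    by (intro holomorphic_intros)
  fix x :: complex
  let ?A = "cball x 1"
  have "uniformly_convergent_on ?A (\<lambda>N z. \<Prod>n<N. 1 + (- (qc ^ n * z)))"
  proof (rule uniformly_convergent_on_prod)
    show "uniformly_convergent_on ?A (\<lambda>N z. \<Sum>n<N. norm (- (qc ^ n * z)))"
    proof (rule Weierstrass_m_test')
      fix n z assume "z \<in> ?A"
      then have "norm z \<le> norm x + 1"
        using norm_triangle_ineq2[of z x] by (simp add: dist_norm norm_minus_commute)
      then show "norm (norm (- (qc ^ n * z))) \<le> q ^ n * (norm x + 1)"
        using q_pos by (simp add: norm_mult norm_power mult_left_mono)
    next
      show "summable (\<lambda>n. q ^ n * (norm x + 1))"
        using q_pos q_less_1 by (intro summable_mult2 summable_geometric) auto
    qed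
  qed (auto intro!: continuous_intros)
  then obtain g where g: "uniform_limit ?A (\<lambda>N z. \<Prod>n<N. 1 - qc ^ n * z) g sequentially"
    by (auto simp: uniformly_convergent_on_def)
  have "g z = qp z" if "z \<in> ?A" for z
    using tendsto_uniform_limitI[OF g that] qpoch_tendsto LIMSEQ_unique by blast
  then have "uniform_limit ?A (\<lambda>N z. \<Prod>n<N. 1 - qc ^ n * z) qp sequentially"
    by (intro uniform_limit_cong'[THEN iffD1, OF _ _ g]) auto
  then show "\<exists>d>0. cball x d \<subseteq> UNIV \<and>
      uniform_limit (cball x d) (\<lambda>N z. \<Prod>n<N. 1 - qc ^ n * z) qp sequentially"
    by (intro exI[of _ 1]) auto
qed auto

lemma qpoch_holomorphic [holomorphic_intros]:
  "f holomorphic_on S \<Longrightarrow> (\<lambda>z. qp (f z)) holomorphic_on S"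
  using holomorphic_on_compose_gen[OF _ qpoch_holomorphic_UNIV, of f S] by (simp add: o_def)

lemma qpoch_continuous [continuous_intros]:
  "continuous_on S f \<Longrightarrow> continuous_on S (\<lambda>z. qp (f z))"
  using continuous_on_compose2[OF holomorphic_on_imp_continuous_on[OF qpoch_holomorphic_UNIV]]
  by auto

lemma theta_holomorphic [holomorphic_intros]:
  "f holomorphic_on S \<Longrightarrow> (\<And>z. z \<in> S \<Longrightarrow> f z \<noteq> 0) \<Longrightarrow> (\<lambda>z. \<theta> (f z)) holomorphic_on S"
  unfolding theta_def by (intro holomorphic_intros) auto

lemma theta_continuous [continuous_intros]:
  "continuous_on S f \<Longrightarrow> (\<And>z. z \<in> S \<Longrightarrow> f z \<noteq> 0) \<Longrightarrow> continuous_on S (\<lambda>z. \<theta> (f z))"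
  unfolding theta_def by (intro continuous_intros) auto

lemma theta_qc_mult:
  assumes "x \<noteq> 0"
  shows "\<theta> (qc * x) = - \<theta> x / x"
proof -
  have "\<theta> (qc * x) = qp (qc * x) * qp (1 / x)"
    by (simp add: theta_def)
  also have "qp (1 / x) = (1 - 1 / x) * qp (qc / x)"
    using qpoch_rec[of "1 / x"] by simp
  also have "qp (qc * x) * \<dots> = - ((1 - x) * qp (qc * x)) * qp (qc / x) / x"
    using assms by (simp add: field_simps)
  also have "\<dots> = - \<theta> x / x"
    by (simp add: theta_def qpoch_rec[of x, symmetric])
  finally show ?thesis .
qed

lemma theta_qc_divide: "x \<noteq> 0 \<Longrightarrow> \<theta> (qc / x) = \<theta> x"
  by (simp add: theta_def)

lemma theta_inverse: "x \<noteq> 0 \<Longrightarrow> \<theta> (1 / x) = - \<theta> x / x"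
  using theta_qc_divide[of "qc * x"] theta_qc_mult[of x] by (simp add: field_simps)

lemma theta_swap: "x \<noteq> 0 \<Longrightarrow> y \<noteq> 0 \<Longrightarrow> \<theta> (x / y) = - (x / y) * \<theta> (y / x)"
  using theta_inverse[of "y / x"] by simp

lemma theta_one [simp]: "\<theta> 1 = 0"
  using qpoch_rec[of 1] by (simp add: theta_def)

section \<open>Location and simplicity of the zeros of theta\<close>

lemma theta_qc_powi:
  assumes "x \<noteq> 0"
  shows "\<theta> (x * qc powi d) = 0 \<longleftrightarrow> \<theta> x = 0"
proof (induction d rule: int_induct[where k = 0])
  case (step1 i)
  have "\<theta> (x * qc powi (i + 1)) = \<theta> (qc * (x * qc powi i))"
    by (simp add: power_int_add ac_simps)
  then show ?case
    using assms step1 theta_qc_mult[of "x * qc powi i"] by auto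
next
  case (step2 i)
  have "\<theta> (x * qc powi i) = \<theta> (qc * (x * qc powi (i - 1)))"
    by (simp add: power_int_diff mult_ac)
  then show ?case
    using assms step2 theta_qc_mult[of "x * qc powi (i - 1)"] by auto
qed simp

lemma theta_eq_0_iff:
  assumes "x \<noteq> 0"
  shows "\<theta> x = 0 \<longleftrightarrow> (\<exists>d. x = qc powi d)"
proof
  assume "\<theta> x = 0"
  then consider i where "qc ^ i * x = 1" | i where "qc ^ i * (qc / x) = 1"
    by (auto simp: theta_def qpoch_eq_0_iff)
  then show "\<exists>d. x = qc powi d"
  proof cases
    case 1
    then have "x = qc powi (- int i)"
      by (simp add: power_int_minus field_simps)
    then show ?thesis ..
  next
    case 2
    then have "x = qc powi (int (Suc i))"
      using assms unfolding power_int_of_nat by (simp add: field_simps)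
    then show ?thesis ..
  qed
next
  assume "\<exists>d. x = qc powi d"
  then show "\<theta> x = 0"
    using theta_qc_powi[of 1] by auto
qed

text \<open>At 1 the zero comes from the factor 1 - y of \<open>qp y\<close>; the cofactor there is
  minus the square of \<open>qp qc\<close>, nonzero because no positive power of q is 1.
  Quasi-periodicity carries the factorization to the neighbouring powers of q.\<close>

lemma theta_simple_zero:
  "\<exists>h. h holomorphic_on -{0} \<and> h (qc powi d) \<noteq> 0 \<and> (\<forall>y. y \<noteq> 0 \<longrightarrow> \<theta> y = (y - qc powi d) * h y)"
proof (induction d rule: int_induct[where k = 0])
  case base
  have "qp qc \<noteq> 0"
  proof
    assume "qp qc = 0"
    then obtain i where "qc ^ Suc i = 1"
      by (auto simp: qpoch_eq_0_iff mult_ac)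
    then have "q ^ Suc i = 1"
      using of_real_eq_iff[of "q ^ Suc i" 1, where 'a = complex] by simp
    then show False
      using power_Suc_less_one[OF q_pos q_less_1, of i] by simp
  qed
  then have "- qp (qc * 1) * qp (qc / 1) \<noteq> 0"
    by simp
  moreover have "(\<lambda>y. - qp (qc * y) * qp (qc / y)) holomorphic_on -{0}"
    by (auto intro!: holomorphic_intros)
  moreover have "\<theta> y = (y - 1) * (- qp (qc * y) * qp (qc / y))" for y
    by (subst theta_def, subst qpoch_rec[of y]) (simp add: algebra_simps)
  ultimately show ?case
    by (intro exI[of _ "\<lambda>y. - qp (qc * y) * qp (qc / y)"]) simp
next
  case (step1 i)
  then obtain h where h: "h holomorphic_on -{0}" "h (qc powi i) \<noteq> 0"
      "\<And>y. y \<noteq> 0 \<Longrightarrow> \<theta> y = (y - qc powi i) * h y"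
    by blast
  let ?h = "\<lambda>y. - h (y / qc) / y"
  have "(\<lambda>y. h (y / qc)) holomorphic_on -{0}"
    by (intro holomorphic_on_compose_gen[OF _ h(1), unfolded o_def]) (auto intro!: holomorphic_intros)
  then have "?h holomorphic_on -{0}"
    by (auto intro!: holomorphic_intros)
  moreover have "?h (qc powi (i + 1)) \<noteq> 0"
    using h(2) by (simp add: power_int_add)
  moreover have "\<theta> y = (y - qc powi (i + 1)) * ?h y" if "y \<noteq> 0" for y
  proof -
    have "\<theta> y = - \<theta> (y / qc) / (y / qc)"
      using that theta_qc_mult[of "y / qc"] by simp
    also have "\<dots> = - ((y / qc - qc powi i) * h (y / qc)) / (y / qc)"
      using that by (subst h(3)) auto
    also have "\<dots> = (y - qc powi (i + 1)) * ?h y"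
      using that by (simp add: power_int_add field_simps)
    finally show ?thesis .
  qed
  ultimately show ?case
    by (intro exI[of _ ?h]) auto
next
  case (step2 i)
  then obtain h where h: "h holomorphic_on -{0}" "h (qc powi i) \<noteq> 0"
      "\<And>y. y \<noteq> 0 \<Longrightarrow> \<theta> y = (y - qc powi i) * h y"
    by blast
  let ?h = "\<lambda>y. - qc * y * h (qc * y)"
  have "(\<lambda>y. h (qc * y)) holomorphic_on -{0}"
    by (intro holomorphic_on_compose_gen[OF _ h(1), unfolded o_def]) (auto intro!: holomorphic_intros)
  then have "?h holomorphic_on -{0}"
    by (auto intro!: holomorphic_intros)
  moreover have "?h (qc powi (i - 1)) \<noteq> 0"
    using h(2) by (simp add: power_int_diff)
  moreover have "\<theta> y = (y - qc powi (i - 1)) * ?h y" if "y \<noteq> 0" for y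
  proof -
    have "\<theta> y = - y * \<theta> (qc * y)"
      using that theta_qc_mult[of y] by simp
    also have "\<dots> = - y * ((qc * y - qc powi i) * h (qc * y))"
      using that by (subst h(3)) auto
    also have "\<dots> = (y - qc powi (i - 1)) * ?h y"
      by (simp add: power_int_diff field_simps)
    finally show ?thesis .
  qed
  ultimately show ?case
    by (intro exI[of _ ?h]) auto
qed

subsection \<open>Interpolation of theta functions\<close>

text \<open>The zeros of the divisor are simple and fill exactly the orbit z q^d, on which f
  vanishes. So the quotient has only removable singularities, which \<open>remove_sings\<close>
  fills in.\<close>

lemma theta_division:
  assumes f: "f holomorphic_on -{0}" and z: "z \<noteq> 0"
    and zero: "\<And>d. f (z * qc powi d) = 0"
  obtains g where "g holomorphic_on -{0}" "\<And>y. y \<noteq> 0 \<Longrightarrow> f y = \<theta> (y / z) * g y"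
proof -
  define k where "k = (\<lambda>y. f y / \<theta> (y / z))"
  have regular: "k analytic_on {a}" if "a \<noteq> 0" "\<theta> (a / z) \<noteq> 0" for a
    unfolding k_def using that z f
    by (intro analytic_on_divide)
      (auto intro!: holomorphic_on_imp_analytic_at[of _ "-{0}"] holomorphic_intros)
  have singular: "isolated_singularity_at k a \<and> (\<exists>c. k \<midarrow>a\<rightarrow> c)"
    if a: "a \<noteq> 0" "\<theta> (a / z) = 0" for a
  proof -
    from a z obtain d where d: "a = z * qc powi d"
      using theta_eq_0_iff[of "a / z"] by (auto simp: field_simps)
    obtain h where h: "h holomorphic_on -{0}" "h (qc powi d) \<noteq> 0"
        "\<And>y. y \<noteq> 0 \<Longrightarrow> \<theta> y = (y - qc powi d) * h y"
      using theta_simple_zero[of d] by blast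
    define f1 where "f1 = (\<lambda>y. if y = a then deriv f a else (f y - f a) / (y - a))"
    have "f1 holomorphic_on -{0}"
      unfolding f1_def by (rule pole_lemma_open[OF f]) auto
    moreover have "(\<lambda>y. h (y / z)) holomorphic_on -{0}"
      using z by (intro holomorphic_on_compose_gen[OF _ h(1), unfolded o_def])
        (auto intro!: holomorphic_intros)
    ultimately have ana: "(\<lambda>y. f1 y * z / h (y / z)) analytic_on {a}"
      using a d h(2) z
      by (intro analytic_on_divide analytic_on_mult)
        (auto intro!: holomorphic_on_imp_analytic_at[of _ "-{0}"])
    have "\<forall>\<^sub>F y in at a. y \<in> -{0}"
      using a by (intro eventually_at_in_open') auto
    then have ev: "\<forall>\<^sub>F y in at a. k y = f1 y * z / h (y / z)"
      using eventually_neq_at_within[of a a UNIV]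
    proof eventually_elim
      case (elim y)
      have "\<theta> (y / z) = (y - a) / z * h (y / z)"
        using elim z h(3)[of "y / z"] d by (simp add: field_simps)
      moreover have "f y = (y - a) * f1 y"
        using elim zero[of d] d by (simp add: f1_def)
      ultimately show ?case
        using elim z by (simp add: k_def)
    qed
    have "(\<lambda>y. f1 y * z / h (y / z)) \<midarrow>a\<rightarrow> f1 a * z / h (a / z)"
      using analytic_at_imp_isCont[OF ana] by (rule isContD)
    then have "k \<midarrow>a\<rightarrow> f1 a * z / h (a / z)"
      using ev by (simp add: tendsto_cong)
    moreover have "isolated_singularity_at k a"
      using isolated_singularity_at_cong[OF ev refl] isolated_singularity_at_analytic[OF ana] by simp
    ultimately show ?thesis
      by blast
  qed
  have "remove_sings k analytic_on {a}" if "a \<noteq> 0" for a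
  proof (cases "\<theta> (a / z) = 0")
    case True
    then show ?thesis
      using singular[OF that] remove_sings_analytic_at by blast
  next
    case False
    then show ?thesis
      using regular[OF that] remove_sings_analytic_on by blast
  qed
  then have "remove_sings k holomorphic_on -{0}"
    by (intro analytic_imp_holomorphic, subst analytic_on_analytic_at) blast
  moreover have "f y = \<theta> (y / z) * remove_sings k y" if "y \<noteq> 0" for y
  proof (cases "\<theta> (y / z) = 0")
    case True
    with that z obtain d where "y = z * qc powi d"
      using theta_eq_0_iff[of "y / z"] by (auto simp: field_simps)
    then show ?thesis
      using zero True by simp
  next
    case False
    then show ?thesis
      using remove_sings_at_analytic[OF regular[OF that False]] by (simp add: k_def)
  qed
  ultimately show ?thesis
    using that by blast
qed

text \<open>The annulus meets every orbit under multiplication by q and is compact: a bound on it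
  controls a quasi-periodic function everywhere, up to powers of the multiplier.\<close>

lemma annulus_representative:
  fixes y :: complex
  assumes "y \<noteq> 0"
  obtains d where "q \<le> norm (y * qc powi (-d))" "norm (y * qc powi (-d)) \<le> 1"
proof -
  let ?e = "log q (norm y)"
  define d where "d = \<lfloor>?e\<rfloor>"
  have "norm (y * qc powi (-d)) = q powr ?e * q powr (- real_of_int d)"
    using assms q_pos q_less_1 powr_real_of_int'[of q "-d"]
    by (simp add: norm_mult norm_power_int)
  then have n: "norm (y * qc powi (-d)) = q powr (?e - real_of_int d)"
    by (simp add: powr_add[symmetric])
  have "0 \<le> ?e - real_of_int d" "?e - real_of_int d \<le> 1"
    unfolding d_def by linarith+
  then have "q powr 1 \<le> q powr (?e - real_of_int d)" "q powr (?e - real_of_int d) \<le> q powr 0"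
    using q_pos q_less_1 by (intro powr_mono'; simp)+
  then show ?thesis
    using that[of d] n q_pos by simp
qed

lemma quasi_periodic_power:
  fixes g :: "complex \<Rightarrow> complex"
  assumes "\<And>y. y \<noteq> 0 \<Longrightarrow> g (qc * y) = c * g y" "y \<noteq> 0"
  shows "g (qc ^ n * y) = c ^ n * g y"
proof (induction n)
  case (Suc n)
  then show ?case
    using assms(1)[of "qc ^ n * y"] assms(2) by (simp add: mult.assoc)
qed simp

text \<open>After multiplication by a power of \<open>y\<close> the function is bounded near \<open>0\<close>, hence extends
  to an entire function; its Taylor coefficients satisfy \<open>c\<^sub>k q\<^sup>k = \<lambda> c\<^sub>k\<close>.\<close>

lemma quasi_periodic_eq_0:
  assumes g: "g holomorphic_on -{0}"
    and qp: "\<And>y. y \<noteq> 0 \<Longrightarrow> g (qc * y) = c * g y"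
    and c: "\<And>d. c \<noteq> qc powi d" and y: "y \<noteq> 0"
  shows "g y = 0"
proof -
  have "(\<lambda>n. norm c * q ^ n) \<longlonglongrightarrow> norm c * 0"
    using q_pos q_less_1 by (intro tendsto_intros LIMSEQ_power_zero) auto
  then have "\<forall>\<^sub>F n in sequentially. norm c * q ^ n < 1"
    by (intro order_tendstoD(2)) auto
  then obtain N where N: "norm c * q ^ N < 1"
    by (auto simp: eventually_sequentially)
  \<comment> \<open>Multiplication by y^N turns the multiplier c into c q^N. Once its norm is below
    1, the values do not grow under shifts towards 0.\<close>
  define c' where "c' = c * qc ^ N"
  have c'_less: "norm c' < 1"
    using N q_pos by (simp add: c'_def norm_mult norm_power)
  have c'_ne: "c' \<noteq> qc ^ n" for n
    using c[of "int n - int N"] by (auto simp: c'_def power_int_diff field_simps)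
  define f where "f = (\<lambda>y. y ^ N * g y)"
  have f_hol: "f holomorphic_on -{0}"
    unfolding f_def by (intro holomorphic_intros g)
  have f_qp: "f (qc * y) = c' * f y" if "y \<noteq> 0" for y
    using qp[OF that] by (simp add: f_def c'_def power_mult_distrib)
  let ?A = "{y::complex. q \<le> norm y \<and> norm y \<le> 1}"
  have "closed ?A"
    by (intro closed_Collect_conj closed_Collect_le continuous_intros)
  moreover have "bounded ?A"
    by (auto simp: bounded_iff)
  ultimately have "compact ?A"
    by (simp add: compact_eq_bounded_closed)
  moreover have "continuous_on ?A f"
    using q_pos by (intro continuous_on_subset[OF holomorphic_on_imp_continuous_on[OF f_hol]]) auto
  ultimately have "compact (f ` ?A)"
    by (intro compact_continuous_image)
  then obtain B where B: "\<And>y. y \<in> ?A \<Longrightarrow> norm (f y) \<le> B"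
    using compact_imp_bounded by (fastforce simp: bounded_iff)
  have bound: "norm (f y) \<le> B" if y: "y \<noteq> 0" "norm y \<le> 1" for y
  proof -
    obtain d where d: "q \<le> norm (y * qc powi (-d))" "norm (y * qc powi (-d)) \<le> 1"
      using annulus_representative[OF y(1)] by blast
    let ?w = "y * qc powi (-d)"
    show ?thesis
    proof (cases "0 \<le> d")
      case True
      then obtain n where n: "d = int n"
        using nonneg_int_cases by blast
      have "f y = f (qc ^ n * ?w)"
        using n by (simp add: power_int_minus field_simps)
      also have "\<dots> = c' ^ n * f ?w"
        using that by (intro quasi_periodic_power f_qp) auto
      finally have "norm (f y) = norm c' ^ n * norm (f ?w)"
        by (simp add: norm_mult norm_power)
      also have "\<dots> \<le> 1 * norm (f ?w)"
        using c'_less by (intro mult_right_mono power_le_one) auto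
      finally show ?thesis
        using B[of ?w] d by simp
    next
      \<comment> \<open>Here d < 0 forces norm y >= 1, so y itself already lies in the
        annulus.\<close>
      case False
      then have "q powi d \<ge> q powi (-1)"
        using q_pos q_less_1 by (intro power_int_decreasing) auto
      moreover have "norm y = norm ?w * q powi d"
        using q_pos by (simp add: norm_mult norm_power_int power_int_minus norm_inverse)
      ultimately have "norm y \<ge> q * q powi (-1)"
        using d q_pos by (simp only:) (intro mult_mono; simp)
      then show ?thesis
        using that B[of y] q_pos q_less_1 by (simp add: power_int_minus)
    qed
  qed
  have "f \<in> O[at 0](\<lambda>_. 1)"
  proof (rule landau_o.bigI[of "\<bar>B\<bar> + 1"])
    have "\<forall>\<^sub>F y in at (0::complex). dist y 0 < 1"
      by (auto simp: eventually_at intro: exI[of _ 1])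
    then show "\<forall>\<^sub>F y in at 0. norm (f y) \<le> (\<bar>B\<bar> + 1) * norm (1::complex)"
      using eventually_neq_at_within[of 0 0 UNIV]
      by eventually_elim (use bound in fastforce)
  qed simp
  then obtain F where F: "F holomorphic_on UNIV" "\<And>y. y \<noteq> 0 \<Longrightarrow> F y = f y"
    using holomorphic_on_extend[of f UNIV 0] f_hol by (auto simp: Compl_eq_Diff_UNIV)
  have F_qp: "F (qc * y) = c' * F y" for y
  proof (cases "y = 0")
    case True
    have cont: "isCont F 0"
      using holomorphic_on_imp_continuous_on[OF F(1)] continuous_on_eq_continuous_at by blast
    have lim: "(\<lambda>y. F (qc * y)) \<midarrow>0\<rightarrow> F (qc * 0)"
      using cont by (intro isCont_tendsto_compose[of _ F] tendsto_intros) auto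
    have "(\<lambda>y. c' * F y) \<midarrow>0\<rightarrow> c' * F 0"
      using cont by (intro tendsto_intros) (simp add: isContD)
    moreover have "\<forall>\<^sub>F y in at 0. F (qc * y) = c' * F y"
      using eventually_neq_at_within[of 0 0 UNIV]
      by eventually_elim (use F(2) f_qp in auto)
    ultimately have "(\<lambda>y. F (qc * y)) \<midarrow>0\<rightarrow> c' * F 0"
      by (simp only: tendsto_cong)
    from tendsto_unique[OF trivial_limit_at lim this] show ?thesis
      using True by simp
  next
    case False
    then show ?thesis
      using F(2) f_qp by simp
  qed
  have "(deriv ^^ n) F 0 = 0" for n
  proof -
    have "qc ^ n * (deriv ^^ n) F (qc * 0) = (deriv ^^ n) (\<lambda>y. F (qc * y)) 0"
      by (rule higher_deriv_compose_linear[symmetric, OF F(1), where S = UNIV]) auto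
    also have "\<dots> = c' * (deriv ^^ n) F 0"
      unfolding F_qp by (rule higher_deriv_cmult[OF F(1)]) auto
    finally show ?thesis
      using c'_ne[of n] by simp
  qed
  then have "F y = 0"
    using holomorphic_fun_eq_0_on_connected[OF F(1), of 0 y] connected_UNIV by simp
  then show ?thesis
    using F(2)[OF y] y by (simp add: f_def)
qed

text \<open>Real powers of q are positive. This point witnesses that theta is not identically zero,
  so that its zeros are isolated in the two lemmas that follow.\<close>

lemma theta_minus_one: "\<theta> (-1) \<noteq> 0"
proof
  assume "\<theta> (-1) = 0"
  then obtain d where "- 1 = qc powi d"
    using theta_eq_0_iff[of "-1"] by auto
  then have "complex_of_real (-1) = of_real (q powi d)"
    by simp
  then have "-1 = q powi d"
    by (simp only: of_real_eq_iff)
  moreover have "0 < q powi d"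
    using q_pos by simp
  ultimately show False
    by linarith
qed

lemma eventually_theta_nonzero:
  assumes "z \<noteq> 0" "a \<noteq> 0"
  shows "\<forall>\<^sub>F y in at a. \<theta> (y / z) \<noteq> 0"
proof -
  have "\<forall>\<^sub>F y in at a. \<theta> (y / z) \<noteq> 0 \<and> y \<in> -{0}"
    using assms theta_minus_one
    by (intro non_zero_neighbour_alt[of _ _ _ "-z"] theta_holomorphic holomorphic_intros)
      (auto intro: connected_punctured_universe)
  then show ?thesis
    by eventually_elim simp
qed

lemma eventually_theta_exp_nonzero:
  assumes "c \<noteq> 0" "m \<noteq> 0"
  shows "\<forall>\<^sub>F s in at 0. \<theta> (c * exp (m * s)) \<noteq> 0"
proof -
  \<comment> \<open>This s solves c exp (m s) = -1.\<close>
  have "\<theta> (c * exp (m * (Ln (- 1 / c) / m))) \<noteq> 0"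
    using assms theta_minus_one by simp
  then have "\<forall>\<^sub>F s in at 0. \<theta> (c * exp (m * s)) \<noteq> 0 \<and> s \<in> UNIV"
    using assms
    by (intro non_zero_neighbour_alt[of _ _ _ "Ln (- 1 / c) / m"] theta_holomorphic holomorphic_intros)
      auto
  then show ?thesis
    by eventually_elim simp
qed

lemma quasi_periodic_zeros:
  assumes qp: "\<And>y. y \<noteq> 0 \<Longrightarrow> f (qc * y) = 0 \<longleftrightarrow> f y = 0" and "z \<noteq> 0" "f z = 0"
  shows "f (z * qc powi d) = 0"
proof (induction d rule: int_induct[where k = 0])
  case (step1 i)
  then show ?case
    using assms qp[of "z * qc powi i"] by (simp add: power_int_add ac_simps)
next
  case (step2 i)
  then show ?case
    using assms qp[of "z * qc powi (i - 1)"] by (simp add: power_int_diff field_simps)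
qed (use assms in simp)

text \<open>Dividing by \<theta>(y / z) removes the zero z, lowers the degree by one and turns c
  into - c / z. The multiplier left in degree 0 is the argument in the last theta assumption, which
  says that it is not a power of q; \<open>quasi_periodic_eq_0\<close> then applies.\<close>

lemma theta_function_eq_0:
  fixes f :: "complex \<Rightarrow> complex"
  assumes "finite Z" "f holomorphic_on -{0}"
    and "\<And>y. y \<noteq> 0 \<Longrightarrow> f (qc * y) = c * f y / y ^ card Z"
    and "0 \<notin> Z" "\<And>z. z \<in> Z \<Longrightarrow> f z = 0"
    and "\<And>z w. z \<in> Z \<Longrightarrow> w \<in> Z \<Longrightarrow> z \<noteq> w \<Longrightarrow> \<theta> (z / w) \<noteq> 0"
    and "c \<noteq> 0" "\<theta> ((-1) ^ card Z * c / \<Prod>Z) \<noteq> 0"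
    and "y \<noteq> 0"
  shows "f y = 0"
  using assms
proof (induction Z arbitrary: f c y rule: finite_induct)
  case empty
  have "c \<noteq> qc powi d" for d
    using empty theta_eq_0_iff[of c] by auto
  then show ?case
    using quasi_periodic_eq_0[of f c y] empty by simp
next
  case (insert z Z)
  have z: "z \<noteq> 0"
    using insert.prems(3) by auto
  have zeros: "f (z * qc powi d) = 0" for d
  proof (rule quasi_periodic_zeros)
    show "f (qc * y) = 0 \<longleftrightarrow> f y = 0" if "y \<noteq> 0" for y
      using insert.prems(2)[OF that] insert.prems(6) that by simp
    show "f z = 0"
      by (rule insert.prems(4)) simp
  qed (rule z)
  obtain g where g: "g holomorphic_on -{0}" "\<And>y. y \<noteq> 0 \<Longrightarrow> f y = \<theta> (y / z) * g y"
    using theta_division[OF insert.prems(1) z zeros] by blast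
  have cont: "isCont g a" if "a \<noteq> 0" for a
    using holomorphic_on_imp_continuous_on[OF g(1)] that continuous_on_eq_continuous_at[of "-{0}" g]
    by (auto simp: open_Compl)
  \<comment> \<open>The relation for f can be divided by the theta factor only off its zeros; at the
    zeros it follows by continuity.\<close>
  have g_qp: "g (qc * a) = - c / z * g a / a ^ card Z" if "a \<noteq> 0" for a
  proof -
    have lim: "(\<lambda>y. g (qc * y)) \<midarrow>a\<rightarrow> g (qc * a)"
      using that by (intro isCont_tendsto_compose[of _ g] cont tendsto_intros) auto
    have lim': "(\<lambda>y. - c / z * g y / y ^ card Z) \<midarrow>a\<rightarrow> - c / z * g a / a ^ card Z"
      using that cont[OF that] by (intro tendsto_intros) (auto simp: isContD)
    have "\<forall>\<^sub>F y in at a. y \<in> -{0}"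
      using that by (intro eventually_at_in_open') auto
    then have "\<forall>\<^sub>F y in at a. g (qc * y) = - c / z * g y / y ^ card Z"
      using eventually_theta_nonzero[OF z that]
    proof eventually_elim
      case (elim y)
      have "\<theta> (qc * (y / z)) * g (qc * y) = c * (\<theta> (y / z) * g y) / y ^ card (insert z Z)"
        using insert.prems(2)[of y] g(2)[of y] g(2)[of "qc * y"] elim by simp
      then have "- (z * (y ^ card Z * (\<theta> (y / z) * g (qc * y)))) = c * (\<theta> (y / z) * g y)"
        using elim z insert.hyps by (subst (asm) theta_qc_mult) (simp_all add: field_simps)
      then have "\<theta> (y / z) * (z * (y ^ card Z * g (qc * y)) + c * g y) = 0"
        by (simp add: algebra_simps eq_neg_iff_add_eq_0 neg_eq_iff_add_eq_0)
      then have "z * (y ^ card Z * g (qc * y)) + c * g y = 0"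
        using elim by simp
      then show ?case
        using elim z by (simp add: field_simps add_eq_0_iff)
    qed
    then have "(\<lambda>y. g (qc * y)) \<midarrow>a\<rightarrow> - c / z * g a / a ^ card Z"
      using lim' by (simp only: tendsto_cong)
    then show ?thesis
      by (rule tendsto_unique[OF trivial_limit_at lim])
  qed
  have "g y = 0"
  proof (rule insert.IH[OF g(1), of "- c / z"])
    show "\<theta> ((-1) ^ card Z * (- c / z) / \<Prod>Z) \<noteq> 0"
      using insert.prems(7) insert.hyps by (simp add: mult_ac)
    show "g w = 0" if "w \<in> Z" for w
    proof -
      have "w \<noteq> 0" "\<theta> (w / z) \<noteq> 0"
        using insert.prems(3,5) insert.hyps that by auto
      then show ?thesis
        using g(2)[of w] insert.prems(4)[of w] that by simp
    qed
  next
    show "g (qc * y) = - c / z * g y / y ^ card Z" if "y \<noteq> 0" for y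
      by (rule g_qp[OF that])
    show "\<theta> (v / w) \<noteq> 0" if "v \<in> Z" "w \<in> Z" "v \<noteq> w" for v w
      using that by (intro insert.prems(5)) auto
  qed (use insert.prems(3,6,8) z in auto)
  then show ?case
    using g(2)[OF insert.prems(8)] by simp
qed

lemma theta_interpolation_finite:
  fixes \<phi> \<psi> :: "complex \<Rightarrow> complex"
  assumes "finite Z" "0 \<notin> Z" "\<And>z w. z \<in> Z \<Longrightarrow> w \<in> Z \<Longrightarrow> z \<noteq> w \<Longrightarrow> \<theta> (z / w) \<noteq> 0"
    and \<phi>: "\<phi> holomorphic_on -{0}" "\<And>y. y \<noteq> 0 \<Longrightarrow> \<phi> (qc * y) = c * \<phi> y / y ^ card Z"
    and \<psi>: "\<psi> holomorphic_on -{0}" "\<And>y. y \<noteq> 0 \<Longrightarrow> \<psi> (qc * y) = c * \<psi> y / y ^ card Z"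
    and eq: "\<And>z. z \<in> Z \<Longrightarrow> \<phi> z = \<psi> z"
    and c: "c \<noteq> 0" "\<theta> ((-1) ^ card Z * c / \<Prod>Z) \<noteq> 0"
    and y: "y \<noteq> 0"
  shows "\<phi> y = \<psi> y"
proof -
  have "\<phi> y - \<psi> y = 0"
  proof (rule theta_function_eq_0[of Z "\<lambda>y. \<phi> y - \<psi> y" c y])
    show "\<phi> (qc * y) - \<psi> (qc * y) = c * (\<phi> y - \<psi> y) / y ^ card Z" if "y \<noteq> 0" for y
      unfolding \<phi>(2)[OF that] \<psi>(2)[OF that] by (simp add: algebra_simps diff_divide_distrib)
  qed (use assms in \<open>auto intro!: holomorphic_intros\<close>)
  then show ?thesis
    by simp
qed

text \<open>The coefficient of \<open>\<phi> p\<close> in the interpolation of a theta function of degree two with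
  multiplier \<open>1 / (q \<kappa> y\<^sup>2)\<close> at the nodes \<open>p\<close> and \<open>r\<close>.\<close>

definition icoef :: "complex \<Rightarrow> complex \<Rightarrow> complex \<Rightarrow> complex \<Rightarrow> complex" where
  "icoef \<kappa> p r y = \<theta> (r / y) * \<theta> (\<kappa> * y * r) / (\<theta> (r / p) * \<theta> (\<kappa> * p * r))"

lemma icoef_self: "\<theta> (r / p) \<noteq> 0 \<Longrightarrow> \<theta> (\<kappa> * p * r) \<noteq> 0 \<Longrightarrow> icoef \<kappa> p r p = 1"
  by (simp add: icoef_def)

lemma icoef_other: "r \<noteq> 0 \<Longrightarrow> icoef \<kappa> p r r = 0"
  by (simp add: icoef_def)

lemma icoef_qc:
  assumes "p \<noteq> 0" "r \<noteq> 0" "\<kappa> \<noteq> 0" "y \<noteq> 0"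
  shows "icoef \<kappa> p r (qc * y) = icoef \<kappa> p r y / (qc * \<kappa> * y\<^sup>2)"
proof -
  have "\<theta> (r / (qc * y)) = - (r / (qc * y)) * \<theta> (r / y)"
    using theta_qc_mult[of "r / (qc * y)"] assms by (simp add: field_simps)
  moreover have "\<theta> (\<kappa> * (qc * y) * r) = - \<theta> (\<kappa> * y * r) / (\<kappa> * y * r)"
    using theta_qc_mult[of "\<kappa> * y * r"] assms by (simp add: mult_ac)
  ultimately show ?thesis
    using assms unfolding icoef_def by (simp add: power2_eq_square)
qed

lemma icoef_holomorphic [holomorphic_intros]:
  assumes "f holomorphic_on S" "\<And>z. z \<in> S \<Longrightarrow> f z \<noteq> 0" "r \<noteq> 0" "\<kappa> \<noteq> 0"
  shows "(\<lambda>z. icoef \<kappa> p r (f z)) holomorphic_on S"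
proof (cases "\<theta> (r / p) * \<theta> (\<kappa> * p * r) = 0")
  case True
  then show ?thesis
    by (auto simp: icoef_def)
next
  case False
  then show ?thesis
    unfolding icoef_def using assms by (intro holomorphic_intros) auto
qed

lemma icoef_continuous [continuous_intros]:
  assumes "continuous_on S f" "\<And>z. z \<in> S \<Longrightarrow> f z \<noteq> 0" "r \<noteq> 0" "\<kappa> \<noteq> 0"
  shows "continuous_on S (\<lambda>z. icoef \<kappa> p r (f z))"
proof (cases "\<theta> (r / p) * \<theta> (\<kappa> * p * r) = 0")
  case True
  then show ?thesis
    by (auto simp: icoef_def)
next
  case False
  then show ?thesis
    unfolding icoef_def using assms by (intro continuous_intros) auto
qed

text \<open>The factor \<open>D\<close> allows for poles of \<open>\<phi> / D\<close> that are cancelled by zeros of \<open>\<phi>\<close>.\<close>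

lemma theta_interpolation_with_divisor:
  fixes \<phi> D :: "complex \<Rightarrow> complex"
  assumes \<phi>: "\<phi> holomorphic_on -{0}"
      "\<And>y. y \<noteq> 0 \<Longrightarrow> \<phi> (qc * y) = c * \<phi> y / (qc * \<kappa> * y ^ (card Z + 2))"
    and D: "D holomorphic_on -{0}" "\<And>y. y \<noteq> 0 \<Longrightarrow> D (qc * y) = c * D y / y ^ card Z"
    and Z: "finite Z" "0 \<notin> Z" "\<And>z. z \<in> Z \<Longrightarrow> \<phi> z = 0" "\<And>z. z \<in> Z \<Longrightarrow> D z = 0"
    and inc: "\<And>z w. z \<in> insert p (insert r Z) \<Longrightarrow> w \<in> insert p (insert r Z) \<Longrightarrow> z \<noteq> w \<Longrightarrow> \<theta> (z / w) \<noteq> 0"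
    and nz: "p \<noteq> 0" "r \<noteq> 0" "p \<noteq> r" "p \<notin> Z" "r \<notin> Z" "\<kappa> \<noteq> 0" "c \<noteq> 0" "D p \<noteq> 0" "D r \<noteq> 0"
    and c: "c = (-1) ^ card Z * \<Prod>Z"
    and \<kappa>: "\<theta> (\<kappa> * p * r) \<noteq> 0"
    and y: "y \<noteq> 0"
  shows "\<phi> y = D y * (icoef \<kappa> p r y * (\<phi> p / D p) + icoef \<kappa> r p y * (\<phi> r / D r))"
proof (rule theta_interpolation_finite[where Z = "insert p (insert r Z)" and c = "c / (qc * \<kappa>)"
      and \<phi> = \<phi> and \<psi> = "\<lambda>y. D y * (icoef \<kappa> p r y * (\<phi> p / D p) + icoef \<kappa> r p y * (\<phi> r / D r))"])
  let ?Z = "insert p (insert r Z)"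
  have card: "card ?Z = card Z + 2"
    using Z nz by simp
  show "\<phi> (qc * y) = (c / (qc * \<kappa>)) * \<phi> y / y ^ card ?Z" if "y \<noteq> 0" for y
    unfolding card \<phi>(2)[OF that] by simp
  show "\<And>y. y \<noteq> 0 \<Longrightarrow> D (qc * y) * (icoef \<kappa> p r (qc * y) * (\<phi> p / D p) + icoef \<kappa> r p (qc * y) * (\<phi> r / D r)) =
      (c / (qc * \<kappa>)) * (D y * (icoef \<kappa> p r y * (\<phi> p / D p) + icoef \<kappa> r p y * (\<phi> r / D r))) / y ^ card ?Z"
    using nz unfolding card D(2)
    by (simp add: icoef_qc power2_eq_square distrib_left add_divide_distrib) (simp add: ac_simps)
  show "\<phi> z = D z * (icoef \<kappa> p r z * (\<phi> p / D p) + icoef \<kappa> r p z * (\<phi> r / D r))" if "z \<in> ?Z" for z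
    using that Z nz inc[of p r] inc[of r p] \<kappa> by (auto simp: icoef_self icoef_other mult_ac)
  \<comment> \<open>The sign and the product in c cancel against Z, so the leftover multiplier
    involves only \<kappa>, p and r.\<close>
  have "(-1) ^ card ?Z * (c / (qc * \<kappa>)) / \<Prod>?Z = 1 / (qc * (\<kappa> * p * r))"
    unfolding card c using Z nz by (simp add: power_mult_distrib[symmetric])
  moreover have "\<theta> (1 / (qc * (\<kappa> * p * r))) \<noteq> 0"
    using theta_inverse[of "qc * (\<kappa> * p * r)"] theta_qc_mult[of "\<kappa> * p * r"] \<kappa> nz by simp
  ultimately show "\<theta> ((-1) ^ card ?Z * (c / (qc * \<kappa>)) / \<Prod>?Z) \<noteq> 0"
    by simp
qed (use assms in \<open>auto intro!: holomorphic_intros\<close>)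

lemma theta_interpolation:
  fixes \<phi> :: "complex \<Rightarrow> complex"
  assumes \<phi>: "\<phi> holomorphic_on -{0}" "\<And>y. y \<noteq> 0 \<Longrightarrow> \<phi> (qc * y) = \<phi> y / (qc * \<kappa> * y\<^sup>2)"
    and nz: "p \<noteq> 0" "r \<noteq> 0" "\<kappa> \<noteq> 0" "\<theta> (r / p) \<noteq> 0" "\<theta> (\<kappa> * p * r) \<noteq> 0" and y: "y \<noteq> 0"
  shows "\<phi> y = icoef \<kappa> p r y * \<phi> p + icoef \<kappa> r p y * \<phi> r"
proof -
  have "p \<noteq> r" "\<theta> (p / r) \<noteq> 0"
    using nz theta_swap[of p r] by auto
  then show ?thesis
    using theta_interpolation_with_divisor[of \<phi> 1 \<kappa> "{}" "\<lambda>_. 1" p r y] assms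
    by (auto simp: numeral_2_eq_2)
qed

text \<open>This is the three term relation of Weierstrass, parametrized so that no square roots occur.\<close>

lemma theta_three_term:
  assumes "\<kappa> \<noteq> 0" "u \<noteq> 0" "y \<noteq> 0" "p \<noteq> 0" "r \<noteq> 0" "\<theta> (r / p) \<noteq> 0" "\<theta> (\<kappa> * p * r) \<noteq> 0"
  shows "\<theta> (u * y) * \<theta> (u / (\<kappa> * y)) =
      icoef \<kappa> p r y * (\<theta> (u * p) * \<theta> (u / (\<kappa> * p))) +
      icoef \<kappa> r p y * (\<theta> (u * r) * \<theta> (u / (\<kappa> * r)))"
proof (rule theta_interpolation[of "\<lambda>y. \<theta> (u * y) * \<theta> (u / (\<kappa> * y))"])
  show "\<theta> (u * (qc * y)) * \<theta> (u / (\<kappa> * (qc * y))) = \<theta> (u * y) * \<theta> (u / (\<kappa> * y)) / (qc * \<kappa> * y\<^sup>2)"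
    if "y \<noteq> 0" for y
  proof -
    have "\<theta> (u * (qc * y)) = - \<theta> (u * y) / (u * y)"
      using theta_qc_mult[of "u * y"] assms that by (simp add: mult_ac)
    moreover have "\<theta> (u / (\<kappa> * (qc * y))) = - (u / (\<kappa> * (qc * y))) * \<theta> (u / (\<kappa> * y))"
      using theta_qc_mult[of "u / (\<kappa> * (qc * y))"] assms that by (simp add: field_simps)
    ultimately show ?thesis
      using assms that by (simp add: power2_eq_square)
  qed
qed (use assms in \<open>auto intro!: holomorphic_intros\<close>)

end

subsection \<open>Expansion of symmetric theta functions\<close>

text \<open>Adjacent exchanges carry the head of xs to its place in ys, and induction handles the
  rest. P holds the side conditions under which F is known to be symmetric; in the application it
  says that the list is a point of the torus.\<close>

lemma mset_invariant_if_swap_invariant: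
  fixes F :: "'a list \<Rightarrow> 'b"
  assumes swap: "\<And>us a b vs. P (us @ a # b # vs) \<Longrightarrow> F (us @ a # b # vs) = F (us @ b # a # vs)"
    and P: "\<And>xs ys. mset xs = mset ys \<Longrightarrow> P xs \<Longrightarrow> P ys"
    and "mset xs = mset ys" "P xs"
  shows "F xs = F ys"
proof -
  have move: "F (us @ a # y1 @ y2) = F (us @ y1 @ a # y2)" if "P (us @ a # y1 @ y2)" for us a y1 y2
    using that
  proof (induction y1 arbitrary: us)
    case (Cons b y1)
    have "P ((us @ [b]) @ a # y1 @ y2)"
      by (rule P[OF _ Cons.prems]) simp
    then show ?case
      using swap[of us a b "y1 @ y2"] Cons.prems Cons.IH[of "us @ [b]"] by simp
  qed simp
  have "F (us @ xs) = F (us @ ys)" if "mset xs = mset ys" "P (us @ xs)" for us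
    using that
  proof (induction xs arbitrary: us ys)
    case (Cons a xs)
    then have "a \<in> set ys"
      by (metis list.set_intros(1) set_mset_mset)
    then obtain y1 y2 where ys: "ys = y1 @ a # y2"
      by (meson split_list)
    have m: "mset xs = mset (y1 @ y2)"
      using Cons.prems ys by simp
    have "F (us @ a # xs) = F (us @ a # y1 @ y2)"
      using Cons.IH[OF m, of "us @ [a]"] Cons.prems by simp
    also have "\<dots> = F (us @ y1 @ a # y2)"
      by (rule move, rule P[OF _ Cons.prems(2)]) (use m in simp)
    finally show ?case
      using ys by simp
  qed simp
  from this[of "[]"] show ?thesis
    using assms(3,4) by simp
qed

context q_base
begin

text \<open>Expand a symmetric theta function at the points \<open>1 / (b t\<^sup>j)\<close>, one variable after the other,
  the nodes being \<open>X t\<^sup>i\<close> and \<open>Y t\<^sup>l\<close> once \<open>X\<close>-nodes have been chosen \<open>i\<close> times and \<open>Y\<close>-nodes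
  \<open>l\<close> times.  This product is the sum of the weights of all the choices leading to \<open>(i, l)\<close>.\<close>

definition zweight :: "complex \<Rightarrow> complex \<Rightarrow> complex \<Rightarrow> complex \<Rightarrow> complex \<Rightarrow> nat \<Rightarrow> nat \<Rightarrow> complex" where
  "zweight \<kappa> t b X Y i l =
    (\<Prod>j<i. \<theta> (Y * b * t ^ (l + j))) * (\<Prod>j<i. \<theta> (Y * \<kappa> / (b * t ^ j))) *
    (\<Prod>k<l. \<theta> (X * b * t ^ (i + k))) * (\<Prod>k<l. \<theta> (X * \<kappa> / (b * t ^ k))) * (\<Prod>s<i+l. \<theta> (t ^ Suc s)) /
    ((\<Prod>j<i. \<theta> (t ^ Suc j)) * (\<Prod>k<l. \<theta> (t ^ Suc k)) *
     (\<Prod>j<i. \<theta> (Y / X * t powi (int l - int j))) * (\<Prod>k<l. \<theta> (X / Y * t powi (int i - int k))) *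
     (\<Prod>s<i+l. \<theta> (\<kappa> * X * Y * t ^ s)))"

context
  fixes \<kappa> t b X Y :: complex and n :: nat
  assumes nz: "\<kappa> \<noteq> 0" "t \<noteq> 0" "b \<noteq> 0" "X \<noteq> 0" "Y \<noteq> 0"
    and t: "\<And>j. j < n \<Longrightarrow> \<theta> (t ^ Suc j) \<noteq> 0"
    and YX: "\<And>e. \<bar>e\<bar> < int n \<Longrightarrow> \<theta> (Y / X * t powi e) \<noteq> 0"
    and XY: "\<And>e. \<bar>e\<bar> < int n \<Longrightarrow> \<theta> (X / Y * t powi e) \<noteq> 0"
    and \<kappa>: "\<And>s. s < n \<Longrightarrow> \<theta> (\<kappa> * X * Y * t ^ s) \<noteq> 0"
begin

text \<open>Here the choice of the points 1 / (b t^j) takes effect: in \<kappa> y r the power t^l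
  cancels, so that one factor depends on i alone and fits into a product over j < i.\<close>

lemma icoef_first_node:
  "icoef \<kappa> (X * t ^ i) (Y * t ^ l) (1 / (b * t ^ (i + l))) =
    \<theta> (Y * b * t ^ (l + (i + l))) * \<theta> (Y * \<kappa> / (b * t ^ i)) /
    (\<theta> (Y / X * t powi (int l - int i)) * \<theta> (\<kappa> * X * Y * t ^ (i + l)))"
  using nz by (simp add: icoef_def power_int_diff power_add mult_ac)

lemma icoef_second_node:
  "icoef \<kappa> (Y * t ^ l) (X * t ^ i) (1 / (b * t ^ (i + l))) =
    \<theta> (X * b * t ^ (i + (i + l))) * \<theta> (X * \<kappa> / (b * t ^ l)) /
    (\<theta> (X / Y * t powi (int i - int l)) * \<theta> (\<kappa> * X * Y * t ^ (i + l)))"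
  using nz by (simp add: icoef_def power_int_diff power_add mult_ac)

lemma zweight_0_Suc:
  assumes "l < n"
  shows "zweight \<kappa> t b X Y 0 (Suc l) = zweight \<kappa> t b X Y 0 l * icoef \<kappa> (Y * t ^ l) (X * t ^ 0) (1 / (b * t ^ l))"
  using icoef_second_node[of l 0] t[OF assms] by (simp add: zweight_def mult_ac)

lemma zweight_Suc_0:
  assumes "i < n"
  shows "zweight \<kappa> t b X Y (Suc i) 0 = zweight \<kappa> t b X Y i 0 * icoef \<kappa> (X * t ^ i) (Y * t ^ 0) (1 / (b * t ^ i))"
  using icoef_first_node[of i 0] t[OF assms] by (simp add: zweight_def mult_ac)

text \<open>What is left of the recursion in \<open>zweight_Suc_Suc\<close> after the common factors
  have been removed; all factors containing \<kappa> are among those.\<close>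

lemma zweight_three_term:
  assumes m: "m = i + l + 1" "m < n"
  shows "\<theta> (Y * b * t ^ m) * \<theta> (X * b * t ^ m) * \<theta> (t ^ Suc m) =
     \<theta> (X * b * t ^ i) * \<theta> (Y * b * t ^ (l + 1 + m)) * \<theta> (t ^ Suc i) *
       \<theta> (X / Y * t powi (int i + 1)) / \<theta> (X / Y * t powi (int i - int l)) +
     \<theta> (Y * b * t ^ l) * \<theta> (X * b * t ^ (i + 1 + m)) * \<theta> (t ^ Suc l) *
       \<theta> (Y / X * t powi (int l + 1)) / \<theta> (Y / X * t powi (int l - int i))"
proof -
  \<comment> \<open>The multiplier 1 / (X Y) is unrelated to the fixed \<kappa>. At y = Y it makes u
    y, u / (\<kappa> y) and \<kappa> p r equal to Y b t^m, X b t^m and t^(m + 1), the three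
    arguments on the left.\<close>
  let ?\<kappa> = "1 / (X * Y)" and ?u = "b * t ^ m" and ?p = "X * t ^ Suc i" and ?r = "Y * t ^ Suc l"
  have rp: "?r / ?p = Y / X * t powi (int l - int i)" and pr: "?p / ?r = X / Y * t powi (int i - int l)"
    using nz by (simp_all add: power_int_diff)
  have \<kappa>pr: "?\<kappa> * ?p * ?r = t ^ Suc m" "?\<kappa> * ?r * ?p = t ^ Suc m"
    using nz m by (simp_all add: power_add mult_ac)
  have "\<theta> (?u * Y) * \<theta> (?u / (?\<kappa> * Y)) =
      icoef ?\<kappa> ?p ?r Y * (\<theta> (?u * ?p) * \<theta> (?u / (?\<kappa> * ?p))) +
      icoef ?\<kappa> ?r ?p Y * (\<theta> (?u * ?r) * \<theta> (?u / (?\<kappa> * ?r)))"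
  proof (rule theta_three_term)
    show "\<theta> (?r / ?p) \<noteq> 0"
      unfolding rp using m by (intro YX) auto
    show "\<theta> (?\<kappa> * ?p * ?r) \<noteq> 0"
      unfolding \<kappa>pr using m by (intro t) auto
  qed (use nz in auto)
  moreover have "?u * Y = Y * b * t ^ m" "?u / (?\<kappa> * Y) = X * b * t ^ m"
    "?u * ?p = X * b * t ^ (i + 1 + m)" "?u / (?\<kappa> * ?p) = Y * b * t ^ l"
    "?u * ?r = Y * b * t ^ (l + 1 + m)" "?u / (?\<kappa> * ?r) = X * b * t ^ i"
    using nz m by (simp_all add: power_add mult_ac)
  moreover have "icoef ?\<kappa> ?p ?r Y = \<theta> (t ^ Suc l) * \<theta> (Y / X * t powi (int l + 1)) /
      (\<theta> (Y / X * t powi (int l - int i)) * \<theta> (t ^ Suc m))"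
    unfolding icoef_def \<kappa>pr rp using nz by (simp add: power_int_add mult_ac)
  moreover have "icoef ?\<kappa> ?r ?p Y = \<theta> (t ^ Suc i) * \<theta> (X / Y * t powi (int i + 1)) /
      (\<theta> (X / Y * t powi (int i - int l)) * \<theta> (t ^ Suc m))"
    unfolding icoef_def \<kappa>pr pr using nz by (simp add: power_int_add mult_ac)
  ultimately have "\<theta> (Y * b * t ^ m) * \<theta> (X * b * t ^ m) =
    \<theta> (t ^ Suc l) * \<theta> (Y / X * t powi (int l + 1)) /
      (\<theta> (Y / X * t powi (int l - int i)) * \<theta> (t ^ Suc m)) * (\<theta> (X * b * t ^ (i + 1 + m)) * \<theta> (Y * b * t ^ l)) +
    \<theta> (t ^ Suc i) * \<theta> (X / Y * t powi (int i + 1)) /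
      (\<theta> (X / Y * t powi (int i - int l)) * \<theta> (t ^ Suc m)) * (\<theta> (Y * b * t ^ (l + 1 + m)) * \<theta> (X * b * t ^ i))"
    by (simp only:)
  then show ?thesis
    using t[OF m(2)] YX[of "int l - int i"] XY[of "int i - int l"] m
    by (simp add: distrib_right del: power_Suc) (simp add: mult_ac add.commute del: power_Suc)
qed

text \<open>The field arithmetic of \<open>zweight_Suc_Suc\<close>, with variables in place of theta values.\<close>

lemma zweight_step_algebra:
  fixes N0 :: complex
  assumes rel: "am * bm * \<tau>m = bi * al' * \<tau>i * ni' / nil' + al * bi' * \<tau>l * nl / nli"
    and N1: "N1 * nli' = nl * N0" and N1': "N1' * nil'' = ni' * N0'"
    and nz: "nil' \<noteq> 0" "nli \<noteq> 0" "nli' \<noteq> 0" "nil'' \<noteq> 0" "nl \<noteq> 0" "ni' \<noteq> 0" "\<tau>i \<noteq> 0" "\<tau>l \<noteq> 0" "\<sigma> \<noteq> 0"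
      "Ti \<noteq> 0" "Tl \<noteq> 0" "N0 \<noteq> 0" "N0' \<noteq> 0" "S \<noteq> 0"
  shows "(A * am) * (C * c) * (B * bm) * (C' * c') * (T * \<tau>m) /
      ((Ti * \<tau>i) * (Tl * \<tau>l) * (nl * N0) * (ni' * N0') * (S * \<sigma>)) =
    A * C * (bi * B) * (C' * c') * T / (Ti * (Tl * \<tau>l) * N1 * (N0' * nil') * S) * (al' * c / (nli' * \<sigma>)) +
    (al * A) * (C * c) * B * C' * T / ((Ti * \<tau>i) * Tl * (N0 * nli) * N1' * S) * (bi' * c' / (nil'' * \<sigma>))"
proof -
  let ?K = "A * C * c * B * C' * c' * T / (Ti * Tl * N0 * N0' * S * \<sigma>)"
  have "(A * am) * (C * c) * (B * bm) * (C' * c') * (T * \<tau>m) /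
      ((Ti * \<tau>i) * (Tl * \<tau>l) * (nl * N0) * (ni' * N0') * (S * \<sigma>)) = ?K * (am * bm * \<tau>m) / (\<tau>i * \<tau>l * nl * ni')"
    by (simp add: mult_ac)
  also have "\<dots> = ?K * (bi * al' * \<tau>i * ni' / nil' + al * bi' * \<tau>l * nl / nli) / (\<tau>i * \<tau>l * nl * ni')"
    unfolding rel ..
  also have "\<dots> = ?K * (bi * al' / (nil' * \<tau>l * nl)) + ?K * (al * bi' / (nli * \<tau>i * ni'))"
    using nz by (simp add: distrib_left add_divide_distrib mult_ac)
  also have "?K * (bi * al' / (nil' * \<tau>l * nl)) =
      A * C * (bi * B) * (C' * c') * T * (al' * c) / (Ti * (Tl * \<tau>l) * (N1 * nli') * (N0' * nil') * S * \<sigma>)"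
    unfolding N1 by (simp add: mult_ac)
  also have "\<dots> = A * C * (bi * B) * (C' * c') * T / (Ti * (Tl * \<tau>l) * N1 * (N0' * nil') * S) * (al' * c / (nli' * \<sigma>))"
    by (simp add: mult_ac)
  also have "?K * (al * bi' / (nli * \<tau>i * ni')) =
      (al * A) * (C * c) * B * C' * T * (bi' * c') / ((Ti * \<tau>i) * Tl * (N0 * nli) * (N1' * nil'') * S * \<sigma>)"
    unfolding N1' by (simp add: mult_ac)
  also have "\<dots> = (al * A) * (C * c) * B * C' * T / ((Ti * \<tau>i) * Tl * (N0 * nli) * N1' * S) * (bi' * c' / (nil'' * \<sigma>))"
    by (simp add: mult_ac)
  finally show ?thesis .
qed

text \<open>The last choice on a path to (i + 1, l + 1) was an X-node, coming from (i, l + 1), or a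
  Y-node, coming from (i + 1, l).\<close>

lemma zweight_Suc_Suc:
  assumes m: "m = i + l + 1" "m < n"
  shows "zweight \<kappa> t b X Y (Suc i) (Suc l) =
    zweight \<kappa> t b X Y i (Suc l) * icoef \<kappa> (X * t ^ i) (Y * t ^ Suc l) (1 / (b * t ^ m)) +
    zweight \<kappa> t b X Y (Suc i) l * icoef \<kappa> (Y * t ^ l) (X * t ^ Suc i) (1 / (b * t ^ m))"
proof -
  define a where "a = (\<lambda>e. \<theta> (Y * b * t ^ e))"
  define b' where "b' = (\<lambda>e. \<theta> (X * b * t ^ e))"
  define N where "N = (\<lambda>e. \<theta> (Y / X * t powi e))"
  define N' where "N' = (\<lambda>e. \<theta> (X / Y * t powi e))"
  have ic: "icoef \<kappa> (X * t ^ i) (Y * t ^ Suc l) (1 / (b * t ^ m)) =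
      a (l + 1 + m) * \<theta> (Y * \<kappa> / (b * t ^ i)) / (N (int (Suc l) - int i) * \<theta> (\<kappa> * X * Y * t ^ m))"
    "icoef \<kappa> (Y * t ^ l) (X * t ^ Suc i) (1 / (b * t ^ m)) =
      b' (i + 1 + m) * \<theta> (X * \<kappa> / (b * t ^ l)) / (N' (int (Suc i) - int l) * \<theta> (\<kappa> * X * Y * t ^ m))"
    using icoef_first_node[of i "Suc l"] icoef_second_node[of l "Suc i"] m
    by (simp_all add: a_def b'_def N_def N'_def add_ac del: power_Suc)
  \<comment> \<open>The exponents depend on both counters, so raising one counter shifts the whole
    product that belongs to the other; splitting off the first factor realigns them.\<close>
  have e1: "(\<Prod>j<Suc i. a (l + j)) = a l * (\<Prod>j<i. a (Suc l + j))"
    and e2: "(\<Prod>k<Suc l. b' (i + k)) = b' i * (\<Prod>k<l. b' (Suc i + k))"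
    and e3: "(\<Prod>j<Suc i. N (int (Suc l) - int j)) = N (int l + 1) * (\<Prod>j<i. N (int l - int j))"
    and e4: "(\<Prod>k<Suc l. N' (int (Suc i) - int k)) = N' (int i + 1) * (\<Prod>k<l. N' (int i - int k))"
    by (simp_all add: prod.lessThan_Suc_shift add_ac del: prod.lessThan_Suc)
  have W: "zweight \<kappa> t b X Y i' l' =
    (\<Prod>j<i'. a (l' + j)) * (\<Prod>j<i'. \<theta> (Y * \<kappa> / (b * t ^ j))) *
    (\<Prod>k<l'. b' (i' + k)) * (\<Prod>k<l'. \<theta> (X * \<kappa> / (b * t ^ k))) * (\<Prod>s<i'+l'. \<theta> (t ^ Suc s)) /
    ((\<Prod>j<i'. \<theta> (t ^ Suc j)) * (\<Prod>k<l'. \<theta> (t ^ Suc k)) *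
     (\<Prod>j<i'. N (int l' - int j)) * (\<Prod>k<l'. N' (int i' - int k)) *
     (\<Prod>s<i'+l'. \<theta> (\<kappa> * X * Y * t ^ s)))" for i' l'
    by (simp add: zweight_def a_def b'_def N_def N'_def)
  have s: "Suc i + Suc l = Suc m" "i + Suc l = m" "Suc i + l = m"
    using m by auto
  have N: "N e \<noteq> 0" and N': "N' e \<noteq> 0" if "\<bar>e\<bar> < int n" for e
    using YX XY that by (simp_all add: N_def N'_def)
  have am: "a (Suc l + i) = a m" "b' (Suc i + l) = b' m"
    using m by (simp_all add: add_ac)
  show ?thesis
    unfolding W ic s e1 e2 e3 e4 unfolding prod.lessThan_Suc am
  proof (rule zweight_step_algebra)
    show "a m * b' m * \<theta> (t ^ Suc m) =
      b' i * a (l + 1 + m) * \<theta> (t ^ Suc i) * N' (int i + 1) / N' (int i - int l) +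
      a l * b' (i + 1 + m) * \<theta> (t ^ Suc l) * N (int l + 1) / N (int l - int i)"
      using zweight_three_term[OF m] by (simp only: a_def b'_def N_def N'_def)
    show "(\<Prod>j<i. N (int (Suc l) - int j)) * N (int (Suc l) - int i) = N (int l + 1) * (\<Prod>j<i. N (int l - int j))"
      using e3 by simp
    show "(\<Prod>k<l. N' (int (Suc i) - int k)) * N' (int (Suc i) - int l) = N' (int i + 1) * (\<Prod>k<l. N' (int i - int k))"
      using e4 by simp
  qed (use m N N' t \<kappa> in \<open>auto simp del: power_Suc simp add: prod_zero_iff\<close>)
qed

text \<open>The successive choices of nodes form lattice paths. Induction on the number m of
  replaced points groups the paths by endpoint (i, m - i): by symmetry F sees only the endpoint, and
  the recursion for \<open>zweight\<close> adds up the paths leading there.\<close>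

lemma symmetric_theta_expansion:
  fixes F :: "complex list \<Rightarrow> complex"
  defines "\<xi> \<equiv> \<lambda>j. 1 / (b * t ^ j)"
  defines "pt \<equiv> \<lambda>i l. map (\<lambda>j. X * t ^ j) [0..<i] @ map (\<lambda>j. Y * t ^ j) [0..<l]"
  assumes sym: "\<And>xs ys. length xs = n \<Longrightarrow> 0 \<notin> set xs \<Longrightarrow> mset xs = mset ys \<Longrightarrow> F xs = F ys"
    and hol: "\<And>vs. Suc (length vs) = n \<Longrightarrow> 0 \<notin> set vs \<Longrightarrow> (\<lambda>y. F (y # vs)) holomorphic_on -{0}"
    and qp: "\<And>y vs. Suc (length vs) = n \<Longrightarrow> 0 \<notin> set vs \<Longrightarrow> y \<noteq> 0 \<Longrightarrow>
      F (qc * y # vs) = F (y # vs) / (qc * \<kappa> * y\<^sup>2)"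
  shows "F (map \<xi> [0..<n]) = (\<Sum>i\<le>n. zweight \<kappa> t b X Y i (n - i) * F (pt i (n - i)))"
proof -
  have "F (map \<xi> [0..<n]) = (\<Sum>i\<le>m. zweight \<kappa> t b X Y i (m - i) * F (pt i (m - i) @ map \<xi> [m..<n]))"
    if "m \<le> n" for m
    using that
  proof (induction m)
    case 0
    then show ?case
      by (simp add: pt_def zweight_def)
  next
    case (Suc m)
    then have m: "m < n" by simp
    define P where "P = (\<lambda>i. F (pt i (Suc m - i) @ map \<xi> [Suc m..<n]))"
    define u where "u = (\<lambda>i. icoef \<kappa> (X * t ^ i) (Y * t ^ (m - i)) (\<xi> m))"
    define v where "v = (\<lambda>i. icoef \<kappa> (Y * t ^ (m - i)) (X * t ^ i) (\<xi> m))"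
    let ?W = "zweight \<kappa> t b X Y"
    have exp: "F (pt i (m - i) @ map \<xi> [m..<n]) = u i * P (Suc i) + v i * P i" if i: "i \<le> m" for i
    proof -
      define l where "l = m - i"
      have l: "m = i + l" "Suc m - i = Suc l"
        using i by (auto simp: l_def)
      define vs where "vs = pt i l @ map \<xi> [Suc m..<n]"
      have vs: "Suc (length vs) = n" "0 \<notin> set vs"
        using m nz l by (auto simp: vs_def pt_def \<xi>_def)
      have \<xi>: "\<xi> m \<noteq> 0"
        using nz by (simp add: \<xi>_def)
      \<comment> \<open>Holomorphy and quasi-periodicity are assumed for the first entry, so
        symmetry brings the point \<xi> m to the front.\<close>
      have "F (pt i l @ map \<xi> [m..<n]) = F (\<xi> m # vs)"
        using vs \<xi> m by (intro sym) (auto simp: vs_def upt_conv_Cons)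
      also have "\<dots> = icoef \<kappa> (X * t ^ i) (Y * t ^ l) (\<xi> m) * F (X * t ^ i # vs) +
          icoef \<kappa> (Y * t ^ l) (X * t ^ i) (\<xi> m) * F (Y * t ^ l # vs)"
      proof (rule theta_interpolation[where \<phi> = "\<lambda>y. F (y # vs)"])
        have "Y * t ^ l / (X * t ^ i) = Y / X * t powi (int l - int i)"
          using nz by (simp add: power_int_diff)
        then show "\<theta> (Y * t ^ l / (X * t ^ i)) \<noteq> 0"
          using YX[of "int l - int i"] m l by (simp only:) simp
        have "\<kappa> * (X * t ^ i) * (Y * t ^ l) = \<kappa> * X * Y * t ^ m"
          using l by (simp add: power_add mult_ac)
        then show "\<theta> (\<kappa> * (X * t ^ i) * (Y * t ^ l)) \<noteq> 0"
          by (simp only: \<kappa>[OF m] not_False_eq_True)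
      qed (use nz \<xi> vs hol qp in auto)
      also have "F (X * t ^ i # vs) = P (Suc i)"
        unfolding P_def using vs nz l by (intro sym) (auto simp: vs_def pt_def)
      also have "F (Y * t ^ l # vs) = P i"
        unfolding P_def l(2) using vs nz by (intro sym) (auto simp: vs_def pt_def)
      finally show ?thesis
        by (simp add: u_def v_def l_def)
    qed
    \<comment> \<open>The endpoint (i + 1, m - i) is reached by an X-step from (i, m - i) and,
      unless i = m, by a Y-step from (i + 1, m - i - 1).\<close>
    have W: "?W (Suc i) (m - i) = ?W i (m - i) * u i + (if i < m then ?W (Suc i) (m - Suc i) * v (Suc i) else 0)"
      if i: "i \<le> m" for i
    proof (cases "i < m")
      case True
      then obtain l where "m = i + l + 1"
        using less_imp_Suc_add by auto
      then show ?thesis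
        using zweight_Suc_Suc[of m i l] m by (simp add: u_def v_def \<xi>_def del: power_Suc)
    next
      case False
      then have "i = m" using i by simp
      then show ?thesis
        using zweight_Suc_0[OF m] by (simp add: u_def \<xi>_def)
    qed
    have "F (map \<xi> [0..<n]) = (\<Sum>i\<le>m. ?W i (m - i) * (u i * P (Suc i) + v i * P i))"
      using Suc exp by simp
    also have "\<dots> = (\<Sum>i\<le>m. ?W i (m - i) * u i * P (Suc i)) + (\<Sum>i<Suc m. ?W i (m - i) * v i * P i)"
      by (simp add: distrib_left sum.distrib mult_ac lessThan_Suc_atMost del: sum.lessThan_Suc)
    also have "(\<Sum>i<Suc m. ?W i (m - i) * v i * P i) =
        ?W 0 m * v 0 * P 0 + (\<Sum>i<m. ?W (Suc i) (m - Suc i) * v (Suc i) * P (Suc i))"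
      by (simp add: sum.lessThan_Suc_shift del: sum.lessThan_Suc)
    also have "(\<Sum>i<m. ?W (Suc i) (m - Suc i) * v (Suc i) * P (Suc i)) =
        (\<Sum>i\<le>m. (if i < m then ?W (Suc i) (m - Suc i) * v (Suc i) else 0) * P (Suc i))"
      by (simp add: lessThan_Suc_atMost[symmetric])
    also have "?W 0 m * v 0 = ?W 0 (Suc m)"
      using zweight_0_Suc[OF m] by (simp add: v_def \<xi>_def)
    finally have "F (map \<xi> [0..<n]) = ?W 0 (Suc m) * P 0 + (\<Sum>i\<le>m. ?W (Suc i) (m - i) * P (Suc i))"
      using W by (simp add: sum.distrib[symmetric] distrib_right add_ac)
    then show ?case
      unfolding P_def sum.atMost_Suc_shift by simp
  qed
  from this[of n] show ?thesis
    by simp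
qed

end

end

subsection \<open>The Jackson sum\<close>

definition pairprod :: "nat \<Rightarrow> (nat \<Rightarrow> nat \<Rightarrow> 'a::comm_ring_1) \<Rightarrow> 'a" where
  "pairprod n f = (\<Prod>k=1..n. \<Prod>j\<in>{1..<k}. f j k)"

abbreviation adjswap :: "nat \<Rightarrow> nat \<Rightarrow> nat" where
  "adjswap a \<equiv> Transposition.transpose a (Suc a)"

lemma pairprod_cong:
  "(\<And>j k. j \<in> {1..n} \<Longrightarrow> k \<in> {1..n} \<Longrightarrow> j < k \<Longrightarrow> f j k = g j k) \<Longrightarrow> pairprod n f = pairprod n g"
  unfolding pairprod_def by (intro prod.cong) auto

lemma pairprod_mult: "pairprod n (\<lambda>j k. f j k * g j k) = pairprod n f * pairprod n g"
  by (simp add: pairprod_def prod.distrib)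

text \<open>Exchanging a and a + 1 permutes the pairs j < k other than (a, a + 1) and reverses that
  one.\<close>

lemma pairprod_swap_adjacent:
  fixes f :: "nat \<Rightarrow> nat \<Rightarrow> 'a::comm_ring_1"
  assumes a: "1 \<le> a" "Suc a \<le> n" and anti: "f (Suc a) a = - f a (Suc a)"
  shows "pairprod n (\<lambda>j k. f (adjswap a j) (adjswap a k)) = - pairprod n f"
proof -
  let ?s = "adjswap a"
  let ?I = "SIGMA k:{1..n}. {1..<k}"
  let ?p = "(Suc a, a)"
  have pp: "pairprod n g = (\<Prod>p\<in>?I. g (snd p) (fst p))" for g :: "nat \<Rightarrow> nat \<Rightarrow> 'a"
    by (simp add: pairprod_def prod.Sigma split_def)
  have split: "(\<Prod>p\<in>?I. h p) = h ?p * (\<Prod>p\<in>?I - {?p}. h p)" for h :: "nat \<times> nat \<Rightarrow> 'a"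
    using a by (intro prod.remove) auto
  have s_less: "?s j < ?s k" if "j < k" "(k, j) \<noteq> ?p" for j k
    using that by (auto simp: Transposition.transpose_def)
  have s_range: "?s j \<in> {1..n} \<longleftrightarrow> j \<in> {1..n}" for j
    using a by (auto simp: Transposition.transpose_def)
  have img: "(?s (fst p), ?s (snd p)) \<in> ?I - {?p}" if "p \<in> ?I - {?p}" for p
  proof -
    obtain k j where p: "p = (k, j)" by fastforce
    have "?s j < ?s k"
      using that p by (intro s_less) auto
    moreover have "(?s k, ?s j) \<noteq> ?p"
      using that p by (auto simp: Transposition.transpose_def split: if_splits)
    ultimately show ?thesis
      using that p s_range[of k] s_range[of j] by auto
  qed
  have "(\<Prod>p\<in>?I - {?p}. f (?s (snd p)) (?s (fst p))) = (\<Prod>p\<in>?I - {?p}. f (snd p) (fst p))"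
    using img
    by (intro prod.reindex_bij_witness[of _ "\<lambda>p. (?s (fst p), ?s (snd p))" "\<lambda>p. (?s (fst p), ?s (snd p))"])
      auto
  then show ?thesis
    unfolding pp split using anti by simp
qed

lemma pairprod_row:
  fixes c :: "nat \<Rightarrow> 'a::comm_ring_1"
  assumes i: "i \<in> {1..n}"
  shows "pairprod n (\<lambda>j k. if k = i then c j else if j = i then c k else 1) = (\<Prod>l\<in>{1..n}-{i}. c l)"
proof -
  have inner: "(\<Prod>j\<in>{1..<k}. if k = i then c j else if j = i then c k else 1) =
      (if k = i then \<Prod>j\<in>{1..<i}. c j else if i < k then c k else 1)" if "k \<in> {1..n}" for k
    using i by (auto intro!: prod.neutral)
  have "pairprod n (\<lambda>j k. if k = i then c j else if j = i then c k else 1) =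
      (\<Prod>k=1..n. if k = i then \<Prod>j\<in>{1..<i}. c j else if i < k then c k else 1)"
    unfolding pairprod_def using inner by (intro prod.cong) auto
  also have "\<dots> = (\<Prod>j\<in>{1..<i}. c j) * (\<Prod>k\<in>{1..n}-{i}. if i < k then c k else 1)"
    using i by (subst prod.remove[of _ i]) (auto intro!: prod.cong)
  also have "(\<Prod>k\<in>{1..n}-{i}. if i < k then c k else 1) = (\<Prod>k\<in>{i<..n}. c k)"
    using i by (intro prod.mono_neutral_cong_right) auto
  also have "(\<Prod>j\<in>{1..<i}. c j) * (\<Prod>k\<in>{i<..n}. c k) = (\<Prod>l\<in>{1..<i} \<union> {i<..n}. c l)"
    by (intro prod.union_disjoint[symmetric]) auto
  also have "{1..<i} \<union> {i<..n} = {1..n} - {i}"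
    using i by auto
  finally show ?thesis .
qed

text \<open>Only the pairs containing i change, and there is exactly one for each other index l, on
  whichever side of i it lies. This is the form in which a q-shift of one variable acts.\<close>

lemma pairprod_row_scale:
  fixes f g :: "nat \<Rightarrow> nat \<Rightarrow> 'a::comm_ring_1"
  assumes i: "i \<in> {1..n}"
    and "\<And>j k. j \<in> {1..n} \<Longrightarrow> k \<in> {1..n} \<Longrightarrow> j \<noteq> i \<Longrightarrow> k \<noteq> i \<Longrightarrow> j < k \<Longrightarrow> g j k = f j k"
    and "\<And>l. l \<in> {1..n} \<Longrightarrow> l < i \<Longrightarrow> g l i = c l * f l i"
    and "\<And>l. l \<in> {1..n} \<Longrightarrow> i < l \<Longrightarrow> g i l = c l * f i l"
  shows "pairprod n g = (\<Prod>l\<in>{1..n}-{i}. c l) * pairprod n f"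
proof -
  have "pairprod n g = pairprod n (\<lambda>j k. (if k = i then c j else if j = i then c k else 1) * f j k)"
    using assms by (intro pairprod_cong) auto
  then show ?thesis
    using pairprod_row[OF i, of c] by (simp add: pairprod_mult)
qed

text \<open>Each index lies in n - 1 pairs. This is the origin of the exponent of \<open>w2\<close>
  in \<open>summable_weight\<close>.\<close>

lemma pairprod_sym_mult:
  fixes u :: "nat \<Rightarrow> 'a::comm_ring_1"
  shows "pairprod n (\<lambda>j k. u j * u k) = (\<Prod>i=1..n. u i ^ (n - 1))"
proof (induction n)
  case (Suc n)
  have "pairprod (Suc n) (\<lambda>j k. u j * u k) =
      pairprod n (\<lambda>j k. u j * u k) * ((\<Prod>j=1..n. u j) * u (Suc n) ^ n)"
    by (simp add: pairprod_def prod.distrib atLeastLessThanSuc_atLeastAtMost)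
  also have "pairprod n (\<lambda>j k. u j * u k) * ((\<Prod>j=1..n. u j) * u (Suc n) ^ n) =
      (\<Prod>i=1..n. u i ^ n) * u (Suc n) ^ n"
    unfolding Suc.IH mult.assoc[symmetric] prod.distrib[symmetric]
    by (cases n) (auto intro!: prod.cong simp: mult_ac)
  finally show ?case
    by simp
qed (simp add: pairprod_def)

lemma norm_pairprod_le:
  fixes f :: "nat \<Rightarrow> nat \<Rightarrow> complex"
  assumes "\<And>j k. j \<in> {1..n} \<Longrightarrow> k \<in> {1..n} \<Longrightarrow> norm (f j k) \<le> g j k"
  shows "norm (pairprod n f) \<le> pairprod n g"
  unfolding pairprod_def prod_norm[symmetric]
  using assms by (intro prod_mono conjI prod_nonneg) auto

section \<open>Quotients of infinite products with their poles removed\<close>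

lemma triangular_step: "(d + 1) * d div 2 = d * (d - 1) div 2 + (d::int)"
proof -
  have "(d + 1) * d = d * (d - 1) + d * 2"
    by (simp add: algebra_simps)
  then show ?thesis
    by simp
qed

context q_base
begin

text \<open>The quotient \<open>\<theta>(B x) (A x q\<^sup>d)\<^sub>\<infinity> / (B x q\<^sup>d)\<^sub>\<infinity>\<close> with its removable
  singularities removed (see \<open>regq_theta\<close>).\<close>

definition regq :: "complex \<Rightarrow> complex \<Rightarrow> complex \<Rightarrow> int \<Rightarrow> complex" where
  "regq A B x d = qp (A * x * qc powi d) * qp (qc powi (1 - d) / (B * x)) *
     (- (B * x)) powi d * qc powi (d * (d - 1) div 2)"

text \<open>For d >= 0, shifting d times collects the multipliers - c q^e with e < d; their product
  gives the triangular exponent.\<close>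

lemma theta_qc_powi_mult:
  assumes "c \<noteq> 0"
  shows "\<theta> (c * qc powi d) * (- c) powi d * qc powi (d * (d - 1) div 2) = \<theta> c"
proof -
  let ?T = "\<lambda>d. \<theta> (c * qc powi d) * (- c) powi d * qc powi (d * (d - 1) div 2)"
  have step: "?T (d + 1) = ?T d" for d
  proof -
    have "\<theta> (c * qc powi (d + 1)) = - \<theta> (c * qc powi d) / (c * qc powi d)"
      using theta_qc_mult[of "c * qc powi d"] assms by (simp add: power_int_add mult_ac)
    then have "?T (d + 1) = - \<theta> (c * qc powi d) / (c * qc powi d) * (- c) powi (d + 1) *
        qc powi (d * (d - 1) div 2 + d)"
      using triangular_step[of d] by simp
    then show ?thesis
      using assms by (simp add: power_int_add)
  qed
  show ?thesis
  proof (induction d rule: int_induct[where k = 0])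
    case (step1 i)
    then show ?case using step[of i] by simp
  next
    case (step2 i)
    then show ?case using step[of "i - 1"] by simp
  qed simp
qed

lemma regq_theta:
  assumes "B \<noteq> 0" "x \<noteq> 0"
  shows "regq A B x d * qp (B * x * qc powi d) = qp (A * x * qc powi d) * \<theta> (B * x)"
proof -
  have "\<theta> (B * x * qc powi d) = qp (B * x * qc powi d) * qp (qc powi (1 - d) / (B * x))"
    using assms by (simp add: theta_def power_int_diff mult_ac)
  then show ?thesis
    using theta_qc_powi_mult[of "B * x" d] assms by (simp add: regq_def mult_ac)
qed

text \<open>The extra factor does not depend on d. Hence in the lattice sum a q-shift of the
  variable becomes a shift of the summation index.\<close>

lemma regq_qc:
  assumes "B \<noteq> 0" "x \<noteq> 0"
  shows "regq A B (qc * x) d = regq A B x (d + 1) / (- (B * x))"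
proof -
  have "(- (B * (qc * x))) powi d = (- (B * x)) powi d * qc powi d"
    using power_int_mult_distrib[of "- (B * x)" qc d] by (simp add: mult_ac)
  moreover have "qc powi (1 - d) / (B * (qc * x)) = qc powi (1 - (d + 1)) / (B * x)"
    by (simp add: power_int_diff power_int_minus field_simps)
  moreover have "A * (qc * x) * qc powi d = A * x * qc powi (d + 1)"
    by (simp add: power_int_add mult_ac)
  ultimately have "regq A B (qc * x) d = qp (A * x * qc powi (d + 1)) * qp (qc powi (1 - (d + 1)) / (B * x)) *
      ((- (B * x)) powi d * qc powi d) * qc powi (d * (d - 1) div 2)"
    by (simp only: regq_def)
  also have "\<dots> = regq A B x (d + 1) / (- (B * x))"
    unfolding regq_def using assms triangular_step[of d]
    by (simp add: power_int_add mult_ac)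
  finally show ?thesis .
qed

text \<open>Reduces negative d to positive d in \<open>regq_bound\<close>. For A = q / t and B = t
  the reflected parameters are again A and B, which makes \<open>fac2_swap\<close> possible.\<close>

lemma regq_reflect:
  assumes "A \<noteq> 0" "B \<noteq> 0" "x \<noteq> 0"
  shows "regq A B x (- d) = (A / B) powi d * regq (qc / B) (qc / A) (1 / x) d"
proof -
  have tri: "(- d) * (- d - 1) div 2 = d * (d - 1) div 2 + d"
    using triangular_step[of d] by (simp add: algebra_simps)
  have 1: "A * x * qc powi (- d) = qc powi (1 - d) / (qc / A * (1 / x))"
    using assms by (simp add: power_int_diff power_int_minus field_simps)
  have 2: "qc powi (1 - (- d)) / (B * x) = qc / B * (1 / x) * qc powi d"
    using assms by (simp add: power_int_add)
  have 3: "(- (B * x)) powi (- d) = (A / B) powi d * (- (qc / A * (1 / x))) powi d * qc powi (- d)"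
  proof -
    have "(A / B) powi d * (- (qc / A * (1 / x))) powi d * qc powi (- d) =
        (A / B * (- (qc / A * (1 / x))) * inverse qc) powi d"
      by (simp only: power_int_mult_distrib power_int_minus power_int_inverse)
    also have "A / B * (- (qc / A * (1 / x))) * inverse qc = inverse (- (B * x))"
      using assms by (simp add: field_simps)
    finally show ?thesis
      by (simp only: power_int_minus power_int_inverse)
  qed
  have "qc powi (- d) * qc powi (d * (d - 1) div 2 + d) = qc powi (d * (d - 1) div 2)"
    by (simp add: power_int_add power_int_minus)
  then show ?thesis
    unfolding regq_def 1 2 3 tri by (simp add: mult_ac)
qed

lemma regq_holomorphic [holomorphic_intros]:
  assumes "f holomorphic_on S" "\<And>z. z \<in> S \<Longrightarrow> f z \<noteq> 0" "B \<noteq> 0"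
  shows "(\<lambda>z. regq A B (f z) d) holomorphic_on S"
  unfolding regq_def using assms by (intro holomorphic_intros) auto

text \<open>Each of the first m factors of the left \<open>qp\<close> has the form 1 - 1 / (q^i c) =
  - (1 - q^i c) / (q^i c). The powers of - c and q clear these denominators, and what remains stays
  bounded as m grows.\<close>

lemma qpoch_reverse:
  assumes "c \<noteq> 0"
  shows "qp (qc powi (1 - int m) / c) * (- c) ^ m * qc powi (int m * (int m - 1) div 2) =
    qp (qc / c) * (\<Prod>i<m. 1 - qc ^ i * c)"
proof (induction m)
  case (Suc m)
  have e: "qc powi (1 - int (Suc m)) = inverse (qc ^ m)"
    by (simp add: power_int_minus)
  have tri: "int (Suc m) * (int (Suc m) - 1) div 2 = int m * (int m - 1) div 2 + int m"
    using triangular_step[of "int m"] by (simp add: add_ac)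
  have "qp (qc powi (1 - int (Suc m)) / c) = (1 - inverse (qc ^ m) / c) * qp (qc powi (1 - int m) / c)"
    unfolding e using qpoch_rec[of "inverse (qc ^ m) / c"] by (simp add: power_int_diff field_simps)
  then have "qp (qc powi (1 - int (Suc m)) / c) * (- c) ^ Suc m * qc powi (int (Suc m) * (int (Suc m) - 1) div 2)
    = ((1 - inverse (qc ^ m) / c) * (- c) * qc ^ m) *
      (qp (qc powi (1 - int m) / c) * (- c) ^ m * qc powi (int m * (int m - 1) div 2))"
    unfolding tri by (simp add: power_int_add mult_ac)
  also have "(1 - inverse (qc ^ m) / c) * (- c) * qc ^ m = 1 - qc ^ m * c"
    using assms by (simp add: field_simps)
  finally show ?case
    unfolding Suc.IH by (simp add: mult_ac)
qed simp

lemma regq_bound_nonneg: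
  assumes "B \<noteq> 0" "0 < \<rho>1"
  shows "\<exists>C\<ge>0. \<forall>x d. \<rho>1 \<le> norm x \<longrightarrow> norm x \<le> \<rho>2 \<longrightarrow> 0 \<le> d \<longrightarrow> norm (regq A B x d) \<le> C"
proof -
  let ?e = "\<lambda>r. exp (r / (1 - q))"
  let ?C = "?e (norm A * \<rho>2) * (?e (q / (norm B * \<rho>1)) * ?e (norm B * \<rho>2))"
  have "norm (regq A B x d) \<le> ?C" if x: "\<rho>1 \<le> norm x" "norm x \<le> \<rho>2" and d: "0 \<le> d" for x d
  proof -
    obtain m where m: "d = int m"
      using d nonneg_int_cases by blast
    have x0: "x \<noteq> 0"
      using x assms by auto
    have "regq A B x d = qp (A * x * qc ^ m) * (qp (qc / (B * x)) * (\<Prod>i<m. 1 - qc ^ i * (B * x)))"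
      using qpoch_reverse[of "B * x" m] assms x0 by (simp add: regq_def m mult_ac)
    also have "norm \<dots> \<le> ?C"
      unfolding norm_mult
    proof (intro mult_mono norm_qpoch_le norm_prod_qpoch_le)
      have "q ^ m \<le> 1" using q_pos q_less_1 by (intro power_le_one) auto
      then have "norm A * norm x * q ^ m \<le> norm A * \<rho>2 * 1"
        using x assms q_pos by (intro mult_mono) auto
      then show "norm (A * x * qc ^ m) \<le> norm A * \<rho>2"
        using q_pos by (simp add: norm_mult norm_power)
      show "norm (qc / (B * x)) \<le> q / (norm B * \<rho>1)"
        using x assms q_pos by (simp add: norm_divide norm_mult) (auto intro!: divide_left_mono mult_left_mono mult_pos_pos)
      show "norm (B * x) \<le> norm B * \<rho>2"
        using x by (simp add: norm_mult mult_left_mono)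
    qed auto
    finally show ?thesis .
  qed
  then show ?thesis
    by (intro exI[of _ ?C]) auto
qed

text \<open>For negative d the reflected function is bounded on the inverted annulus, and the factor
  (A / B)^d of the reflection supplies the growth rate.\<close>

lemma regq_bound:
  assumes nz: "A \<noteq> 0" "B \<noteq> 0" and \<rho>: "0 < \<rho>1"
  shows "\<exists>C\<ge>0. \<forall>x d. \<rho>1 \<le> norm x \<longrightarrow> norm x \<le> \<rho>2 \<longrightarrow>
    norm (regq A B x d) \<le> C * (if 0 \<le> d then 1 else norm (A / B) ^ nat (- d))"
proof -
  obtain C where C: "0 \<le> C"
      "\<And>x d. \<rho>1 \<le> norm x \<Longrightarrow> norm x \<le> \<rho>2 \<Longrightarrow> 0 \<le> d \<Longrightarrow> norm (regq A B x d) \<le> C"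
    using regq_bound_nonneg[OF nz(2) \<rho>, of \<rho>2 A] by blast
  obtain C' where C': "0 \<le> C'" "\<And>x d. 1 / \<rho>2 \<le> norm x \<Longrightarrow> norm x \<le> 1 / \<rho>1 \<Longrightarrow> 0 \<le> d \<Longrightarrow>
      0 < \<rho>2 \<Longrightarrow> norm (regq (qc / B) (qc / A) x d) \<le> C'"
  proof (cases "0 < \<rho>2")
    case True
    then show ?thesis
      using regq_bound_nonneg[of "qc / A" "1 / \<rho>2" "1 / \<rho>1" "qc / B"] nz that by auto
  next
    \<comment> \<open>The added premise 0 < \<rho>2 fails here, so any constant serves.\<close>
    case False
    then show ?thesis
      using that[of 0] by auto
  qed
  have "norm (regq A B x d) \<le> (C + C') * (if 0 \<le> d then 1 else norm (A / B) ^ nat (- d))"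
    if x: "\<rho>1 \<le> norm x" "norm x \<le> \<rho>2" for x d
  proof (cases "0 \<le> d")
    case True
    then show ?thesis
      using C(2)[OF x True] C'(1) by simp
  next
    case False
    have "x \<noteq> 0"
      using x \<rho> by auto
    then have "norm (regq A B x d) = norm (A / B) powi (- d) * norm (regq (qc / B) (qc / A) (1 / x) (- d))"
      using regq_reflect[OF nz, of x "- d"] by (simp add: norm_mult norm_power_int)
    also have "norm (A / B) powi (- d) = norm (A / B) ^ nat (- d)"
      using False by (simp add: power_int_def)
    also have "norm (regq (qc / B) (qc / A) (1 / x) (- d)) \<le> C'"
    proof (rule C'(2))
      show "1 / \<rho>2 \<le> norm (1 / x)" "norm (1 / x) \<le> 1 / \<rho>1" "0 < \<rho>2"
        using x \<rho> order.strict_trans2[OF \<rho> x(1)] order.strict_trans2[OF order.strict_trans2[OF \<rho> x(1)] x(2)]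
        by (auto simp: norm_divide intro!: divide_left_mono mult_pos_pos simp del: zero_less_norm_iff)
    qed (use False in auto)
    finally have "norm (regq A B x d) \<le> norm (A / B) ^ nat (- d) * C'"
      by (simp add: mult_left_mono)
    also have "\<dots> \<le> (C + C') * norm (A / B) ^ nat (- d)"
      using C(1) by (simp add: mult_ac mult_right_mono)
    finally show ?thesis
      using False by simp
  qed
  then show ?thesis
    using C(1) C'(1) by (intro exI[of _ "C + C'"]) auto
qed

end

section \<open>Summability over the integers and over product index sets\<close>

lemma summable_on_int_geometric:
  fixes r :: real
  assumes "0 \<le> r" "r < 1"
  shows "(\<lambda>d::int. r ^ nat \<bar>d\<bar>) summable_on UNIV"
proof -
  have nat: "(\<lambda>m::nat. r ^ m) summable_on UNIV"
    using assms by (subst summable_on_UNIV_nonneg_real_iff) (auto intro: summable_geometric)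
  have bij: "bij_betw int UNIV {0..}"
    by (rule bij_betwI[of _ _ _ nat]) auto
  have "(\<lambda>d::int. r ^ nat \<bar>d\<bar>) summable_on {0..}"
    using nat summable_on_reindex_bij_betw[OF bij, of "\<lambda>d. r ^ nat \<bar>d\<bar>"] by simp
  moreover have bij': "bij_betw (\<lambda>m. - int m) UNIV {..0}"
    by (rule bij_betwI[of _ _ _ "\<lambda>d. nat (- d)"]) auto
  have "(\<lambda>d::int. r ^ nat \<bar>d\<bar>) summable_on {..0}"
    using nat summable_on_reindex_bij_betw[OF bij', of "\<lambda>d. r ^ nat \<bar>d\<bar>"] by simp
  then have "(\<lambda>d::int. r ^ nat \<bar>d\<bar>) summable_on {..<0}"
    by (rule summable_on_subset_banach) auto
  ultimately have "(\<lambda>d::int. r ^ nat \<bar>d\<bar>) summable_on ({0..} \<union> {..<0})"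
    by (intro summable_on_Un_disjoint) auto
  moreover have "{0..} \<union> {..<0} = (UNIV :: int set)"
    by auto
  ultimately show ?thesis
    by simp
qed

lemma summable_on_prod_PiE:
  fixes w :: "'b \<Rightarrow> real"
  assumes "finite A" "countable B" "w summable_on B" "\<And>b. b \<in> B \<Longrightarrow> 0 \<le> w b"
  shows "(\<lambda>g. \<Prod>x\<in>A. w (g x)) summable_on (A \<rightarrow>\<^sub>E B)"
proof -
  have "Infinite_Sum.abs_summable_on w B"
    using assms by (subst summable_on_iff_abs_summable_on_real[symmetric]) auto
  then have "Infinite_Set_Sum.abs_summable_on w B"
    by (rule abs_summable_equivalent[THEN iffD1])
  then have "Infinite_Set_Sum.abs_summable_on (\<lambda>g. \<Prod>x\<in>A. w (g x)) (A \<rightarrow>\<^sub>E B)"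
    using assms by (intro abs_summable_on_prod_PiE) auto
  then show ?thesis
    by (metis abs_summable_equivalent abs_summable_summable)
qed

lemma PiE_adjswap:
  assumes "1 \<le> a" "Suc a \<le> n" "\<nu> \<in> {1..n} \<rightarrow>\<^sub>E B"
  shows "\<nu> \<circ> adjswap a \<in> {1..n} \<rightarrow>\<^sub>E B"
  using assms by (auto simp: PiE_def extensional_def Pi_def Transposition.transpose_def)

section \<open>The series \<open>G\<close>, the divisor \<open>D\<close>, and their common
  symmetries\<close>

locale jackson = q_base +
  fixes t a1 a2 b1 b2 :: complex and n :: nat
  assumes t_nz: "t \<noteq> 0" and a_nz: "a1 \<noteq> 0" "a2 \<noteq> 0" and b_nz: "b1 \<noteq> 0" "b2 \<noteq> 0" and n_pos: "1 \<le> n"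
    and conv_0: "\<forall>i\<in>{1..n}. cmod (of_real q * t ^ (2 * i - 2)) < 1"
    and conv_inf: "\<forall>i\<in>{1..n}. q < cmod (a1 * a2 * b1 * b2 * t ^ (2 * i - 2))"
begin

text \<open>The factor of \<open>Phi\<close> belonging to one variable, taken at x q^\<nu> and
  divided by the corresponding factor of \<open>hfun\<close>.\<close>

definition fac1 :: "complex \<Rightarrow> int \<Rightarrow> complex" where
  "fac1 x \<nu> = qc powi \<nu> * (regq (qc * inverse a1) b1 x \<nu> * regq (qc * inverse a2) b2 x \<nu>)"

text \<open>The factor of \<open>Phi\<close> and \<open>Delta\<close> belonging to a pair, times x
  \<theta>(t y / x) and divided by x^(2 \<tau>). No logarithm remains: of the complex power only
  t^(2 \<nu>) survives.\<close>

definition fac2 :: "complex \<Rightarrow> complex \<Rightarrow> int \<Rightarrow> int \<Rightarrow> complex" where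
  "fac2 x y \<nu> \<mu> = t powi (2 * \<nu>) * regq (qc * inverse t) t (y / x) (\<mu> - \<nu>) * (x - y * qc powi (\<mu> - \<nu>))"

lemma fac1_qc:
  assumes "x \<noteq> 0"
  shows "fac1 (qc * x) \<nu> = fac1 x (\<nu> + 1) / (qc * b1 * b2 * x\<^sup>2)"
  using assms b_nz by (simp add: fac1_def regq_qc power_int_add power2_eq_square)

text \<open>The reflection of \<open>regq\<close> produces (q / t^2)^d. Together with t^(2 d) this
  is q^d, which the linear factor absorbs with a change of sign.\<close>

lemma fac2_swap:
  assumes "x \<noteq> 0" "y \<noteq> 0"
  shows "fac2 x y \<nu> \<mu> = - fac2 y x \<mu> \<nu>"
proof -
  define d where "d = \<mu> - \<nu>"
  let ?R = "regq (qc * inverse t) t (y / x) d"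
  have \<mu>: "\<mu> = \<nu> + d" "\<nu> - \<mu> = - d"
    by (auto simp: d_def)
  have "regq (qc * inverse t) t (x / y) (- d) =
      (qc * inverse t / t) powi d * regq (qc / t) (qc / (qc * inverse t)) (1 / (x / y)) d"
    using assms t_nz by (intro regq_reflect) auto
  also have "\<dots> = (qc * inverse t / t) powi d * ?R"
    using t_nz by (simp add: field_simps)
  finally have "fac2 y x \<mu> \<nu> = t powi (2 * \<nu>) * (t powi (2 * d) * (qc * inverse t / t) powi d) *
      ?R * (y - x * qc powi (- d))"
    unfolding fac2_def \<mu> using t_nz by (simp add: power_int_add distrib_left)
  also have "t powi (2 * d) * (qc * inverse t / t) powi d = qc powi d"
  proof -
    have "t powi (2 * d) * (qc * inverse t / t) powi d = (t\<^sup>2 * (qc * inverse t / t)) powi d"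
      by (simp only: power_int_mult power_int_mult_distrib power_int_numeral)
    also have "t\<^sup>2 * (qc * inverse t / t) = qc"
      using t_nz by (simp add: power2_eq_square field_simps)
    finally show ?thesis .
  qed
  also have "t powi (2 * \<nu>) * qc powi d * ?R * (y - x * qc powi (- d)) =
      - (t powi (2 * \<nu>) * ?R * (x - y * qc powi d))"
    by (simp add: power_int_minus field_simps)
  finally show ?thesis
    unfolding fac2_def d_def by simp
qed

lemma fac2_qc:
  assumes "x \<noteq> 0" "y \<noteq> 0"
  shows "fac2 x (qc * y) \<nu> \<mu> = - (x / (t * y)) * fac2 x y \<nu> (\<mu> + 1)"
    and "fac2 (qc * y) x \<mu> \<nu> = - (x / (t * y)) * fac2 y x (\<mu> + 1) \<nu>"
proof -
  have "regq (qc * inverse t) t (qc * y / x) (\<mu> - \<nu>) =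
      regq (qc * inverse t) t (y / x) (\<mu> + 1 - \<nu>) / (- (t * (y / x)))"
    using regq_qc[of t "y / x" "qc * inverse t" "\<mu> - \<nu>"] assms t_nz by (simp add: algebra_simps)
  moreover have "qc * y * qc powi (\<mu> - \<nu>) = y * qc powi (\<mu> + 1 - \<nu>)"
    by (simp add: power_int_add[symmetric] power_int_add power_int_diff)
  ultimately show eq: "fac2 x (qc * y) \<nu> \<mu> = - (x / (t * y)) * fac2 x y \<nu> (\<mu> + 1)"
    using assms t_nz unfolding fac2_def by simp
  show "fac2 (qc * y) x \<mu> \<nu> = - (x / (t * y)) * fac2 y x (\<mu> + 1) \<nu>"
    using eq fac2_swap[of "qc * y" x \<mu> \<nu>] fac2_swap[of y x "\<mu> + 1" \<nu>] assms by simp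
qed

text \<open>Growth rates of \<open>fac1\<close>. For negative \<nu> the two \<open>regq\<close>
  contribute the ratios q / (a1 b1) and q / (a2 b2), and the power of q in \<open>fac1\<close> takes
  away one q.\<close>

definition w1 :: "int \<Rightarrow> real" where
  "w1 \<nu> = (if 0 \<le> \<nu> then q ^ nat \<nu> else (q / cmod (a1 * a2 * b1 * b2)) ^ nat (- \<nu>))"

text \<open>The size of \<open>fac2\<close> is governed by the smaller of its two indices. A product
  of two such maxima majorizes it and separates the indices, so the bound for a whole summand
  becomes a product over single indices.\<close>

definition w2 :: "int \<Rightarrow> real" where
  "w2 \<nu> = max 1 ((cmod t)\<^sup>2 powi \<nu>)"

lemma fac1_bound:
  assumes "0 < \<rho>1"
  shows "\<exists>C\<ge>0. \<forall>x \<nu>. \<rho>1 \<le> cmod x \<longrightarrow> cmod x \<le> \<rho>2 \<longrightarrow> cmod (fac1 x \<nu>) \<le> C * w1 \<nu>"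
proof -
  obtain C1 where C1: "0 \<le> C1" "\<And>x d. \<rho>1 \<le> norm x \<Longrightarrow> norm x \<le> \<rho>2 \<Longrightarrow>
    norm (regq (qc * inverse a1) b1 x d) \<le> C1 * (if 0 \<le> d then 1 else norm (qc * inverse a1 / b1) ^ nat (- d))"
    using regq_bound[of "qc * inverse a1" b1 \<rho>1 \<rho>2] assms a_nz b_nz by auto
  obtain C2 where C2: "0 \<le> C2" "\<And>x d. \<rho>1 \<le> norm x \<Longrightarrow> norm x \<le> \<rho>2 \<Longrightarrow>
    norm (regq (qc * inverse a2) b2 x d) \<le> C2 * (if 0 \<le> d then 1 else norm (qc * inverse a2 / b2) ^ nat (- d))"
    using regq_bound[of "qc * inverse a2" b2 \<rho>1 \<rho>2] assms a_nz b_nz by auto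
  have "cmod (fac1 x \<nu>) \<le> C1 * C2 * w1 \<nu>" if x: "\<rho>1 \<le> cmod x" "cmod x \<le> \<rho>2" for x \<nu>
  proof (cases "0 \<le> \<nu>")
    case True
    have "cmod (fac1 x \<nu>) = q powi \<nu> * (norm (regq (qc * inverse a1) b1 x \<nu>) * norm (regq (qc * inverse a2) b2 x \<nu>))"
      using q_pos by (simp add: fac1_def norm_mult norm_power_int)
    also have "\<dots> \<le> q powi \<nu> * (C1 * C2)"
      using C1(1) C2(1) C1(2)[OF x, of \<nu>] C2(2)[OF x, of \<nu>] True q_pos
      by (intro mult_left_mono mult_mono) auto
    finally show ?thesis
      using True by (simp add: w1_def power_int_def mult_ac)
  next
    case False
    define m where "m = nat (- \<nu>)"
    have \<nu>: "q powi \<nu> = inverse q ^ m"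
      using False by (simp add: m_def power_int_def)
    have "cmod (fac1 x \<nu>) = inverse q ^ m * (norm (regq (qc * inverse a1) b1 x \<nu>) * norm (regq (qc * inverse a2) b2 x \<nu>))"
      using q_pos \<nu> by (simp add: fac1_def norm_mult norm_power_int)
    also have "\<dots> \<le> inverse q ^ m * ((C1 * norm (qc * inverse a1 / b1) ^ m) * (C2 * norm (qc * inverse a2 / b2) ^ m))"
      using C1(1) C2(1) C1(2)[OF x, of \<nu>] C2(2)[OF x, of \<nu>] False q_pos
      by (intro mult_left_mono mult_mono) (auto simp: m_def)
    also have "\<dots> = C1 * C2 * (inverse q * norm (qc * inverse a1 / b1) * norm (qc * inverse a2 / b2)) ^ m"
      by (simp add: power_mult_distrib mult_ac)
    also have "inverse q * norm (qc * inverse a1 / b1) * norm (qc * inverse a2 / b2) = q / cmod (a1 * a2 * b1 * b2)"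
      using q_pos by (simp add: norm_mult norm_divide norm_inverse field_simps)
    finally show ?thesis
      using False by (simp add: w1_def m_def)
  qed
  then show ?thesis
    using C1 C2 by (intro exI[of _ "C1 * C2"]) auto
qed

text \<open>For \<nu> <= \<mu> the index of \<open>regq\<close> is nonnegative and only t^(2 \<nu>)
  can grow; antisymmetry gives the other case.\<close>

lemma fac2_bound:
  assumes \<rho>: "0 < \<rho>1"
  shows "\<exists>C\<ge>0. \<forall>x y \<nu> \<mu>. \<rho>1 \<le> cmod x \<longrightarrow> cmod x \<le> \<rho>2 \<longrightarrow> \<rho>1 \<le> cmod y \<longrightarrow> cmod y \<le> \<rho>2 \<longrightarrow>
    cmod (fac2 x y \<nu> \<mu>) \<le> C * (w2 \<nu> * w2 \<mu>)"
proof (cases "\<rho>1 \<le> \<rho>2")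
  case False
  then show ?thesis
    by (intro exI[of _ 0]) auto
next
  case True
  then have \<rho>2: "0 < \<rho>2" using \<rho> by simp
  obtain C where C: "0 \<le> C" "\<And>x d. \<rho>1 / \<rho>2 \<le> norm x \<Longrightarrow> norm x \<le> \<rho>2 / \<rho>1 \<Longrightarrow> 0 \<le> d \<Longrightarrow>
      norm (regq (qc * inverse t) t x d) \<le> C"
    using regq_bound_nonneg[OF t_nz, of "\<rho>1 / \<rho>2"] \<rho> \<rho>2 by (metis divide_pos_pos)
  have le: "cmod (fac2 x y \<nu> \<mu>) \<le> C * (2 * \<rho>2) * w2 \<nu>"
    if xy: "\<rho>1 \<le> cmod x" "cmod x \<le> \<rho>2" "\<rho>1 \<le> cmod y" "cmod y \<le> \<rho>2" and d: "\<nu> \<le> \<mu>" for x y \<nu> \<mu>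
  proof -
    have "cmod (fac2 x y \<nu> \<mu>) = (cmod t)\<^sup>2 powi \<nu> * norm (regq (qc * inverse t) t (y / x) (\<mu> - \<nu>)) *
        cmod (x - y * qc powi (\<mu> - \<nu>))"
      by (simp add: fac2_def norm_mult norm_power_int power_int_mult norm_power)
    also have "\<dots> \<le> w2 \<nu> * C * (2 * \<rho>2)"
    proof (intro mult_mono)
      show "norm (regq (qc * inverse t) t (y / x) (\<mu> - \<nu>)) \<le> C"
      proof (rule C(2))
        show "\<rho>1 / \<rho>2 \<le> cmod (y / x)" "cmod (y / x) \<le> \<rho>2 / \<rho>1"
          unfolding norm_divide using xy \<rho> \<rho>2 by (intro frac_le; linarith)+
      qed (use d in auto)
      have "qc powi (\<mu> - \<nu>) = qc ^ nat (\<mu> - \<nu>)"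
        using d by (simp add: power_int_def)
      then have "norm (qc powi (\<mu> - \<nu>)) \<le> 1"
        using q_pos q_less_1 by (simp add: norm_power power_le_one)
      then have "norm (y * qc powi (\<mu> - \<nu>)) \<le> \<rho>2 * 1"
        unfolding norm_mult using xy \<rho>2 by (intro mult_mono) auto
      then show "cmod (x - y * qc powi (\<mu> - \<nu>)) \<le> 2 * \<rho>2"
        using norm_triangle_ineq4[of x "y * qc powi (\<mu> - \<nu>)"] xy by simp
    qed (use C(1) \<rho>2 in \<open>auto simp: w2_def\<close>)
    finally show ?thesis
      by (simp add: mult_ac)
  qed
  have w2: "1 \<le> w2 \<nu>" for \<nu>
    by (simp add: w2_def)
  have "cmod (fac2 x y \<nu> \<mu>) \<le> C * (2 * \<rho>2) * (w2 \<nu> * w2 \<mu>)"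
    if xy: "\<rho>1 \<le> cmod x" "cmod x \<le> \<rho>2" "\<rho>1 \<le> cmod y" "cmod y \<le> \<rho>2" for x y \<nu> \<mu>
  proof (cases "\<nu> \<le> \<mu>")
    case True
    have "w2 \<nu> * 1 \<le> w2 \<nu> * w2 \<mu>"
      using w2[of \<nu>] w2[of \<mu>] by (intro mult_left_mono) auto
    then have "C * (2 * \<rho>2) * w2 \<nu> \<le> C * (2 * \<rho>2) * (w2 \<nu> * w2 \<mu>)"
      using C(1) \<rho>2 by (intro mult_left_mono) auto
    then show ?thesis
      using le[OF xy True] by linarith
  next
    case False
    have "x \<noteq> 0" "y \<noteq> 0" using xy \<rho> by auto
    then have "cmod (fac2 x y \<nu> \<mu>) = cmod (fac2 y x \<mu> \<nu>)"
      by (simp add: fac2_swap[of x y])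
    also have "\<dots> \<le> C * (2 * \<rho>2) * w2 \<mu>"
      using False by (intro le xy) auto
    also have "1 * w2 \<mu> \<le> w2 \<nu> * w2 \<mu>"
      using w2[of \<nu>] w2[of \<mu>] by (intro mult_right_mono) auto
    then have "C * (2 * \<rho>2) * w2 \<mu> \<le> C * (2 * \<rho>2) * (w2 \<nu> * w2 \<mu>)"
      using C(1) \<rho>2 by (intro mult_left_mono) auto
    finally show ?thesis .
  qed
  then show ?thesis
    using C(1) \<rho>2 by (intro exI[of _ "C * (2 * \<rho>2)"]) auto
qed

lemma summable_weight: "(\<lambda>\<nu>. w1 \<nu> * w2 \<nu> ^ (n - 1)) summable_on UNIV"
proof -
  define T where "T = (cmod t)\<^sup>2"
  define c where "c = cmod (a1 * a2 * b1 * b2)"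
  define k where "k = n - 1"
  have T: "0 < T" and c: "0 < c"
    using t_nz a_nz b_nz by (auto simp: T_def c_def)
  have tk: "cmod (t ^ (2 * n - 2)) = T ^ k"
    using n_pos by (simp add: T_def k_def norm_power power_mult[symmetric] right_diff_distrib')
  have q1: "q < c" "q * T ^ k < 1" "q < c * T ^ k"
    using conv_inf[rule_format, of 1] conv_0[rule_format, of n] conv_inf[rule_format, of n] n_pos tk q_pos
    by (simp_all add: c_def norm_mult)
  \<comment> \<open>The four possible geometric ratios: the first two for \<nu> to +infinity, the
    last two for \<nu> to -infinity, according to which argument of the maximum in \<open>w2\<close>
    wins. They are below 1 by the convergence conditions for i = 1 and i = n.\<close>
  define r where "r = Max {q, q * T ^ k, q / c, q / (c * T ^ k)}"
  have r: "r < 1" "q \<le> r" "q * T ^ k \<le> r" "q / c \<le> r" "q / (c * T ^ k) \<le> r" "0 \<le> r"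
    using q1 q_pos q_less_1 T c unfolding r_def by (auto simp: divide_simps le_max_iff_disj)
  have bound: "w1 \<nu> * w2 \<nu> ^ k \<le> r ^ nat \<bar>\<nu>\<bar>" for \<nu>
  proof -
    define m where "m = nat \<bar>\<nu>\<bar>"
    have max: "max 1 y ^ k = (if y \<le> 1 then 1 else y ^ k)" for y :: real
      by (auto simp: max_def)
    show ?thesis
    proof (cases "0 \<le> \<nu>")
      case True
      then have \<nu>: "\<nu> = int m" by (simp add: m_def)
      have "w1 \<nu> * w2 \<nu> ^ k = q ^ m * max 1 (T ^ m) ^ k"
        by (simp add: w1_def w2_def \<nu> T_def)
      also have "\<dots> \<le> max (q ^ m) ((q * T ^ k) ^ m)"
        unfolding max by (auto simp: power_mult_distrib power_mult[symmetric] mult.commute)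
      also have "\<dots> \<le> r ^ m"
        using r q_pos T by (intro max.boundedI power_mono) auto
      finally show ?thesis
        by (simp add: m_def)
    next
      case False
      then have \<nu>: "\<nu> = - int m" "m \<noteq> 0" by (auto simp: m_def)
      have "w1 \<nu> * w2 \<nu> ^ k = (q / c) ^ m * max 1 (inverse T ^ m) ^ k"
        using \<nu> by (simp add: w1_def w2_def T_def c_def power_int_minus power_inverse)
      also have "\<dots> \<le> max ((q / c) ^ m) ((q / (c * T ^ k)) ^ m)"
        unfolding max
        by (auto simp: power_mult_distrib power_divide power_mult[symmetric] mult.commute power_inverse field_simps)
      also have "\<dots> \<le> r ^ m"
        using r q_pos T c by (intro max.boundedI power_mono) auto
      finally show ?thesis
        by (simp add: m_def)
    qed
  qed
  have nonneg: "0 \<le> w1 \<nu> * w2 \<nu> ^ k" for \<nu>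
    using q_pos c by (auto simp: w1_def w2_def c_def intro!: mult_nonneg_nonneg zero_le_power)
  have "(\<lambda>\<nu>. w1 \<nu> * w2 \<nu> ^ k) summable_on UNIV"
    by (rule summable_on_comparison_test[OF summable_on_int_geometric[OF r(6,1)]]) (use bound nonneg in auto)
  then show ?thesis
    by (simp add: k_def)
qed

text \<open>At a regular point this is the summand of \<open>Jsum\<close> times \<open>D\<close> /
  \<open>hfun\<close>; see \<open>summand_eq\<close>.\<close>

definition Gterm :: "(nat \<Rightarrow> complex) \<Rightarrow> (nat \<Rightarrow> int) \<Rightarrow> complex" where
  "Gterm x \<nu> = (\<Prod>i=1..n. fac1 (x i) (\<nu> i)) * pairprod n (\<lambda>j k. fac2 (x j) (x k) (\<nu> j) (\<nu> k))"

definition G :: "(nat \<Rightarrow> complex) \<Rightarrow> complex" where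
  "G x = (\<Sum>\<^sub>\<infinity>\<nu>\<in>{1..n} \<rightarrow>\<^sub>E UNIV. Gterm x \<nu>)"

definition D :: "(nat \<Rightarrow> complex) \<Rightarrow> complex" where
  "D x = pairprod n (\<lambda>j k. x j * \<theta> (x k / x j))"

lemma Gterm_bound:
  assumes "0 < \<rho>1"
  shows "\<exists>M. M summable_on ({1..n} \<rightarrow>\<^sub>E UNIV) \<and>
    (\<forall>x \<nu>. (\<forall>i\<in>{1..n}. \<rho>1 \<le> cmod (x i) \<and> cmod (x i) \<le> \<rho>2) \<longrightarrow> cmod (Gterm x \<nu>) \<le> M \<nu>)"
proof -
  obtain C1 where C1: "0 \<le> C1" "\<And>x \<nu>. \<rho>1 \<le> cmod x \<Longrightarrow> cmod x \<le> \<rho>2 \<Longrightarrow> cmod (fac1 x \<nu>) \<le> C1 * w1 \<nu>"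
    using fac1_bound[OF assms, of \<rho>2] by blast
  obtain C2 where C2: "0 \<le> C2" "\<And>x y \<nu> \<mu>. \<rho>1 \<le> cmod x \<Longrightarrow> cmod x \<le> \<rho>2 \<Longrightarrow> \<rho>1 \<le> cmod y \<Longrightarrow>
      cmod y \<le> \<rho>2 \<Longrightarrow> cmod (fac2 x y \<nu> \<mu>) \<le> C2 * (w2 \<nu> * w2 \<mu>)"
    using fac2_bound[OF assms, of \<rho>2] by blast
  define w where "w = (\<lambda>\<nu>. w1 \<nu> * w2 \<nu> ^ (n - 1))"
  have w_nonneg: "0 \<le> w \<nu>" for \<nu>
    using q_pos by (auto simp: w_def w1_def w2_def intro!: mult_nonneg_nonneg zero_le_power)
  define K where "K = C1 ^ n * pairprod n (\<lambda>j k. C2)"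
  define M where "M = (\<lambda>\<nu>. K * (\<Prod>i=1..n. w (\<nu> i)))"
  have "M summable_on ({1..n} \<rightarrow>\<^sub>E UNIV)"
    unfolding M_def using summable_weight w_nonneg
    by (intro summable_on_cmult_right summable_on_prod_PiE) (auto simp: w_def)
  moreover have "cmod (Gterm x \<nu>) \<le> M \<nu>"
    if x: "\<forall>i\<in>{1..n}. \<rho>1 \<le> cmod (x i) \<and> cmod (x i) \<le> \<rho>2" for x \<nu>
  proof -
    have "cmod (Gterm x \<nu>) \<le> (\<Prod>i=1..n. C1 * w1 (\<nu> i)) * pairprod n (\<lambda>j k. C2 * (w2 (\<nu> j) * w2 (\<nu> k)))"
      unfolding Gterm_def norm_mult
    proof (intro mult_mono norm_pairprod_le)
      show "norm (\<Prod>i=1..n. fac1 (x i) (\<nu> i)) \<le> (\<Prod>i=1..n. C1 * w1 (\<nu> i))"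
        unfolding prod_norm[symmetric] using x C1(2) by (intro prod_mono) auto
      show "0 \<le> (\<Prod>i=1..n. C1 * w1 (\<nu> i))"
        using C1(1) q_pos by (intro prod_nonneg mult_nonneg_nonneg) (auto simp: w1_def)
    qed (use x C2(2) in auto)
    also have "\<dots> = M \<nu>"
      by (simp add: pairprod_mult pairprod_sym_mult[unfolded pairprod_mult] prod.distrib M_def K_def w_def)
    finally show ?thesis .
  qed
  ultimately show ?thesis
    by blast
qed

lemma Gterm_holomorphic:
  assumes X: "\<And>i. i \<in> {1..n} \<Longrightarrow> (\<lambda>s. X s i) holomorphic_on S"
    and nz: "\<And>i s. i \<in> {1..n} \<Longrightarrow> s \<in> S \<Longrightarrow> X s i \<noteq> 0"
  shows "(\<lambda>s. Gterm (X s) \<nu>) holomorphic_on S"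
  unfolding Gterm_def pairprod_def fac1_def fac2_def using X nz a_nz b_nz t_nz
  by (intro holomorphic_intros) auto

text \<open>On a small disc the coordinates stay in an annulus away from 0, where
  \<open>Gterm_bound\<close> gives a majorant and hence uniform convergence. The parameter s covers
  both the variation of a single coordinate and the paths \<open>expath\<close>.\<close>

lemma G_holomorphic:
  assumes S: "open S"
    and X: "\<And>i. i \<in> {1..n} \<Longrightarrow> (\<lambda>s. X s i) holomorphic_on S"
    and nz: "\<And>i s. i \<in> {1..n} \<Longrightarrow> s \<in> S \<Longrightarrow> X s i \<noteq> 0"
  shows "(\<lambda>s. G (X s)) holomorphic_on S"
proof -
  have "(\<lambda>s. G (X s)) analytic_on {s0}" if s0: "s0 \<in> S" for s0
  proof -
    obtain r where r: "0 < r" "cball s0 r \<subseteq> S"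
      using S s0 open_contains_cball by blast
    define V where "V = (\<Union>i\<in>{1..n}. (\<lambda>s. X s i) ` cball s0 r)"
    have "continuous_on (cball s0 r) (\<lambda>s. X s i)" if "i \<in> {1..n}" for i
      using X[OF that] r(2) by (meson continuous_on_subset holomorphic_on_imp_continuous_on)
    then have V: "compact V"
      unfolding V_def by (intro compact_UN compact_continuous_image) auto
    then obtain \<rho>2 where \<rho>2: "\<And>v. v \<in> V \<Longrightarrow> cmod v \<le> \<rho>2"
      by (meson bounded_iff compact_imp_bounded)
    have "open (- V)"
      using V by (simp add: compact_imp_closed open_Compl)
    moreover have "0 \<in> - V"
      using nz r(2) by (auto simp: V_def)
    ultimately obtain \<rho>1 where \<rho>1: "0 < \<rho>1" "ball 0 \<rho>1 \<subseteq> - V"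
      using open_contains_ball by blast
    have V_bounds: "\<rho>1 \<le> cmod v \<and> cmod v \<le> \<rho>2" if "v \<in> V" for v
    proof -
      have "v \<notin> ball 0 \<rho>1"
        using that \<rho>1(2) by blast
      then show ?thesis
        using \<rho>2[OF that] by simp
    qed
    obtain M where M: "M summable_on ({1..n} \<rightarrow>\<^sub>E (UNIV :: int set))"
        "\<And>x \<nu>. (\<forall>i\<in>{1..n}. \<rho>1 \<le> cmod (x i) \<and> cmod (x i) \<le> \<rho>2) \<Longrightarrow> cmod (Gterm x \<nu>) \<le> M \<nu>"
      using Gterm_bound[OF \<rho>1(1), of \<rho>2] by blast
    have bound: "cmod (Gterm (X s) \<nu>) \<le> M \<nu>" if "s \<in> cball s0 r" for s \<nu>
    proof (rule M(2), rule ballI)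
      fix i assume "i \<in> {1..n}"
      then have "X s i \<in> V"
        using that unfolding V_def by blast
      then show "\<rho>1 \<le> cmod (X s i) \<and> cmod (X s i) \<le> \<rho>2"
        by (rule V_bounds)
    qed
    have ulim: "uniform_limit (cball s0 r) (\<lambda>A s. \<Sum>\<nu>\<in>A. Gterm (X s) \<nu>) (\<lambda>s. G (X s))
        (finite_subsets_at_top ({1..n} \<rightarrow>\<^sub>E UNIV))"
      unfolding G_def using bound M(1) by (intro Weierstrass_m_test_general) auto
    have sum_hol: "(\<lambda>s. \<Sum>\<nu>\<in>A. Gterm (X s) \<nu>) holomorphic_on S" for A
      by (intro holomorphic_intros Gterm_holomorphic X nz)
    have "continuous_on (cball s0 r) (\<lambda>s. \<Sum>\<nu>\<in>A. Gterm (X s) \<nu>) \<and>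
        (\<lambda>s. \<Sum>\<nu>\<in>A. Gterm (X s) \<nu>) holomorphic_on ball s0 r" for A
      using sum_hol r(2) ball_subset_cball
      by (meson continuous_on_subset holomorphic_on_imp_continuous_on holomorphic_on_subset order_trans)
    then have ev: "\<forall>\<^sub>F A in finite_subsets_at_top ({1..n} \<rightarrow>\<^sub>E UNIV).
        continuous_on (cball s0 r) (\<lambda>s. \<Sum>\<nu>\<in>A. Gterm (X s) \<nu>) \<and>
        (\<lambda>s. \<Sum>\<nu>\<in>A. Gterm (X s) \<nu>) holomorphic_on ball s0 r"
      by simp
    have "(\<lambda>s. G (X s)) holomorphic_on ball s0 r"
      using holomorphic_uniform_limit[OF ev ulim finite_subsets_at_top_neq_bot] .
    then show ?thesis
      using r(1) by (auto simp: analytic_at intro!: exI[of _ "ball s0 r"])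
  qed
  then show ?thesis
    by (intro analytic_imp_holomorphic, subst analytic_on_analytic_at) blast
qed

lemma D_holomorphic:
  assumes X: "\<And>i. i \<in> {1..n} \<Longrightarrow> (\<lambda>s. X s i) holomorphic_on S"
    and nz: "\<And>i s. i \<in> {1..n} \<Longrightarrow> s \<in> S \<Longrightarrow> X s i \<noteq> 0"
  shows "(\<lambda>s. D (X s)) holomorphic_on S"
  unfolding D_def pairprod_def using X nz by (intro holomorphic_intros) auto

lemma Gterm_qc:
  assumes i: "i \<in> {1..n}" and nz: "\<And>l. l \<in> {1..n} \<Longrightarrow> x l \<noteq> 0"
  shows "Gterm (x(i := qc * x i)) \<nu> =
    (\<Prod>l\<in>{1..n}-{i}. - (x l / (t * x i))) / (qc * b1 * b2 * (x i)\<^sup>2) * Gterm x (\<nu>(i := \<nu> i + 1))"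
proof -
  let ?x = "x(i := qc * x i)" and ?\<nu> = "\<nu>(i := \<nu> i + 1)"
  have "(\<Prod>l=1..n. fac1 (?x l) (\<nu> l)) = fac1 (qc * x i) (\<nu> i) * (\<Prod>l\<in>{1..n}-{i}. fac1 (x l) (\<nu> l))"
    using i by (subst prod.remove[of _ i]) (auto intro!: prod.cong)
  also have "\<dots> = 1 / (qc * b1 * b2 * (x i)\<^sup>2) * (\<Prod>l=1..n. fac1 (x l) (?\<nu> l))"
    using i by (subst prod.remove[of "{1..n}" i]) (auto intro!: prod.cong simp: fac1_qc nz)
  finally have 1: "(\<Prod>l=1..n. fac1 (?x l) (\<nu> l)) = \<dots>" .
  have "pairprod n (\<lambda>j k. fac2 (?x j) (?x k) (\<nu> j) (\<nu> k)) = (\<Prod>l\<in>{1..n}-{i}. - (x l / (t * x i))) *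
      pairprod n (\<lambda>j k. fac2 (x j) (x k) (?\<nu> j) (?\<nu> k))"
  proof (rule pairprod_row_scale[OF i])
    fix l assume l: "l \<in> {1..n}"
    show "fac2 (?x l) (?x i) (\<nu> l) (\<nu> i) = - (x l / (t * x i)) * fac2 (x l) (x i) (?\<nu> l) (?\<nu> i)" if "l < i"
      using that fac2_qc(1)[OF nz[OF l] nz[OF i]] by simp
    show "fac2 (?x i) (?x l) (\<nu> i) (\<nu> l) = - (x l / (t * x i)) * fac2 (x i) (x l) (?\<nu> i) (?\<nu> l)" if "i < l"
      using that fac2_qc(2)[OF nz[OF l] nz[OF i]] by simp
  qed auto
  with 1 show ?thesis
    unfolding Gterm_def by (simp add: mult_ac)
qed

text \<open>The factor in \<open>Gterm_qc\<close> does not depend on \<nu>, and the index set is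
  invariant under raising \<nu>_i by one.\<close>

lemma G_qc:
  assumes i: "i \<in> {1..n}" and nz: "\<And>l. l \<in> {1..n} \<Longrightarrow> x l \<noteq> 0"
  shows "G (x(i := qc * x i)) =
    (\<Prod>l\<in>{1..n}-{i}. - (x l / (t * x i))) / (qc * b1 * b2 * (x i)\<^sup>2) * G x"
proof -
  have "(\<Sum>\<^sub>\<infinity>\<nu>\<in>{1..n} \<rightarrow>\<^sub>E UNIV. Gterm x (\<nu>(i := \<nu> i + 1))) = G x"
    unfolding G_def using i
    by (intro infsum_reindex_bij_witness[of _ "\<lambda>\<nu>. \<nu>(i := \<nu> i - 1)" "\<lambda>\<nu>. \<nu>(i := \<nu> i + 1)"])
      (auto simp: PiE_def extensional_def)
  then show ?thesis
    unfolding G_def[of "x(i := qc * x i)"]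
    by (subst infsum_cong[OF Gterm_qc[OF assms]]) (simp_all only: infsum_cmult_right')
qed

lemma D_qc:
  assumes i: "i \<in> {1..n}" and nz: "\<And>l. l \<in> {1..n} \<Longrightarrow> x l \<noteq> 0"
  shows "D (x(i := qc * x i)) = (\<Prod>l\<in>{1..n}-{i}. - (x l / x i)) * D x"
  unfolding D_def
proof (rule pairprod_row_scale[OF i])
  let ?x = "x(i := qc * x i)"
  fix l assume l: "l \<in> {1..n}"
  show "?x l * \<theta> (?x i / ?x l) = - (x l / x i) * (x l * \<theta> (x i / x l))" if "l < i"
  proof -
    have "\<theta> (qc * x i / x l) = - (x l / x i) * \<theta> (x i / x l)"
      using theta_qc_mult[of "x i / x l"] nz[OF l] nz[OF i] by simp
    then show ?thesis
      using that by simp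
  qed
  show "?x i * \<theta> (?x l / ?x i) = - (x l / x i) * (x i * \<theta> (x l / x i))" if "i < l"
  proof -
    have "\<theta> (x l / (qc * x i)) = - (x l / (qc * x i)) * \<theta> (x l / x i)"
      using theta_qc_mult[of "x l / (qc * x i)"] nz[OF l] nz[OF i] by (simp add: field_simps)
    then show ?thesis
      using that by simp
  qed
qed auto

lemma Gterm_swap:
  assumes a: "1 \<le> a" "Suc a \<le> n" and nz: "\<And>l. l \<in> {1..n} \<Longrightarrow> x l \<noteq> 0"
  shows "Gterm (x \<circ> adjswap a) (\<nu> \<circ> adjswap a) = - Gterm x \<nu>"
proof -
  have "(\<Prod>i=1..n. fac1 ((x \<circ> adjswap a) i) ((\<nu> \<circ> adjswap a) i)) = (\<Prod>i=1..n. fac1 (x i) (\<nu> i))"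
    using a by (intro prod.reindex_bij_witness[of _ "adjswap a" "adjswap a"])
      (auto simp: Transposition.transpose_def)
  moreover have "pairprod n (\<lambda>j k. fac2 ((x \<circ> adjswap a) j) ((x \<circ> adjswap a) k) ((\<nu> \<circ> adjswap a) j) ((\<nu> \<circ> adjswap a) k))
      = - pairprod n (\<lambda>j k. fac2 (x j) (x k) (\<nu> j) (\<nu> k))"
    using pairprod_swap_adjacent[OF a, of "\<lambda>j k. fac2 (x j) (x k) (\<nu> j) (\<nu> k)"]
      fac2_swap[of "x (Suc a)" "x a"] nz a by simp
  ultimately show ?thesis
    unfolding Gterm_def by simp
qed

lemma G_swap:
  assumes a: "1 \<le> a" "Suc a \<le> n" and nz: "\<And>l. l \<in> {1..n} \<Longrightarrow> x l \<noteq> 0"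
  shows "G (x \<circ> adjswap a) = - G x"
proof -
  have "G (x \<circ> adjswap a) = (\<Sum>\<^sub>\<infinity>\<nu>\<in>{1..n} \<rightarrow>\<^sub>E UNIV. Gterm (x \<circ> adjswap a) (\<nu> \<circ> adjswap a))"
    unfolding G_def using PiE_adjswap[OF a]
    by (intro infsum_reindex_bij_witness[of _ "\<lambda>\<nu>. \<nu> \<circ> adjswap a" "\<lambda>\<nu>. \<nu> \<circ> adjswap a"])
      (auto simp: o_assoc[symmetric])
  also have "\<dots> = - G x"
    using Gterm_swap[OF a nz] by (simp add: G_def infsum_uminus)
  finally show ?thesis .
qed

lemma D_swap:
  assumes a: "1 \<le> a" "Suc a \<le> n" and nz: "\<And>l. l \<in> {1..n} \<Longrightarrow> x l \<noteq> 0"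
  shows "D (x \<circ> adjswap a) = - D x"
  unfolding D_def
  using pairprod_swap_adjacent[OF a, of "\<lambda>j k. x j * \<theta> (x k / x j)"]
    theta_swap[of "x a" "x (Suc a)"] nz[of a] nz[of "Suc a"] a by simp

text \<open>If the equal coordinates are adjacent, \<open>G_swap\<close> gives G x = - G x.
  Otherwise adjacent exchanges bring them together, each only changing the sign.\<close>

lemma G_eq_0:
  assumes "a \<in> {1..n}" "b \<in> {1..n}" "a \<noteq> b" "x a = x b" and nz: "\<And>l. l \<in> {1..n} \<Longrightarrow> x l \<noteq> 0"
  shows "G x = 0"
proof -
  have "G x = 0" if "1 \<le> a" "a < b" "b \<le> n" "x a = x b" "\<And>l. l \<in> {1..n} \<Longrightarrow> x l \<noteq> 0" for a b x
    using that
  proof (induction b arbitrary: x)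
    case (Suc b)
    show ?case
    proof (cases "a = b")
      case True
      then have "x \<circ> adjswap a = x"
        using Suc.prems by (auto simp: fun_eq_iff Transposition.transpose_def)
      then show ?thesis
        using G_swap[of a x] Suc.prems True by simp
    next
      case False
      let ?x = "x \<circ> adjswap b"
      have "?x l \<noteq> 0" if "l \<in> {1..n}" for l
        using Suc.prems that False by (auto simp: Transposition.transpose_def)
      moreover have "?x a = ?x b"
        using Suc.prems False by (simp add: Transposition.transpose_def)
      ultimately have "G ?x = 0"
        using Suc.prems False by (intro Suc.IH) auto
      then show ?thesis
        using G_swap[of b x] Suc.prems False by simp
    qed
  qed simp
  from this[of a b x] this[of b a x] show ?thesis
    using assms by (cases a b rule: linorder_cases) auto
qed

lemma D_eq_0_iff:
  assumes nz: "\<And>l. l \<in> {1..n} \<Longrightarrow> x l \<noteq> 0"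
  shows "D x = 0 \<longleftrightarrow> (\<exists>j\<in>{1..n}. \<exists>k\<in>{1..n}. j \<noteq> k \<and> \<theta> (x k / x j) = 0)"
proof -
  have "D x = 0 \<longleftrightarrow> (\<exists>k\<in>{1..n}. \<exists>j\<in>{1..<k}. \<theta> (x k / x j) = 0)"
    unfolding D_def pairprod_def using nz by auto
  also have "\<dots> \<longleftrightarrow> (\<exists>j\<in>{1..n}. \<exists>k\<in>{1..n}. j \<noteq> k \<and> \<theta> (x k / x j) = 0)" (is "?l = ?r")
  proof
    assume ?l
    then obtain j k where "k \<in> {1..n}" "j \<in> {1..<k}" "\<theta> (x k / x j) = 0"
      by blast
    then show ?r
      by (intro bexI[of _ j] bexI[of _ k]) auto
  next
    assume ?r
    then obtain j k where jk: "j \<in> {1..n}" "k \<in> {1..n}" "j \<noteq> k" "\<theta> (x k / x j) = 0"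
      by blast
    then have "\<theta> (x j / x k) = 0"
      using theta_swap[of "x j" "x k"] nz by simp
    then consider "j < k" | "k < j" "\<theta> (x j / x k) = 0"
      using jk by linarith
    then show ?l
    proof cases
      case 1
      then show ?thesis
        using jk by (intro bexI[of _ k] bexI[of _ j]) auto
    next
      case 2
      then show ?thesis
        using jk by (intro bexI[of _ j] bexI[of _ k]) auto
    qed
  qed
  finally show ?thesis .
qed

text \<open>Under x_i -> q x_i the multipliers of \<open>G\<close> and \<open>D\<close> have
  quotient 1 / (q \<kappa> x_i^2); the power of t collects one factor from each other
  variable.\<close>

definition \<kappa> :: complex where
  "\<kappa> = b1 * b2 * t ^ (n - 1)"

lemma \<kappa>_nz [simp]: "\<kappa> \<noteq> 0"
  using b_nz t_nz by (simp add: \<kappa>_def)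

text \<open>As functions of x_i, both \<open>G\<close> and \<open>D\<close> vanish at the n - 1
  other coordinates, \<open>G\<close> by antisymmetry. These zeros are the divisor, and two further
  nodes determine the remaining freedom.\<close>

lemma G_interpolation:
  assumes i: "i \<in> {1..n}" and nz: "\<And>l. l \<in> {1..n} \<Longrightarrow> x l \<noteq> 0" and pr: "p \<noteq> 0" "r \<noteq> 0" "y \<noteq> 0"
    and x: "\<And>l m. l \<in> {1..n} \<Longrightarrow> m \<in> {1..n} \<Longrightarrow> l \<noteq> i \<Longrightarrow> m \<noteq> i \<Longrightarrow> l \<noteq> m \<Longrightarrow> \<theta> (x l / x m) \<noteq> 0"
    and px: "\<And>l. l \<in> {1..n} \<Longrightarrow> l \<noteq> i \<Longrightarrow> \<theta> (p / x l) \<noteq> 0"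
    and rx: "\<And>l. l \<in> {1..n} \<Longrightarrow> l \<noteq> i \<Longrightarrow> \<theta> (r / x l) \<noteq> 0"
    and rp: "\<theta> (r / p) \<noteq> 0" and \<kappa>pr: "\<theta> (\<kappa> * p * r) \<noteq> 0"
  shows "G (x(i := y)) = D (x(i := y)) *
    (icoef \<kappa> p r y * (G (x(i := p)) / D (x(i := p))) + icoef \<kappa> r p y * (G (x(i := r)) / D (x(i := r))))"
proof -
  let ?I = "{1..n} - {i}"
  let ?Z = "x ` ?I"
  \<comment> \<open>The constant in the multiplier of \<open>D\<close>: the product of all - x_l
    with l different from i.\<close>
  let ?c = "(-1) ^ card ?Z * \<Prod>?Z"
  have swap: "\<theta> (v / w) \<noteq> 0 \<longleftrightarrow> \<theta> (w / v) \<noteq> 0" if "v \<noteq> 0" "w \<noteq> 0" for v w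
    using theta_swap[of v w] that by simp
  have inj: "inj_on x ?I"
  proof (rule inj_onI)
    fix l m assume lm: "l \<in> ?I" "m \<in> ?I" "x l = x m"
    show "l = m"
    proof (rule ccontr)
      assume "l \<noteq> m"
      then show False
        using x[of l m] nz[of l] lm by simp
    qed
  qed
  have cardZ: "card ?Z = n - 1"
    unfolding card_image[OF inj] using i by simp
  have prodZ: "\<Prod>?Z = (\<Prod>l\<in>?I. x l)"
    using prod.reindex[OF inj, of "\<lambda>z. z"] by simp
  have upd_nz: "(x(i := y)) l \<noteq> 0" if "y \<noteq> 0" "l \<in> {1..n}" for y l
    using nz that by simp
  have prod_row: "(\<Prod>l\<in>?I. - (x l / (e * y))) = ?c / (e * y) ^ card ?Z" for e y
  proof -
    have "(\<Prod>l\<in>?I. - (x l / (e * y))) = (\<Prod>l\<in>?I. (-1) * x l / (e * y))"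
      by simp
    also have "\<dots> = (-1) ^ card ?I * (\<Prod>l\<in>?I. x l) / (e * y) ^ card ?I"
      by (simp only: prod_dividef prod.distrib prod_constant power_mult_distrib)
    finally show ?thesis
      by (simp only: prodZ card_image[OF inj])
  qed
  have hol_upd: "(\<lambda>s. (x(i := s)) l) holomorphic_on -{0}" for l
    by (cases "l = i") (auto intro!: holomorphic_intros)
  show ?thesis
  proof (rule theta_interpolation_with_divisor[where \<phi> = "\<lambda>y. G (x(i := y))" and D = "\<lambda>y. D (x(i := y))"
        and Z = ?Z and c = ?c])
    show "(\<lambda>y. G (x(i := y))) holomorphic_on -{0}"
      using upd_nz by (intro G_holomorphic hol_upd) (auto simp: open_Compl)
    show "(\<lambda>y. D (x(i := y))) holomorphic_on -{0}"
      using upd_nz by (intro D_holomorphic hol_upd) auto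
    show "G (x(i := qc * y)) = ?c * G (x(i := y)) / (qc * \<kappa> * y ^ (card ?Z + 2))" if "y \<noteq> 0" for y
    proof -
      have "G (x(i := qc * y)) = (\<Prod>l\<in>?I. - (x l / (t * y))) / (qc * b1 * b2 * y\<^sup>2) * G (x(i := y))"
        using G_qc[OF i, of "x(i := y)"] upd_nz[OF that] by simp
      also have "\<dots> = ?c / (t * y) ^ (n - 1) / (qc * b1 * b2 * y\<^sup>2) * G (x(i := y))"
        unfolding prod_row cardZ ..
      also have "\<dots> = ?c * G (x(i := y)) / (qc * \<kappa> * y ^ (card ?Z + 2))"
        unfolding cardZ \<kappa>_def by (simp add: power_mult_distrib power_add power2_eq_square mult_ac)
      finally show ?thesis .
    qed
    show "D (x(i := qc * y)) = ?c * D (x(i := y)) / y ^ card ?Z" if "y \<noteq> 0" for y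
      using D_qc[OF i, of "x(i := y)"] upd_nz[OF that] prod_row[of 1 y] by simp
    show "G (x(i := z)) = 0" if zZ: "z \<in> ?Z" for z
    proof -
      obtain l where l: "l \<in> ?I" "z = x l"
        using zZ by blast
      then show ?thesis
        using nz i by (intro G_eq_0[of i l]) auto
    qed
    show "D (x(i := z)) = 0" if zZ: "z \<in> ?Z" for z
    proof -
      obtain l where l: "l \<in> ?I" "z = x l"
        using zZ by blast
      then have "\<theta> ((x(i := z)) l / (x(i := z)) i) = 0"
        using nz by simp
      then have ex: "\<exists>j\<in>{1..n}. \<exists>k\<in>{1..n}. j \<noteq> k \<and> \<theta> ((x(i := z)) k / (x(i := z)) j) = 0"
        using l i by (intro bexI[of _ i] bexI[of _ l] conjI) (auto simp del: fun_upd_apply)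
      have upd: "(x(i := z)) m \<noteq> 0" if "m \<in> {1..n}" for m
        using that l nz by simp
      show ?thesis
        using D_eq_0_iff[of "x(i := z)", OF upd] ex by blast
    qed
    have D_nz: "D (x(i := w)) \<noteq> 0" if "w \<noteq> 0" "\<And>l. l \<in> ?I \<Longrightarrow> \<theta> (w / x l) \<noteq> 0" for w
    proof
      assume "D (x(i := w)) = 0"
      moreover have "(x(i := w)) l \<noteq> 0" if "l \<in> {1..n}" for l
        using that nz \<open>w \<noteq> 0\<close> by simp
      ultimately obtain j k where jk: "j \<in> {1..n}" "k \<in> {1..n}" "j \<noteq> k" "\<theta> ((x(i := w)) k / (x(i := w)) j) = 0"
        using D_eq_0_iff[of "x(i := w)"] by blast
      then show False
        using that(2)[of j] that(2)[of k] x[of k j] swap[of w "x k"] \<open>w \<noteq> 0\<close> nz[of k]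
        by (auto split: if_splits)
    qed
    show "D (x(i := p)) \<noteq> 0" "D (x(i := r)) \<noteq> 0"
      by (rule D_nz; use pr px rx in auto)+
    show "p \<noteq> r"
      using rp pr by auto
    have "w \<notin> ?Z" if "w \<noteq> 0" "\<And>l. l \<in> {1..n} \<Longrightarrow> l \<noteq> i \<Longrightarrow> \<theta> (w / x l) \<noteq> 0" for w
    proof
      assume "w \<in> ?Z"
      then obtain l where "l \<in> {1..n}" "l \<noteq> i" "w = x l"
        by blast
      then show False
        using that(1) that(2)[of l] by simp
    qed
    then show "p \<notin> ?Z" "r \<notin> ?Z"
      using px rx pr by blast+
    show "?c \<noteq> 0"
      unfolding prodZ using nz by simp
    show "\<theta> (z / w) \<noteq> 0" if "z \<in> insert p (insert r ?Z)" "w \<in> insert p (insert r ?Z)" "z \<noteq> w" for z w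
    proof -
      have Z: "\<theta> (p / v) \<noteq> 0" "\<theta> (v / p) \<noteq> 0" "\<theta> (r / v) \<noteq> 0" "\<theta> (v / r) \<noteq> 0" if "v \<in> ?Z" for v
      proof -
        obtain l where "l \<in> {1..n}" "l \<noteq> i" "v = x l"
          using \<open>v \<in> ?Z\<close> by blast
        then show "\<theta> (p / v) \<noteq> 0" "\<theta> (v / p) \<noteq> 0" "\<theta> (r / v) \<noteq> 0" "\<theta> (v / r) \<noteq> 0"
          using px[of l] rx[of l] swap[of v p] swap[of v r] nz[of l] pr by auto
      qed
      have ZZ: "\<theta> (v / w) \<noteq> 0" if "v \<in> ?Z" "w \<in> ?Z" "v \<noteq> w" for v w
        using that x by blast
      have "\<theta> (p / r) \<noteq> 0"
        using swap[of p r] rp pr by blast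
      with that rp Z ZZ show ?thesis
        by (elim insertE) blast+
    qed
  qed (use nz pr \<kappa>pr in auto)
qed

end

subsection \<open>The holomorphic extension\<close>

lemma torus_eq_expt:
  assumes "x \<in> torus n"
  shows "x = expt n (\<lambda>i. Ln (x i))"
  using assms by (auto simp: torus_def expt_def fun_eq_iff PiE_def Pi_def extensional_def restrict_def)

lemma torus_nz: "x \<in> torus n \<Longrightarrow> i \<in> {1..n} \<Longrightarrow> x i \<noteq> 0"
  by (auto simp: torus_def)

lemma torus_upd: "x \<in> torus n \<Longrightarrow> i \<in> {1..n} \<Longrightarrow> w \<noteq> 0 \<Longrightarrow> x(i := w) \<in> torus n"
  by (auto simp: torus_def PiE_def extensional_def Pi_def)

lemma torus_adjswap: "x \<in> torus n \<Longrightarrow> 1 \<le> a \<Longrightarrow> Suc a \<le> n \<Longrightarrow> x \<circ> adjswap a \<in> torus n"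
  unfolding torus_def by (intro PiE_adjswap)

lemma expt_torus: "expt n u \<in> torus n"
  by (auto simp: torus_def expt_def)

lemma torus_tendsto:
  assumes F: "holomorphic_on_torus n F" and Y: "\<And>s. Y s \<in> torus n"
    and cont: "\<And>i. i \<in> {1..n} \<Longrightarrow> continuous_on UNIV (\<lambda>s::complex. Y s i)"
  shows "(\<lambda>s. F (Y s)) \<midarrow>0\<rightarrow> F (Y 0)"
proof -
  have "continuous_on UNIV (\<lambda>s. Y s i)" for i
  proof (cases "i \<in> {1..n}")
    \<comment> \<open>Outside {1..n} every point of the torus has the value
      \<open>undefined\<close>, so this coordinate is constant.\<close>
    case False
    then have "(\<lambda>s. Y s i) = (\<lambda>s. undefined)"
      using Y by (auto simp: torus_def PiE_def extensional_def)
    then show ?thesis by (simp only: continuous_on_const)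
  qed (rule cont)
  then have "continuous_on UNIV Y"
    by (rule continuous_on_coordinatewise_then_product)
  moreover have "continuous_on (torus n) F"
    using F by (simp add: holomorphic_on_torus_def)
  ultimately have "continuous_on UNIV (\<lambda>s. F (Y s))"
    using Y by (intro continuous_on_compose2[of "torus n" F UNIV Y]) auto
  then show ?thesis
    by (simp add: continuous_on_def)
qed

text \<open>For small \<open>s \<noteq> 0\<close> this point is generic: none of the finitely many theta functions in
  question vanishes there.\<close>

definition expath :: "nat \<Rightarrow> (nat \<Rightarrow> complex) \<Rightarrow> complex \<Rightarrow> nat \<Rightarrow> complex" where
  "expath n x s = (\<lambda>j. if j \<in> {1..n} then x j * exp (of_nat j * s) else x j)"

lemma expath_0 [simp]: "expath n x 0 = x"
  by (auto simp: expath_def)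

lemma expath_torus: "x \<in> torus n \<Longrightarrow> expath n x s \<in> torus n"
  by (auto simp: expath_def torus_def PiE_def extensional_def)

lemma expath_holomorphic: "(\<lambda>s. expath n x s i) holomorphic_on S"
  by (cases "i \<in> {1..n}") (auto simp: expath_def intro!: holomorphic_intros)

context q_base
begin

text \<open>The coordinates move at the distinct speeds 1, ..., n, so every ratio varies along the
  path and hits zeros of theta only at isolated s. The value c = 0 switches the second condition
  off.\<close>

lemma eventually_path_off_diagonal:
  assumes "x \<in> torus n"
  shows "\<forall>\<^sub>F s in at 0. \<forall>j\<in>{1..n}. \<forall>k\<in>{1..n}. j \<noteq> k \<longrightarrow>
    \<theta> (expath n x s k / expath n x s j) \<noteq> 0 \<and> (c \<noteq> 0 \<longrightarrow> \<theta> (c * (expath n x s k / expath n x s j)) \<noteq> 0)"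
proof (intro eventually_ball_finite ballI)
  fix j k assume jk: "j \<in> {1..n}" "k \<in> {1..n}"
  show "\<forall>\<^sub>F s in at 0. j \<noteq> k \<longrightarrow> \<theta> (expath n x s k / expath n x s j) \<noteq> 0 \<and>
    (c \<noteq> 0 \<longrightarrow> \<theta> (c * (expath n x s k / expath n x s j)) \<noteq> 0)"
  proof (cases "j = k")
    case False
    have eq: "expath n x s k / expath n x s j = x k / x j * exp ((of_nat k - of_nat j) * s)" for s
      using jk by (simp add: expath_def left_diff_distrib exp_diff)
    have ev: "\<forall>\<^sub>F s in at 0. \<theta> (e * (x k / x j) * exp ((of_nat k - of_nat j) * s)) \<noteq> 0" if "e \<noteq> 0" for e
      using False jk assms that by (intro eventually_theta_exp_nonzero) (auto simp: torus_nz)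
    show ?thesis
    proof (cases "c = 0")
      case True
      then show ?thesis
        using ev[of 1] by (simp add: eq)
    next
      case c: False
      from ev[of 1] ev[OF c] show ?thesis
        unfolding eq by (simp add: mult.assoc eventually_conj_iff)
    qed
  qed simp
qed auto

lemma eventually_path_nonzero:
  assumes "x \<in> torus n" "c \<noteq> 0"
  shows "\<forall>\<^sub>F s in at 0. \<forall>j\<in>{1..n}. \<theta> (c * expath n x s j) \<noteq> 0"
proof (intro eventually_ball_finite ballI)
  fix j assume j: "j \<in> {1..n}"
  have "\<forall>\<^sub>F s in at 0. \<theta> (c * x j * exp (of_nat j * s)) \<noteq> 0"
    using j assms by (intro eventually_theta_exp_nonzero) (auto simp: torus_nz)
  then show "\<forall>\<^sub>F s in at 0. \<theta> (c * expath n x s j) \<noteq> 0"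
    using j by (simp add: expath_def mult.assoc)
qed auto

lemma exp_ln_q: "exp (of_int d * of_real (ln q)) = qc powi d"
proof -
  have "exp (complex_of_real (ln q)) = qc"
    using q_pos by (simp add: exp_of_real)
  then show ?thesis
    using exp_power_int[of "complex_of_real (ln q)" d] by simp
qed

lemma qpower_eq_exp: "qpower q \<tau> = exp (\<tau> * of_real (ln q))"
  using q_pos by (simp add: qpower_def powr_def Ln_of_real)

lemma regq_quotient:
  assumes "B \<noteq> 0" "x \<noteq> 0" "\<theta> (B * x) \<noteq> 0"
  shows "qp (A * (x * qc powi d)) / qp (B * (x * qc powi d)) = regq A B x d / \<theta> (B * x)"
proof -
  have "\<theta> (B * x * qc powi d) \<noteq> 0"
    using theta_qc_powi[of "B * x" d] assms by simp
  then have "qp (B * x * qc powi d) \<noteq> 0"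
    by (auto simp: theta_def)
  then show ?thesis
    using regq_theta[OF assms(1,2), of A d] assms(3) by (simp add: field_simps)
qed

end

section \<open>The quotient J / h as G / D, and its interpolation\<close>

context jackson
begin

lemma D_path_nonzero:
  assumes "x \<in> torus n"
  shows "\<forall>\<^sub>F s in at 0. D (expath n x s) \<noteq> 0"
  using eventually_path_off_diagonal[OF assms, of 0]
proof eventually_elim
  case (elim s)
  then show ?case
    using torus_nz[OF expath_torus[OF assms]] by (subst D_eq_0_iff) auto
qed

lemma G_path_tendsto: "x \<in> torus n \<Longrightarrow> (\<lambda>s. G (expath n x s)) \<midarrow>0\<rightarrow> G x"
  and D_path_tendsto: "x \<in> torus n \<Longrightarrow> (\<lambda>s. D (expath n x s)) \<midarrow>0\<rightarrow> D x"
proof -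
  assume x: "x \<in> torus n"
  have "(\<lambda>s. G (expath n x s)) holomorphic_on UNIV" "(\<lambda>s. D (expath n x s)) holomorphic_on UNIV"
    using torus_nz[OF expath_torus[OF x]]
    by (intro G_holomorphic D_holomorphic expath_holomorphic; auto)+
  then have "continuous_on UNIV (\<lambda>s. G (expath n x s))" "continuous_on UNIV (\<lambda>s. D (expath n x s))"
    by (auto intro: holomorphic_on_imp_continuous_on)
  then show "(\<lambda>s. G (expath n x s)) \<midarrow>0\<rightarrow> G x" "(\<lambda>s. D (expath n x s)) \<midarrow>0\<rightarrow> D x"
    unfolding continuous_on_def by (metis (no_types) UNIV_I expath_0)+
qed

text \<open>\<open>D\<close>, F and \<open>G\<close> are continuous along the path, so an identity
  checked at its generic points reaches its starting point, even where \<open>D\<close>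
  vanishes.\<close>

lemma torus_eq_by_density:
  assumes F: "holomorphic_on_torus n F" and x: "x \<in> torus n"
    and ev: "\<forall>\<^sub>F s in at 0. D (expath n x s) * F (expath n x s) = c * G (expath n x s)"
  shows "D x * F x = c * G x"
proof -
  have "(\<lambda>s. F (expath n x s)) \<midarrow>0\<rightarrow> F (expath n x 0)"
    by (rule torus_tendsto[OF F expath_torus[OF x]])
      (rule holomorphic_on_imp_continuous_on[OF expath_holomorphic])
  then have "(\<lambda>s. D (expath n x s) * F (expath n x s)) \<midarrow>0\<rightarrow> D x * F x"
    by (intro tendsto_mult D_path_tendsto x) simp
  then have "(\<lambda>s. c * G (expath n x s)) \<midarrow>0\<rightarrow> D x * F x"
    using ev by (simp only: tendsto_cong)
  moreover have "(\<lambda>s. c * G (expath n x s)) \<midarrow>0\<rightarrow> c * G x"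
    by (intro tendsto_mult tendsto_const G_path_tendsto x)
  ultimately show ?thesis
    by (rule tendsto_unique[OF trivial_limit_at])
qed

text \<open>On the right the logarithms u enter only through exp (2 \<tau> u j) in
  \<open>hfun\<close>; \<open>Gterm\<close> and \<open>D\<close> depend on the point alone. This is
  why J / h is single-valued.\<close>

lemma summand_eq:
  assumes t: "t = qpower q \<tau>" and reg: "regular_point q \<tau> b1 b2 n (expt n u)"
  shows "Phi q \<tau> a1 a2 b1 b2 n (qshift q \<nu> u) * Delta n (expt n (qshift q \<nu> u)) * D (expt n u) =
    Gterm (expt n u) \<nu> * hfun q \<tau> b1 b2 n u"
proof -
  define x where "x = expt n u"
  define z where "z = expt n (qshift q \<nu> u)"
  have x: "x i = exp (u i)" "x i \<noteq> 0" and z: "z i = x i * qc powi \<nu> i" if "i \<in> {1..n}" for i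
    using that by (auto simp: x_def z_def expt_def qshift_def exp_add exp_ln_q)
  have th: "\<theta> (b1 * x i) \<noteq> 0" "\<theta> (b2 * x i) \<noteq> 0" if "i \<in> {1..n}" for i
    using reg that by (auto simp: regular_point_def x_def)
  have thp: "\<theta> (t * (x k / x j)) \<noteq> 0" if "j \<in> {1..n}" "k \<in> {1..n}" "j < k" for j k
    using reg that by (auto simp: regular_point_def x_def t)
  have single: "z i * (qp (qc * inverse a1 * z i) * qp (qc * inverse a2 * z i)) / (qp (b1 * z i) * qp (b2 * z i)) =
      fac1 (x i) (\<nu> i) * (x i / (\<theta> (b1 * x i) * \<theta> (b2 * x i)))" if i: "i \<in> {1..n}" for i
  proof -
    have "z i * (qp (qc * inverse a1 * z i) * qp (qc * inverse a2 * z i)) / (qp (b1 * z i) * qp (b2 * z i)) =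
        x i * qc powi \<nu> i * (qp (qc * inverse a1 * z i) / qp (b1 * z i)) * (qp (qc * inverse a2 * z i) / qp (b2 * z i))"
      using z[OF i] by simp
    also have "\<dots> = x i * qc powi \<nu> i * (regq (qc * inverse a1) b1 (x i) (\<nu> i) / \<theta> (b1 * x i)) *
        (regq (qc * inverse a2) b2 (x i) (\<nu> i) / \<theta> (b2 * x i))"
      unfolding z[OF i] using regq_quotient[OF _ x(2)[OF i]] b_nz th[OF i] by simp
    finally show ?thesis
      by (simp add: fac1_def mult_ac)
  qed
  have pair: "exp ((2 * \<tau> - 1) * qshift q \<nu> u j) * (qp (qc * inverse t * (z k / z j)) / qp (t * (z k / z j))) *
      (z j - z k) * (x j * \<theta> (x k / x j)) =
      fac2 (x j) (x k) (\<nu> j) (\<nu> k) * (exp (2 * \<tau> * u j) * (\<theta> (x k / x j) / \<theta> (t * (x k / x j))))"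
    if jk: "j \<in> {1..n}" "k \<in> {1..n}" "j < k" for j k
  proof -
    have ratio: "z k / z j = x k / x j * qc powi (\<nu> k - \<nu> j)"
      using z[OF jk(1)] z[OF jk(2)] by (simp add: power_int_diff)
    have quot: "qp (qc * inverse t * (z k / z j)) / qp (t * (z k / z j)) =
        regq (qc * inverse t) t (x k / x j) (\<nu> k - \<nu> j) / \<theta> (t * (x k / x j))"
      unfolding ratio by (rule regq_quotient) (use thp[OF jk] t_nz x jk in auto)
    have "exp ((2 * \<tau> - 1) * qshift q \<nu> u j) = exp (2 * \<tau> * u j) * exp (of_int (2 * \<nu> j) * (\<tau> * of_real (ln q))) /
        exp (qshift q \<nu> u j)"
      by (simp add: qshift_def exp_add[symmetric] exp_diff[symmetric] algebra_simps)
    also have "exp (of_int (2 * \<nu> j) * (\<tau> * of_real (ln q))) = t powi (2 * \<nu> j)"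
      unfolding t qpower_eq_exp by (rule exp_power_int[symmetric])
    also have "exp (qshift q \<nu> u j) = z j"
      using jk by (simp add: z_def expt_def)
    finally have e: "exp ((2 * \<tau> - 1) * qshift q \<nu> u j) = exp (2 * \<tau> * u j) * t powi (2 * \<nu> j) / z j" .
    \<comment> \<open>The exponent 2 \<tau> - 1 leaves 1 / z_j. With the difference from
      \<open>Delta\<close> and the x_j from \<open>D\<close> this gives the linear factor of
      \<open>fac2\<close>.\<close>
    have zx: "(z j - z k) * x j / z j = x j - x k * qc powi (\<nu> k - \<nu> j)"
      using x jk by (simp add: z power_int_diff field_simps)
    have step: "exp (2 * \<tau> * u j) * t powi (2 * \<nu> j) / z j * (r / \<theta> (t * (x k / x j))) *
        (z j - z k) * (x j * \<theta> (x k / x j)) =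
        exp (2 * \<tau> * u j) * t powi (2 * \<nu> j) * ((z j - z k) * x j / z j) * r *
          (\<theta> (x k / x j) / \<theta> (t * (x k / x j)))" for r
      by (simp add: mult_ac)
    show ?thesis
      unfolding quot e step zx fac2_def by (simp add: mult_ac)
  qed
  have Phi: "Phi q \<tau> a1 a2 b1 b2 n (qshift q \<nu> u) =
      (\<Prod>i=1..n. fac1 (x i) (\<nu> i) * (x i / (\<theta> (b1 * x i) * \<theta> (b2 * x i)))) *
      pairprod n (\<lambda>j k. exp ((2 * \<tau> - 1) * qshift q \<nu> u j) *
        (qp (qc * inverse t * (z k / z j)) / qp (t * (z k / z j))))"
    unfolding Phi_def Let_def pairprod_def z_def[symmetric] t[symmetric]
    by (intro arg_cong2[where f = "(*)"] prod.cong single) auto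
  have Delta: "Delta n z = pairprod n (\<lambda>j k. z j - z k)"
    by (simp add: Delta_def pairprod_def)
  have hfun: "hfun q \<tau> b1 b2 n u = (\<Prod>i=1..n. x i / (\<theta> (b1 * x i) * \<theta> (b2 * x i))) *
      pairprod n (\<lambda>j k. exp (2 * \<tau> * u j) * (\<theta> (x k / x j) / \<theta> (t * (x k / x j))))"
    by (simp add: hfun_def pairprod_def Let_def x_def t)
  have pairs: "pairprod n (\<lambda>j k. exp ((2 * \<tau> - 1) * qshift q \<nu> u j) * (qp (qc * inverse t * (z k / z j)) / qp (t * (z k / z j)))) *
      pairprod n (\<lambda>j k. z j - z k) * pairprod n (\<lambda>j k. x j * \<theta> (x k / x j)) =
      pairprod n (\<lambda>j k. fac2 (x j) (x k) (\<nu> j) (\<nu> k)) *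
      pairprod n (\<lambda>j k. exp (2 * \<tau> * u j) * (\<theta> (x k / x j) / \<theta> (t * (x k / x j))))"
    unfolding pairprod_mult[symmetric] by (rule pairprod_cong) (rule pair)
  show ?thesis
    unfolding x_def[symmetric] z_def[symmetric] Phi Delta hfun Gterm_def D_def prod.distrib
    using arg_cong[OF pairs, of "\<lambda>p. (\<Prod>i=1..n. fac1 (x i) (\<nu> i)) * (\<Prod>i=1..n. x i / (\<theta> (b1 * x i) * \<theta> (b2 * x i))) * p"]
    by (simp only: mult_ac)
qed

text \<open>The ratio of a summand of \<open>Jsum\<close> to \<open>Gterm\<close> is
  \<open>hfun\<close> / \<open>D\<close>, which is independent of \<nu> and can be taken out of the
  sum.\<close>

lemma J_eq:
  assumes t: "t = qpower q \<tau>" and reg: "regular_point q \<tau> b1 b2 n (expt n u)"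
  shows "Jsum q \<tau> a1 a2 b1 b2 n u / hfun q \<tau> b1 b2 n u = (1 - qc) ^ n * (G (expt n u) / D (expt n u))"
    and "D (expt n u) \<noteq> 0"
proof -
  define x where "x = expt n u"
  have x: "x i \<noteq> 0" if "i \<in> {1..n}" for i
    using that by (simp add: x_def expt_def)
  show D: "D (expt n u) \<noteq> 0"
    unfolding D_def pairprod_def x_def[symmetric] using reg x by (auto simp: regular_point_def x_def)
  have h: "hfun q \<tau> b1 b2 n u \<noteq> 0"
    using reg x unfolding hfun_def Let_def x_def[symmetric] by (auto simp: regular_point_def x_def)
  have "Phi q \<tau> a1 a2 b1 b2 n (qshift q \<nu> u) * Delta n (expt n (qshift q \<nu> u)) =
      hfun q \<tau> b1 b2 n u / D (expt n u) * Gterm (expt n u) \<nu>" for \<nu>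
    using summand_eq[OF assms, of \<nu>] D by (simp add: field_simps)
  then have "Jsum q \<tau> a1 a2 b1 b2 n u = (1 - qc) ^ n * (hfun q \<tau> b1 b2 n u / D (expt n u) * G (expt n u))"
    unfolding Jsum_def G_def by (simp only: infsum_cmult_right')
  then show "Jsum q \<tau> a1 a2 b1 b2 n u / hfun q \<tau> b1 b2 n u = (1 - qc) ^ n * (G (expt n u) / D (expt n u))"
    using h by simp
qed

lemma eventually_regular:
  assumes t: "t = qpower q \<tau>" and x: "x \<in> torus n"
  shows "\<forall>\<^sub>F s in at 0. regular_point q \<tau> b1 b2 n (expath n x s)"
  using eventually_path_off_diagonal[OF x, of t] eventually_path_nonzero[OF x b_nz(1)]
    eventually_path_nonzero[OF x b_nz(2)]
  by eventually_elim (use t_nz in \<open>auto simp: regular_point_def t[symmetric]\<close>)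

text \<open>Interpolation in the first \<open>m\<close> coordinates, the nodes for the \<open>i\<close>-th one being
  \<open>p i\<close> and \<open>r i\<close>.  For \<open>m = n\<close> this is manifestly holomorphic.\<close>

primrec interp :: "(nat \<Rightarrow> complex) \<Rightarrow> (nat \<Rightarrow> complex) \<Rightarrow> nat \<Rightarrow> (nat \<Rightarrow> complex) \<Rightarrow> complex" where
  "interp p r 0 x = G x / D x"
| "interp p r (Suc m) x =
    icoef \<kappa> (p (Suc m)) (r (Suc m)) (x (Suc m)) * interp p r m (x(Suc m := p (Suc m))) +
    icoef \<kappa> (r (Suc m)) (p (Suc m)) (x (Suc m)) * interp p r m (x(Suc m := r (Suc m)))"

text \<open>The coordinates beyond m are fixed to c, so at the bottom of the recursion G / D is
  evaluated at a single point. The dependence on s comes from the coefficients \<open>icoef\<close>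
  alone.\<close>

lemma interp_continuous:
  assumes "\<And>i. i \<in> {1..m} \<Longrightarrow> continuous_on S (\<lambda>s. X s i)" "\<And>i s. i \<in> {1..m} \<Longrightarrow> s \<in> S \<Longrightarrow> X s i \<noteq> 0"
    and "\<And>i s. i \<notin> {1..m} \<Longrightarrow> s \<in> S \<Longrightarrow> X s i = c i"
    and nz: "\<And>i. p i \<noteq> 0" "\<And>i. r i \<noteq> 0"
  shows "continuous_on S (\<lambda>s. interp p r m (X s))"
  using assms(1-3)
proof (induction m arbitrary: X c)
  case 0
  have "X s = c" if "s \<in> S" for s
    using 0(3)[OF _ that] by auto
  then have "continuous_on S (\<lambda>s. interp p r 0 (X s)) \<longleftrightarrow> continuous_on S (\<lambda>s. interp p r 0 c)"
    by (intro continuous_on_cong) auto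
  then show ?case by simp
next
  case (Suc m)
  have IH: "continuous_on S (\<lambda>s. interp p r m ((X s)(Suc m := w)))" for w
    by (rule Suc.IH[where c = "c(Suc m := w)"]) (use Suc.prems in auto)
  show ?case
    unfolding interp.simps using Suc.prems nz by (intro continuous_intros IH) auto
qed

lemma interp_holomorphic:
  assumes "\<And>i. i \<in> {1..m} \<Longrightarrow> (\<lambda>s. X s i) holomorphic_on S" "\<And>i s. i \<in> {1..m} \<Longrightarrow> s \<in> S \<Longrightarrow> X s i \<noteq> 0"
    and "\<And>i s. i \<notin> {1..m} \<Longrightarrow> s \<in> S \<Longrightarrow> X s i = c i"
    and nz: "\<And>i. p i \<noteq> 0" "\<And>i. r i \<noteq> 0"
  shows "(\<lambda>s. interp p r m (X s)) holomorphic_on S"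
  using assms(1-3)
proof (induction m arbitrary: X c)
  case 0
  have "X s = c" if "s \<in> S" for s
    using 0(3)[OF _ that] by auto
  then have "(\<lambda>s. interp p r 0 (X s)) holomorphic_on S \<longleftrightarrow> (\<lambda>s. interp p r 0 c) holomorphic_on S"
    by (intro holomorphic_cong) auto
  then show ?case by simp
next
  case (Suc m)
  have IH: "(\<lambda>s. interp p r m ((X s)(Suc m := w))) holomorphic_on S" for w
    by (rule Suc.IH[where c = "c(Suc m := w)"]) (use Suc.prems in auto)
  show ?case
    unfolding interp.simps using Suc.prems nz by (intro holomorphic_intros IH) auto
qed

text \<open>\<open>G_interpolation\<close> is applied to one variable after the other and divided by
  \<open>D\<close>. The nodes are separated from x and from each other so that every intermediate
  point, part x and part nodes, avoids the zeros of \<open>D\<close>.\<close>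

lemma interp_eq:
  assumes nz: "\<And>i. p i \<noteq> 0" "\<And>i. r i \<noteq> 0"
    and pr: "\<And>i. i \<in> {1..n} \<Longrightarrow> \<theta> (r i / p i) \<noteq> 0" "\<And>i. i \<in> {1..n} \<Longrightarrow> \<theta> (\<kappa> * p i * r i) \<noteq> 0"
    and sep: "\<And>i j. i \<in> {1..n} \<Longrightarrow> j \<in> {1..n} \<Longrightarrow> i \<noteq> j \<Longrightarrow>
      \<theta> (p i / p j) \<noteq> 0 \<and> \<theta> (p i / r j) \<noteq> 0 \<and> \<theta> (r i / p j) \<noteq> 0 \<and> \<theta> (r i / r j) \<noteq> 0"
    and m: "m \<le> n" and x_nz: "\<And>l. l \<in> {1..n} \<Longrightarrow> x l \<noteq> 0"
    and x: "\<And>j k. j \<in> {1..n} \<Longrightarrow> k \<in> {1..n} \<Longrightarrow> j \<noteq> k \<Longrightarrow> \<theta> (x j / x k) \<noteq> 0"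
    and px: "\<And>i k. i \<in> {1..m} \<Longrightarrow> k \<in> {1..n} \<Longrightarrow> \<theta> (p i / x k) \<noteq> 0 \<and> \<theta> (r i / x k) \<noteq> 0"
  shows "interp p r m x = G x / D x"
  using m x_nz x px
proof (induction m arbitrary: x)
  case (Suc m)
  let ?i = "Suc m"
  have i: "?i \<in> {1..n}"
    using Suc.prems by simp
  have swap: "\<theta> (v / w) \<noteq> 0" if "v \<noteq> 0" "w \<noteq> 0" "\<theta> (w / v) \<noteq> 0" for v w
    using theta_swap[of v w] that by simp
  have IH: "interp p r m (x(?i := w)) = G (x(?i := w)) / D (x(?i := w))"
    if w: "w \<noteq> 0" "\<And>k. k \<in> {1..n} \<Longrightarrow> \<theta> (w / x k) \<noteq> 0"
      "\<And>j. j \<in> {1..m} \<Longrightarrow> \<theta> (p j / w) \<noteq> 0 \<and> \<theta> (r j / w) \<noteq> 0" for w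
  proof (rule Suc.IH)
    show "\<theta> ((x(?i := w)) j / (x(?i := w)) k) \<noteq> 0" if "j \<in> {1..n}" "k \<in> {1..n}" "j \<noteq> k" for j k
      using that w Suc.prems(2,3) swap[of "x j" w] by auto
    show "\<theta> (p j / (x(?i := w)) k) \<noteq> 0 \<and> \<theta> (r j / (x(?i := w)) k) \<noteq> 0" if "j \<in> {1..m}" "k \<in> {1..n}" for j k
      using that w Suc.prems(4)[of j k] by auto
  qed (use Suc.prems w in auto)
  have p: "interp p r m (x(?i := p ?i)) = G (x(?i := p ?i)) / D (x(?i := p ?i))"
    by (rule IH) (use nz Suc.prems(1) Suc.prems(4)[of ?i] sep i in auto)
  have r: "interp p r m (x(?i := r ?i)) = G (x(?i := r ?i)) / D (x(?i := r ?i))"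
    by (rule IH) (use nz Suc.prems(1) Suc.prems(4)[of ?i] sep i in auto)
  have "G (x(?i := x ?i)) = D (x(?i := x ?i)) *
    (icoef \<kappa> (p ?i) (r ?i) (x ?i) * (G (x(?i := p ?i)) / D (x(?i := p ?i))) +
     icoef \<kappa> (r ?i) (p ?i) (x ?i) * (G (x(?i := r ?i)) / D (x(?i := r ?i))))"
    by (rule G_interpolation[OF i]) (use nz pr i Suc.prems in auto)
  moreover have "D x \<noteq> 0"
    using Suc.prems(2,3) by (subst D_eq_0_iff) auto
  ultimately show ?case
    unfolding interp.simps p r by simp
qed simp

text \<open>A single small s serves for all nodes exp (k s): p_i has speed k = 2 i and r_i has speed
  k = 2 i + 1, whence the range up to 2 n + 1. Distinct speeds make the ratios vary with s, and
  positive sums of speeds do the same for \<kappa> p_i r_i.\<close>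

lemma exists_nodes:
  obtains p r :: "nat \<Rightarrow> complex" where "\<And>i. p i \<noteq> 0" "\<And>i. r i \<noteq> 0"
    "\<And>i. i \<in> {1..n} \<Longrightarrow> \<theta> (r i / p i) \<noteq> 0" "\<And>i. i \<in> {1..n} \<Longrightarrow> \<theta> (\<kappa> * p i * r i) \<noteq> 0"
    "\<And>i j. i \<in> {1..n} \<Longrightarrow> j \<in> {1..n} \<Longrightarrow> i \<noteq> j \<Longrightarrow>
      \<theta> (p i / p j) \<noteq> 0 \<and> \<theta> (p i / r j) \<noteq> 0 \<and> \<theta> (r i / p j) \<noteq> 0 \<and> \<theta> (r i / r j) \<noteq> 0"
proof -
  let ?x = "\<lambda>i\<in>{1..2*n+1}. 1 :: complex"
  let ?P = "\<lambda>s j. exp (of_nat j * s) :: complex"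
  have "\<forall>\<^sub>F s in at 0. \<forall>j\<in>{1..2*n+1}. \<forall>k\<in>{1..2*n+1}. j \<noteq> k \<longrightarrow> \<theta> (?P s k / ?P s j) \<noteq> 0"
    using eventually_path_off_diagonal[of ?x "2*n+1" 0] by (simp add: expath_def torus_def)
  moreover have "\<forall>\<^sub>F s in at 0. \<forall>j\<in>{1..2*n+1}. \<forall>k\<in>{1..2*n+1}. \<theta> (\<kappa> * ?P s j * ?P s k) \<noteq> 0"
  proof (intro eventually_ball_finite ballI)
    fix j k assume jk: "j \<in> {1..2*n+1}" "k \<in> {1..2*n+1}"
    then have "of_nat j + of_nat k \<noteq> (0 :: complex)"
      by (metis Suc_le_eq add_is_0 atLeastAtMost_iff gr_implies_not0 of_nat_add of_nat_eq_0_iff One_nat_def)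
    then have "\<forall>\<^sub>F s in at 0. \<theta> (\<kappa> * exp ((of_nat j + of_nat k) * s)) \<noteq> 0"
      by (intro eventually_theta_exp_nonzero) auto
    then show "\<forall>\<^sub>F s in at 0. \<theta> (\<kappa> * ?P s j * ?P s k) \<noteq> 0"
      by (simp add: distrib_right exp_add mult.assoc)
  qed auto
  ultimately have "\<forall>\<^sub>F s in at 0. (\<forall>j\<in>{1..2*n+1}. \<forall>k\<in>{1..2*n+1}. j \<noteq> k \<longrightarrow> \<theta> (?P s k / ?P s j) \<noteq> 0) \<and>
     (\<forall>j\<in>{1..2*n+1}. \<forall>k\<in>{1..2*n+1}. \<theta> (\<kappa> * ?P s j * ?P s k) \<noteq> 0)"
    by (rule eventually_conj)
  then obtain s where s: "\<And>j k. j \<in> {1..2*n+1} \<Longrightarrow> k \<in> {1..2*n+1} \<Longrightarrow> j \<noteq> k \<Longrightarrow> \<theta> (?P s k / ?P s j) \<noteq> 0"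
     "\<And>j k. j \<in> {1..2*n+1} \<Longrightarrow> k \<in> {1..2*n+1} \<Longrightarrow> \<theta> (\<kappa> * ?P s j * ?P s k) \<noteq> 0"
    using eventually_happens'[OF trivial_limit_at] by blast
  show ?thesis
  proof (rule that[of "\<lambda>i. ?P s (2 * i)" "\<lambda>i. ?P s (2 * i + 1)"])
    show "\<theta> (?P s (2 * i + 1) / ?P s (2 * i)) \<noteq> 0" if "i \<in> {1..n}" for i
      using that by (intro s) auto
    show "\<theta> (\<kappa> * ?P s (2 * i) * ?P s (2 * i + 1)) \<noteq> 0" if "i \<in> {1..n}" for i
      using that by (intro s) auto
    show "\<theta> (?P s (2 * i) / ?P s (2 * j)) \<noteq> 0 \<and> \<theta> (?P s (2 * i) / ?P s (2 * j + 1)) \<noteq> 0 \<and>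
        \<theta> (?P s (2 * i + 1) / ?P s (2 * j)) \<noteq> 0 \<and> \<theta> (?P s (2 * i + 1) / ?P s (2 * j + 1)) \<noteq> 0"
      if "i \<in> {1..n}" "j \<in> {1..n}" "i \<noteq> j" for i j
      using that by (intro conjI s; (presburger | auto))
  qed auto
qed

text \<open>Interpolation in all n variables is defined on the whole torus. On generic points it is
  G / D by \<open>interp_eq\<close>, and the product form of this identity passes to the
  limit.\<close>

lemma exists_extension:
  obtains F where "holomorphic_on_torus n F" "\<And>x. x \<in> torus n \<Longrightarrow> D x * F x = G x"
proof -
  obtain p r where pr: "\<And>i. p i \<noteq> 0" "\<And>i. r i \<noteq> 0"
    "\<And>i. i \<in> {1..n} \<Longrightarrow> \<theta> (r i / p i) \<noteq> 0" "\<And>i. i \<in> {1..n} \<Longrightarrow> \<theta> (\<kappa> * p i * r i) \<noteq> 0"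
    "\<And>i j. i \<in> {1..n} \<Longrightarrow> j \<in> {1..n} \<Longrightarrow> i \<noteq> j \<Longrightarrow>
      \<theta> (p i / p j) \<noteq> 0 \<and> \<theta> (p i / r j) \<noteq> 0 \<and> \<theta> (r i / p j) \<noteq> 0 \<and> \<theta> (r i / r j) \<noteq> 0"
    using exists_nodes by blast
  let ?F = "interp p r n"
  have hol: "holomorphic_on_torus n ?F"
    unfolding holomorphic_on_torus_def
  proof (intro conjI ballI)
    show "continuous_on (torus n) ?F"
    proof (rule interp_continuous[where X = "\<lambda>x. x" and c = "\<lambda>_. undefined"])
      show "continuous_on (torus n) (\<lambda>x. x i)" for i
        by (rule continuous_on_subset[OF continuous_on_product_coordinates]) simp
    qed (use pr in \<open>auto simp: torus_def PiE_def extensional_def\<close>)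
    fix x i assume x: "x \<in> torus n" and i: "i \<in> {1..n}"
    show "(\<lambda>w. ?F (x(i := w))) holomorphic_on -{0}"
    proof (rule interp_holomorphic[where c = "\<lambda>_. undefined"])
      show "(\<lambda>w. (x(i := w)) j) holomorphic_on -{0}" for j
        by (cases "j = i") (auto intro!: holomorphic_intros)
      show "(x(i := w)) j = undefined" if "j \<notin> {1..n}" for j w
        using that x i by (auto simp: torus_def PiE_def extensional_def)
    qed (use pr x in \<open>auto simp: torus_nz\<close>)
  qed
  moreover have "D x * ?F x = 1 * G x" if x: "x \<in> torus n" for x
  proof (rule torus_eq_by_density[OF hol x])
    have "\<forall>\<^sub>F s in at 0. \<forall>i\<in>{1..n}. \<forall>j\<in>{1..n}. \<theta> (1 / p i * expath n x s j) \<noteq> 0 \<and> \<theta> (1 / r i * expath n x s j) \<noteq> 0"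
    proof (rule eventually_ball_finite)
      show "\<forall>i\<in>{1..n}. \<forall>\<^sub>F s in at 0. \<forall>j\<in>{1..n}. \<theta> (1 / p i * expath n x s j) \<noteq> 0 \<and> \<theta> (1 / r i * expath n x s j) \<noteq> 0"
      proof
        fix i
        show "\<forall>\<^sub>F s in at 0. \<forall>j\<in>{1..n}. \<theta> (1 / p i * expath n x s j) \<noteq> 0 \<and> \<theta> (1 / r i * expath n x s j) \<noteq> 0"
          using eventually_path_nonzero[OF x, of "1 / p i"] eventually_path_nonzero[OF x, of "1 / r i"] pr(1,2)
          by (auto elim: eventually_elim2)
      qed
    qed simp
    with eventually_path_off_diagonal[OF x, of 0] D_path_nonzero[OF x]
    show "\<forall>\<^sub>F s in at 0. D (expath n x s) * ?F (expath n x s) = 1 * G (expath n x s)"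
    proof eventually_elim
      case (elim s)
      have nz: "expath n x s j \<noteq> 0" if "j \<in> {1..n}" for j
        by (rule torus_nz[OF expath_torus[OF x] that])
      have "?F (expath n x s) = G (expath n x s) / D (expath n x s)"
      proof (rule interp_eq[OF pr])
        show "\<theta> (p i / expath n x s k) \<noteq> 0 \<and> \<theta> (r i / expath n x s k) \<noteq> 0" if "i \<in> {1..n}" "k \<in> {1..n}" for i k
          using elim that theta_swap[of "p i" "expath n x s k"] theta_swap[of "r i" "expath n x s k"] nz pr(1,2)
          by simp
      qed (use elim nz in auto)
      then show ?case
        using elim by simp
    qed
  qed
  ultimately show ?thesis
    using that by simp
qed

end

subsection \<open>Expansion of the regularized sum\<close>

text \<open>The expansion lemma uses lists, where symmetry is invariance under equal
  \<open>mset\<close>. List positions start at 0, coordinates at 1.\<close>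

definition lpoint :: "complex list \<Rightarrow> nat \<Rightarrow> complex" where
  "lpoint xs = (\<lambda>j\<in>{1..length xs}. xs ! (j - 1))"

lemma lpoint_torus: "0 \<notin> set xs \<Longrightarrow> lpoint xs \<in> torus (length xs)"
  by (auto simp: lpoint_def torus_def) (metis Suc_le_eq Suc_pred diff_is_0_eq' diff_less_Suc less_Suc_eq_le not_less_eq nth_mem)

lemma lpoint_Cons_upd: "lpoint (y # vs) = (lpoint (w # vs))(1 := y)"
  by (auto simp: lpoint_def fun_eq_iff restrict_def nth_Cons split: nat.splits)

lemma lpoint_swap: "lpoint (us @ b # a # vs) = lpoint (us @ a # b # vs) \<circ> adjswap (Suc (length us))"
proof
  fix j
  consider "j = 0" | "1 \<le> j" "j \<le> length us" | "j = Suc (length us)" | "j = Suc (Suc (length us))"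
    | k where "j = Suc (Suc (Suc (length us + k)))"
    by (metis One_nat_def Suc_le_eq add_Suc less_iff_Suc_add not_gr_zero not_less_eq_eq le_Suc_eq)
  then show "lpoint (us @ b # a # vs) j = (lpoint (us @ a # b # vs) \<circ> adjswap (Suc (length us))) j"
    by cases (auto simp: lpoint_def Transposition.transpose_def nth_append)
qed

lemma zeta_pt_eq_lpoint:
  assumes "i \<le> n"
  shows "zeta_pt t n i x1 x2 = lpoint (map (\<lambda>j. x1 * t ^ j) [0..<i] @ map (\<lambda>j. x2 * t ^ j) [0..<n - i])"
  using assms by (auto simp: zeta_pt_def lpoint_def fun_eq_iff nth_append)

context q_base
begin

text \<open>With b = b1 the factors \<theta>(Y \<kappa> / (b t^j)) become those with b2. The factors
  with b1 occur in reverse order: for j < i the exponents n - 1 - j and n - i + j run through the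
  same numbers.\<close>

lemma Hcoef_eq_zweight:
  assumes nz: "x1 \<noteq> 0" "x2 \<noteq> 0" "b1 \<noteq> 0" "b2 \<noteq> 0" "t \<noteq> 0" and i: "i \<le> n" "1 \<le> n"
  shows "Hcoef q t b1 b2 n i x1 x2 = zweight (b1 * b2 * t ^ (n - 1)) t b1 x1 x2 i (n - i)"
proof -
  let ?\<kappa> = "b1 * b2 * t ^ (n - 1)"
  have shift: "(\<Prod>j=1..m. f j) = (\<Prod>j<m. f (Suc j))" for f :: "nat \<Rightarrow> complex" and m
    using prod.shift_bounds_cl_Suc_ivl[of f 0 "m - 1"] by (cases m) (auto simp: lessThan_Suc_atMost atMost_atLeast0)
  have rev: "(\<Prod>j<m. \<theta> (c * t ^ (n - Suc j))) = (\<Prod>j<m. \<theta> (c * t ^ (n - m + j)))" if "m \<le> n" for m c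
    using that by (subst prod.nat_diff_reindex[symmetric]) (auto intro!: prod.cong arg_cong[where f = \<theta>] arg_cong[where f = "\<lambda>e. t ^ e"])
  have pw: "y * ?\<kappa> / (b1 * t ^ j) = y * b2 * t ^ (n - Suc j)" if "j < n" for y j
  proof -
    have "t ^ (n - 1) = t ^ (n - Suc j) * t ^ j"
      using that by (simp flip: power_add)
    then show ?thesis
      using nz by simp
  qed
  have e1: "x2 * inverse x1 * t powi (int n - int i - int (Suc j) + 1) = x2 / x1 * t powi (int (n - i) - int j)" for j
  proof -
    have "int n - int i - int (Suc j) + 1 = int (n - i) - int j"
      using i by simp
    then show ?thesis
      by (simp only: divide_inverse)
  qed
  have e2: "x1 * inverse x2 * t powi (int i - int (Suc k) + 1) = x1 / x2 * t powi (int i - int k)" for k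
    by (simp add: divide_inverse)
  have e3: "x1 * x2 * b1 * b2 * t ^ (n + Suc s - 2) = ?\<kappa> * x1 * x2 * t ^ s" for s
  proof -
    have "n + Suc s - 2 = (n - 1) + s"
      using i by simp
    then show ?thesis
      by (simp add: power_add mult_ac)
  qed
  have "(\<Prod>j<i. \<theta> (x2 * b2 * t ^ (n - Suc j))) = (\<Prod>j<i. \<theta> (x2 * ?\<kappa> / (b1 * t ^ j)))"
    using i pw by (intro prod.cong) auto
  note m1 = this
  have m2: "(\<Prod>j<n-i. \<theta> (x1 * b2 * t ^ (n - Suc j))) = (\<Prod>j<n-i. \<theta> (x1 * ?\<kappa> / (b1 * t ^ j)))"
    using pw by (intro prod.cong) auto
  have r1: "(\<Prod>j<i. \<theta> (x2 * b1 * t ^ (n - Suc j))) = (\<Prod>j<i. \<theta> (x2 * b1 * t ^ (n - i + j)))"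
    using rev[OF i(1)] .
  have r2: "(\<Prod>k<n-i. \<theta> (x1 * b1 * t ^ (n - Suc k))) = (\<Prod>k<n-i. \<theta> (x1 * b1 * t ^ (i + k)))"
    using rev[of "n - i"] i by simp
  show ?thesis
    unfolding Hcoef_def zweight_def shift e1 e2 e3 prod.distrib prod_dividef r1 r2 m1 m2
      le_add_diff_inverse[OF i(1)]
    by (simp only: mult_ac times_divide_times_eq times_divide_eq_right times_divide_eq_left divide_divide_eq_left)
qed

end

context jackson
begin

text \<open>Since one extension exists, the chosen function satisfies the defining conditions, and
  density extends the identity from regular points to the torus. Afterwards \<open>Jreg\<close>
  enters only through these two facts.\<close>

lemma Jreg_extension:
  assumes t: "t = qpower q \<tau>"
  defines "F \<equiv> Jreg q \<tau> a1 a2 b1 b2 n"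
  shows "holomorphic_on_torus n F" and "x \<in> torus n \<Longrightarrow> D x * F x = (1 - qc) ^ n * G x"
proof -
  obtain F0 where F0: "holomorphic_on_torus n F0" "\<And>x. x \<in> torus n \<Longrightarrow> D x * F0 x = G x"
    using exists_extension by blast
  define P where "P = (\<lambda>F. holomorphic_on_torus n F \<and> (\<forall>u. regular_point q \<tau> b1 b2 n (expt n u) \<longrightarrow>
           F (expt n u) = Jsum q \<tau> a1 a2 b1 b2 n u / hfun q \<tau> b1 b2 n u))"
  have "P (\<lambda>x. (1 - qc) ^ n * F0 x)"
    unfolding P_def
  proof (intro conjI allI impI)
    show "holomorphic_on_torus n (\<lambda>x. (1 - qc) ^ n * F0 x)"
      using F0(1) by (auto simp: holomorphic_on_torus_def intro!: continuous_intros holomorphic_intros)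
    show "(1 - qc) ^ n * F0 (expt n u) = Jsum q \<tau> a1 a2 b1 b2 n u / hfun q \<tau> b1 b2 n u"
      if "regular_point q \<tau> b1 b2 n (expt n u)" for u
    proof -
      have "F0 (expt n u) = G (expt n u) / D (expt n u)"
        using F0(2)[OF expt_torus, of u] J_eq(2)[OF t that] by (simp add: field_simps)
      then show ?thesis
        using J_eq(1)[OF t that] by simp
    qed
  qed
  then have "P F"
    unfolding F_def Jreg_def P_def[symmetric] by (rule someI[where P = P])
  then show hol: "holomorphic_on_torus n F"
    by (simp add: P_def)
  show "D x * F x = (1 - qc) ^ n * G x" if x: "x \<in> torus n"
  proof (rule torus_eq_by_density[OF hol x])
    show "\<forall>\<^sub>F s in at 0. D (expath n x s) * F (expath n x s) = (1 - qc) ^ n * G (expath n x s)"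
      using eventually_regular[OF t x]
    proof eventually_elim
      case (elim s)
      \<comment> \<open>The defining condition covers every choice of logarithms; the principal one
        is taken.\<close>
      define u where "u = (\<lambda>i. Ln (expath n x s i))"
      have u: "expath n x s = expt n u"
        unfolding u_def by (rule torus_eq_expt[OF expath_torus[OF x]])
      have "F (expt n u) = Jsum q \<tau> a1 a2 b1 b2 n u / hfun q \<tau> b1 b2 n u"
        using \<open>P F\<close> elim unfolding P_def u by blast
      then show ?case
        using J_eq[OF t, of u] elim unfolding u by simp
    qed
  qed
qed

context
  fixes F c
  assumes hol: "holomorphic_on_torus n F" and DF: "\<And>x. x \<in> torus n \<Longrightarrow> D x * F x = c * G x"
begin

text \<open>Comparing D F = c G at a point and at its shift, the factors - x_l / x_i cancel and t^(n
  - 1) is left over. Cancelling \<open>D\<close> requires a generic point, hence the limit along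
  \<open>expath\<close>.\<close>

lemma F_qc:
  assumes i: "i \<in> {1..n}" and x: "x \<in> torus n"
  shows "F (x(i := qc * x i)) = F x / (qc * \<kappa> * (x i)\<^sup>2)"
proof -
  let ?y = "\<lambda>s. expath n x s"
  have y: "?y s \<in> torus n" "(?y s)(i := qc * ?y s i) \<in> torus n" for s
    using expath_torus[OF x, of s] torus_nz[OF expath_torus[OF x] i, of s] i by (auto intro!: torus_upd)
  have eq: "F ((?y s)(i := qc * ?y s i)) = F (?y s) / (qc * \<kappa> * (?y s i)\<^sup>2)" if "D (?y s) \<noteq> 0" for s
  proof -
    let ?p = "\<Prod>l\<in>{1..n}-{i}. - (?y s l / ?y s i)"
    have nz: "?y s l \<noteq> 0" if "l \<in> {1..n}" for l
      by (rule torus_nz[OF y(1) that])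
    have "?p \<noteq> 0"
      using nz i by simp
    have "(\<Prod>l\<in>{1..n}-{i}. - (?y s l / (t * ?y s i))) = (\<Prod>l\<in>{1..n}-{i}. - (?y s l / ?y s i) / t)"
      by (intro prod.cong) auto
    also have "\<dots> = ?p / (\<Prod>l\<in>{1..n}-{i}. t)"
      by (rule prod_dividef)
    also have "(\<Prod>l\<in>{1..n}-{i}. t) = t ^ (n - 1)"
      using i by simp
    finally have "?p * D (?y s) * F ((?y s)(i := qc * ?y s i)) =
        c * (?p / t ^ (n - 1) / (qc * b1 * b2 * (?y s i)\<^sup>2) * G (?y s))"
      using DF[OF y(2)[of s]] D_qc[OF i, of "?y s"] G_qc[OF i, of "?y s"] nz by simp
    also have "\<dots> = ?p * (c * G (?y s)) / (qc * \<kappa> * (?y s i)\<^sup>2)"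
      by (simp add: \<kappa>_def mult_ac)
    also have "\<dots> = ?p * D (?y s) * (F (?y s) / (qc * \<kappa> * (?y s i)\<^sup>2))"
      unfolding DF[OF y(1)[of s], symmetric] by simp
    finally have "(?p * D (?y s)) * F ((?y s)(i := qc * ?y s i)) =
        (?p * D (?y s)) * (F (?y s) / (qc * \<kappa> * (?y s i)\<^sup>2))" .
    then show ?thesis
      using that \<open>?p \<noteq> 0\<close> mult_left_cancel[of "?p * D (?y s)"] by (metis mult_eq_0_iff)
  qed
  have cont: "continuous_on UNIV (\<lambda>s. ?y s l)" for l
    by (rule holomorphic_on_imp_continuous_on[OF expath_holomorphic])
  have lim: "(\<lambda>s. F ((?y s)(i := qc * ?y s i))) \<midarrow>0\<rightarrow> F ((?y 0)(i := qc * ?y 0 i))"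
  proof (rule torus_tendsto[OF hol y(2)])
    show "continuous_on UNIV (\<lambda>s. ((?y s)(i := qc * ?y s i)) l)" for l
      using cont by (cases "l = i") (auto intro!: continuous_intros)
  qed
  have "(\<lambda>s. F (?y s)) \<midarrow>0\<rightarrow> F (?y 0)"
    by (rule torus_tendsto[OF hol y(1)]) (rule cont)
  moreover have "(\<lambda>s. ?y s i) \<midarrow>0\<rightarrow> ?y 0 i"
    using cont[of i] unfolding continuous_on_def by blast
  ultimately have "(\<lambda>s. F (?y s) / (qc * \<kappa> * (?y s i)\<^sup>2)) \<midarrow>0\<rightarrow> F (?y 0) / (qc * \<kappa> * (?y 0 i)\<^sup>2)"
    using torus_nz[OF x i] by (intro tendsto_intros) auto
  moreover have "\<forall>\<^sub>F s in at 0. F ((?y s)(i := qc * ?y s i)) = F (?y s) / (qc * \<kappa> * (?y s i)\<^sup>2)"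
    using D_path_nonzero[OF x] by eventually_elim (rule eq)
  ultimately have "(\<lambda>s. F ((?y s)(i := qc * ?y s i))) \<midarrow>0\<rightarrow> F (?y 0) / (qc * \<kappa> * (?y 0 i)\<^sup>2)"
    by (simp only: tendsto_cong)
  from tendsto_unique[OF trivial_limit_at lim this] show ?thesis
    by simp
qed

text \<open>Off the zeros of \<open>D\<close> this is the quotient of two antisymmetric functions;
  elsewhere it follows by continuity.\<close>

lemma F_swap:
  assumes a: "1 \<le> a" "Suc a \<le> n" and x: "x \<in> torus n"
  shows "F (x \<circ> adjswap a) = F x"
proof -
  let ?y = "\<lambda>s. expath n x s"
  have y: "?y s \<in> torus n" "?y s \<circ> adjswap a \<in> torus n" for s
    using expath_torus[OF x, of s] a by (auto intro: torus_adjswap)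
  have eq: "F (?y s \<circ> adjswap a) = F (?y s)" if "D (?y s) \<noteq> 0" for s
  proof -
    have "D (?y s) * F (?y s \<circ> adjswap a) = D (?y s) * F (?y s)"
      using DF[OF y(1)[of s]] DF[OF y(2)[of s]] D_swap[OF a, of "?y s"] G_swap[OF a, of "?y s"]
        torus_nz[OF y(1), of _ s]
      by simp
    then show ?thesis
      using that by simp
  qed
  have cont: "continuous_on UNIV (\<lambda>s. ?y s l)" for l
    by (rule holomorphic_on_imp_continuous_on[OF expath_holomorphic])
  have lim: "(\<lambda>s. F (?y s \<circ> adjswap a)) \<midarrow>0\<rightarrow> F (?y 0 \<circ> adjswap a)"
    by (rule torus_tendsto[OF hol y(2)]) (use cont in simp)
  have "(\<lambda>s. F (?y s)) \<midarrow>0\<rightarrow> F (?y 0)"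
    by (rule torus_tendsto[OF hol y(1)]) (rule cont)
  moreover have "\<forall>\<^sub>F s in at 0. F (?y s \<circ> adjswap a) = F (?y s)"
    using D_path_nonzero[OF x] by eventually_elim (rule eq)
  ultimately have "(\<lambda>s. F (?y s \<circ> adjswap a)) \<midarrow>0\<rightarrow> F (?y 0)"
    by (simp only: tendsto_cong)
  from tendsto_unique[OF trivial_limit_at lim this] show ?thesis
    by simp
qed

lemma F_expansion:
  assumes nz: "x1 \<noteq> 0" "x2 \<noteq> 0"
    and H: "\<And>i. i \<le> n \<Longrightarrow> Hcoef_defined q t b1 b2 n i x1 x2"
  shows "(\<Sum>i=0..n. F (zeta_pt t n i x1 x2) * Hcoef q t b1 b2 n i x1 x2) =
    F (lpoint (map (\<lambda>j. 1 / (b1 * t ^ j)) [0..<n]))"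
proof -
  let ?F = "\<lambda>xs. F (lpoint xs)"
  let ?pt = "\<lambda>i l. map (\<lambda>j. x1 * t ^ j) [0..<i] @ map (\<lambda>j. x2 * t ^ j) [0..<l]"
  have "?F (map (\<lambda>j. 1 / (b1 * t ^ j)) [0..<n]) =
      (\<Sum>i\<le>n. zweight \<kappa> t b1 x1 x2 i (n - i) * ?F (?pt i (n - i)))"
  proof (rule symmetric_theta_expansion)
    show "\<theta> (t ^ Suc j) \<noteq> 0" if "j < n" for j
      using H[of n] that bspec[of "{1..n}" _ "Suc j"] by (auto simp: Hcoef_defined_def simp del: power_Suc)
    show "\<theta> (x2 / x1 * t powi e) \<noteq> 0" if "\<bar>e\<bar> < int n" for e
    proof -
      \<comment> \<open>The denominators of all the coefficients together cover every exponent e: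
        take i = n - e, j = 1 for e >= 0 and i = n, j = 1 - e for e < 0.\<close>
      have ne: "\<theta> (x2 * inverse x1 * t powi (int n - int i - int j + 1)) \<noteq> 0" if "i \<le> n" "j \<in> {1..i}" for i j
        using H[of i] that by (auto simp: Hcoef_defined_def)
      show ?thesis
      proof (cases "0 \<le> e")
        case True
        then show ?thesis
          using ne[of "n - nat e" 1] that by (simp add: divide_inverse of_nat_diff nat_le_iff)
      next
        case False
        then show ?thesis
          using ne[of n "nat (1 - e)"] that by (simp add: divide_inverse nat_le_iff)
      qed
    qed
    show "\<theta> (x1 / x2 * t powi e) \<noteq> 0" if "\<bar>e\<bar> < int n" for e
    proof -
      \<comment> \<open>Here e >= 0 occurs for i = e, k = 1 and e < 0 for i = 0, k = 1 - e.\<close>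
      have ne: "\<theta> (x1 * inverse x2 * t powi (int i - int k + 1)) \<noteq> 0" if "i \<le> n" "k \<in> {1..n - i}" for i k
        using H[of i] that by (auto simp: Hcoef_defined_def)
      show ?thesis
      proof (cases "0 \<le> e")
        case True
        then show ?thesis
          using ne[of "nat e" 1] that by (simp add: divide_inverse nat_le_iff nat_less_iff Suc_le_eq)
      next
        case False
        then show ?thesis
          using ne[of 0 "nat (1 - e)"] that by (simp add: divide_inverse nat_le_iff)
      qed
    qed
    show "\<theta> (\<kappa> * x1 * x2 * t ^ s) \<noteq> 0" if "s < n" for s
    proof -
      have "\<theta> (x1 * x2 * b1 * b2 * t ^ (n + Suc s - 2)) \<noteq> 0"
      proof -
        have "\<forall>l\<in>{1..n}. \<theta> (x1 * x2 * b1 * b2 * t ^ (n + l - 2)) \<noteq> 0"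
          using H[of 0] unfolding Hcoef_defined_def by blast
        then show ?thesis
          by (rule bspec) (use that in auto)
      qed
      moreover have "n + Suc s - 2 = (n - 1) + s"
        using n_pos by simp
      ultimately show ?thesis
        by (simp add: \<kappa>_def power_add mult_ac)
    qed
    show "?F xs = ?F ys" if "length xs = n" "0 \<notin> set xs" "mset xs = mset ys" for xs ys
    proof (rule mset_invariant_if_swap_invariant[where P = "\<lambda>xs. length xs = n \<and> 0 \<notin> set xs"])
      show "?F (us @ a # b # vs) = ?F (us @ b # a # vs)"
        if "length (us @ a # b # vs) = n \<and> 0 \<notin> set (us @ a # b # vs)" for us a b vs
        using F_swap[of "Suc (length us)" "lpoint (us @ a # b # vs)"] lpoint_torus[of "us @ a # b # vs"] that
        by (simp add: lpoint_swap[of us b a vs])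
      show "length ys = n \<and> 0 \<notin> set ys" if "mset xs = mset ys" "length xs = n \<and> 0 \<notin> set xs" for xs ys
        using that mset_eq_length mset_eq_setD by metis
    qed (use that in auto)
    show "(\<lambda>y. ?F (y # vs)) holomorphic_on -{0}" if "Suc (length vs) = n" "0 \<notin> set vs" for vs
    proof -
      have "lpoint (1 # vs) \<in> torus n"
        using lpoint_torus[of "1 # vs"] that by simp
      then have "(\<lambda>y. F ((lpoint (1 # vs))(1 := y))) holomorphic_on -{0}"
        using hol n_pos by (simp add: holomorphic_on_torus_def)
      moreover have "(\<lambda>y. ?F (y # vs)) = (\<lambda>y. F ((lpoint (1 # vs))(1 := y)))"
        by (rule ext, rule arg_cong[where f = F], rule lpoint_Cons_upd)
      ultimately show ?thesis
        by (simp only:)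
    qed
    show "?F (qc * y # vs) = ?F (y # vs) / (qc * \<kappa> * y\<^sup>2)"
      if "Suc (length vs) = n" "0 \<notin> set vs" "y \<noteq> 0" for y vs
    proof -
      have "lpoint (y # vs) \<in> torus n" "lpoint (y # vs) 1 = y"
        using lpoint_torus[of "y # vs"] that by (simp_all add: lpoint_def)
      then show ?thesis
        using F_qc[of 1 "lpoint (y # vs)"] n_pos by (simp add: lpoint_Cons_upd[of "qc * y" vs y])
    qed
  qed (use nz t_nz b_nz in auto)
  also have "\<dots> = (\<Sum>i\<le>n. F (zeta_pt t n i x1 x2) * Hcoef q t b1 b2 n i x1 x2)"
    using Hcoef_eq_zweight[OF nz b_nz t_nz _ n_pos] zeta_pt_eq_lpoint
    by (intro sum.cong) (auto simp: \<kappa>_def)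
  finally show ?thesis
    by (simp add: atMost_atLeast0)
qed

end

end

theorem theorem4p12:
  fixes q :: real and n :: nat and \<tau> t a1 a2 b1 b2 :: complex
  assumes "0 < q" and "q < 1" and "n \<ge> 1"
    and "a1 \<noteq> 0" and "a2 \<noteq> 0" and "b1 \<noteq> 0" and "b2 \<noteq> 0"
    and "t = qpower q \<tau>"
    and "\<forall>i\<in>{1..n}. cmod (of_real q * t ^ (2 * i - 2)) < 1"
    and "\<forall>i\<in>{1..n}. q < cmod (a1 * a2 * b1 * b2 * t ^ (2 * i - 2))"
    and "\<forall>m::nat. m \<ge> 1 \<longrightarrow> t \<noteq> of_real q ^ m"
  shows "\<exists>C1::complex. \<forall>x1 x2.
    x1 \<noteq> 0 \<longrightarrow> x2 \<noteq> 0 \<longrightarrow> (\<forall>i\<in>{0..n}. Hcoef_defined q t b1 b2 n i x1 x2) \<longrightarrow>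
    (\<Sum>i=0..n. Jreg q \<tau> a1 a2 b1 b2 n (zeta_pt t n i x1 x2) * Hcoef q t b1 b2 n i x1 x2) = C1"
proof -
  interpret q_base q
    using assms by unfold_locales
  interpret jackson q t a1 a2 b1 b2 n
    using assms by unfold_locales (auto simp: qpower_eq_exp)
  let ?F = "Jreg q \<tau> a1 a2 b1 b2 n"
  have "(\<Sum>i=0..n. ?F (zeta_pt t n i x1 x2) * Hcoef q t b1 b2 n i x1 x2) =
      ?F (lpoint (map (\<lambda>j. 1 / (b1 * t ^ j)) [0..<n]))"
    if "x1 \<noteq> 0" "x2 \<noteq> 0" "\<forall>i\<in>{0..n}. Hcoef_defined q t b1 b2 n i x1 x2" for x1 x2
    using that
    by (intro F_expansion[where c = "(1 - of_real q) ^ n"] Jreg_extension[OF assms(8)]) auto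
  then show ?thesis
    by blast
qed

end
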